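(* Let $n\ge1$ and $s=(s_1,\dots,s_n)$ with $s_\nu\in\mathbb{N}_0$, and for each $\nu$ fix admissible coefficients (as defined in the context) of level $s_\nu$. Then the system of functions $$\Psi^{(s)}_{e;ja}(x)=2^{-nj/2}\sum_{r_1=0}^{2^{s_1}-1}\cdots\sum_{r_n=0}^{2^{s_n}-1}\alpha^{(k_e)_1}_{1,r_1}\cdots\alpha^{(k_e)_n}_{n,r_n}\,\Psi^{(0)}_e\Big(2^jx-a-\Big(\frac{r_1}{2^{s_1}}(k_e)_1,\dots,\frac{r_n}{2^{s_n}}(k_e)_n\Big)\Big),\quad x\in\mathbb{Q}_2^n,$$ indexed by $e\subset\{1,\dots,n\}$ with $e\neq\emptyset$, $j\in\mathbb{Z}$, $a\in I_2^n$, is an orthonormal basis of $\mathcal{L}^2(\mathbb{Q}_2^n)$.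
   Context: $\mathbb{Q}_2$ is the field of $2$-adic numbers; on $\mathbb{Q}_2^n$ use the norm $|x|_2=\max_\nu|x_\nu|_2$ and the product Haar measure normalized so that $\mathbb{Z}_2^n$ has measure $1$. $\mathcal{L}^2(\mathbb{Q}_2^n)$ is the space of complex-valued square-integrable functions. $\chi_2(t)=e^{2\pi i\{t\}_2}$, $t\in\mathbb{Q}_2$, with $\{t\}_2$ the $2$-adic fractional part; $\xi\cdot x=\sum_\nu\xi_\nu x_\nu$. $\Omega(t)=1$ for $0\le t\le1$, $\Omega(t)=0$ for $t>1$. $I_2=\{2^{-\gamma}(a_0+a_12+\cdots+a_{\gamma-1}2^{\gamma-1}):\gamma\in\mathbb{N},\ a_j\in\{0,1\}\}\subset\mathbb{Q}_2$, $I_2^n=I_2\times\cdots\times I_2$, $\mathbb{N}_0=\{0,1,2,\dots\}$. For $e\subset\{1,\dots,n\}$, $k_e\in\{0,1\}^n$ has $(k_e)_\nu=1$ if $\nu\in e$ and $0$ otherwise, and $\Psi^{(0)}_e(x)=\chi_2(2^{-1}k_e\cdot x)\,\Omega(|x|_2)$. Admissible coefficients of level $s_\nu$: if $s_\nu\ge1$, choose $\gamma_{\nu,0},\dots,\gamma_{\nu,2^{s_\nu}-1}\in\mathbb{C}$ of modulus $1$ and put $$\alpha^1_{\nu,k}=2^{-s_\nu}(-1)^k\sum_{r=0}^{2^{s_\nu}-1}\gamma_{\nu,r}\,e^{-i\pi\frac{2r+1}{2^{s_\nu}}k},\quad k=0,\dots,2^{s_\nu}-1;$$ if $s_\nu=0$,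 put $\alpha^1_{\nu,0}=1$. In all cases put $\alpha^0_{\nu,0}=1$ and $\alpha^0_{\nu,k}=0$ for $k=1,\dots,2^{s_\nu}-1$. (The superscripts $0,1$ are indices, not powers.) The choice is fixed independently of $e,j,a$. *)

theory Defs
  imports "HOL-Probability.Probability" "HOL-Computational_Algebra.Primes"
begin

section \<open>The 2-adic absolute value on the rationals\<close>

text \<open>\<open>rabs2 (2 ^ v * a / b) = 2 powi (- v)\<close> for odd \<open>a\<close>, \<open>b\<close>; cf. \<open>rabs2_frac\<close>.\<close>

definition rabs2 :: "rat \<Rightarrow> real" where
  "rabs2 q = (if q = 0 then 0 else
     2 powi (int (multiplicity 2 (snd (quotient_of q))) - int (multiplicity 2 (fst (quotient_of q)))))"

lemma rabs2_frac:
  fixes a b :: int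
  assumes "a \<noteq> 0" "b \<noteq> 0"
  shows "rabs2 (of_int a / of_int b) = 2 powi (int (multiplicity 2 b) - int (multiplicity 2 a))"
proof -
  define q :: rat where "q = of_int a / of_int b"
  obtain c d where cd: "quotient_of q = (c, d)" by fastforce
  have d: "d > 0" using quotient_of_denom_pos[OF cd] .
  have q: "q = of_int c / of_int d" using quotient_of_div[OF cd] .
  have q0: "q \<noteq> 0" using assms by (simp add: q_def)
  have c: "c \<noteq> 0" using q q0 by auto
  have "(of_int (a * d) :: rat) = of_int (c * b)"
    using q assms d by (simp add: q_def field_simps)
  hence "a * d = c * b" by (simp only: of_int_eq_iff)
  hence "multiplicity 2 (a * d) = multiplicity 2 (c * b)" by simp
  hence "multiplicity 2 a + multiplicity 2 d = multiplicity 2 c + multiplicity 2 b"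
    using assms c d by (simp add: prime_elem_multiplicity_mult_distrib)
  hence "int (multiplicity 2 b) - int (multiplicity 2 a) = int (multiplicity 2 d) - int (multiplicity 2 c)"
    by linarith
  thus ?thesis using q0 unfolding q_def[symmetric] by (simp add: rabs2_def cd)
qed

lemma rabs2_0 [simp]: "rabs2 0 = 0"
  by (simp add: rabs2_def)

lemma rabs2_pos: "q \<noteq> 0 \<Longrightarrow> rabs2 q > 0"
  by (simp add: rabs2_def)

lemma rabs2_nonneg [simp]: "rabs2 q \<ge> 0"
  by (simp add: rabs2_def)

lemma rabs2_eq_0_iff [simp]: "rabs2 q = 0 \<longleftrightarrow> q = 0"
  by (simp add: rabs2_def)

lemma rat_cases_frac:
  obtains a b :: int where "(q :: rat) = of_int a / of_int b" "b \<noteq> 0"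
  by (metis quotient_of_denom_pos quotient_of_div less_irrefl surj_pair)

lemma rabs2_mult: "rabs2 (x * y) = rabs2 x * rabs2 y"
proof (cases "x = 0 \<or> y = 0")
  case False
  obtain a b :: int where x: "x = of_int a / of_int b" "b \<noteq> 0" by (rule rat_cases_frac)
  obtain c d :: int where y: "y = of_int c / of_int d" "d \<noteq> 0" by (rule rat_cases_frac)
  have a: "a \<noteq> 0" "c \<noteq> 0" using False x y by auto
  have xy: "x * y = of_int (a * c) / of_int (b * d)" using x y by simp
  let ?m = "\<lambda>i. int (multiplicity (2::int) i)"
  have "a * c \<noteq> 0" "b * d \<noteq> 0" using a x y by auto
  hence "rabs2 (x * y) = 2 powi (?m (b * d) - ?m (a * c))" unfolding xy by (rule rabs2_frac)
  also have "?m (b * d) - ?m (a * c) = (?m b - ?m a) + (?m d - ?m c)"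
    using a x y by (simp add: prime_elem_multiplicity_mult_distrib)
  also have "(2::real) powi \<dots> = 2 powi (?m b - ?m a) * 2 powi (?m d - ?m c)"
    by (rule power_int_add) simp
  also have "2 powi (?m b - ?m a) = rabs2 x" using rabs2_frac[of a b] a x by simp
  also have "2 powi (?m d - ?m c) = rabs2 y" using rabs2_frac[of c d] a y by simp
  finally show ?thesis .
qed auto

lemma rabs2_1 [simp]: "rabs2 1 = 1"
  using rabs2_frac[of 1 1] by simp

lemma rabs2_minus [simp]: "rabs2 (- x) = rabs2 x"
proof -
  have "multiplicity (2::int) (-1) = 0" by (simp add: not_dvd_imp_multiplicity_0)
  hence "rabs2 (-1) = 1" using rabs2_frac[of "-1" 1] by simp
  thus ?thesis using rabs2_mult[of "-1" x] by simp
qed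

lemma rabs2_minus_commute: "rabs2 (x - y) = rabs2 (y - x)"
  using rabs2_minus[of "x - y"] by simp

lemma rabs2_inverse: "rabs2 (inverse x) = inverse (rabs2 x)"
proof (cases "x = 0")
  case False
  have "rabs2 (inverse x) * rabs2 x = 1" using False by (simp add: rabs2_mult[symmetric])
  thus ?thesis by (metis inverse_unique mult.commute)
qed auto

lemma rabs2_2: "rabs2 2 = 1 / 2"
  using rabs2_frac[of 2 1] by (simp add: power_int_minus field_simps)

lemma rabs2_of_int_le_iff:
  "rabs2 (of_int m) \<le> 1 / 2 ^ k \<longleftrightarrow> 2 ^ k dvd m"
proof (cases "m = 0")
  case False
  have "rabs2 (of_int m) = 1 / 2 ^ multiplicity 2 m"
    using rabs2_frac[of m 1] False by (simp add: power_int_minus field_simps)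
  hence "rabs2 (of_int m) \<le> 1 / 2 ^ k \<longleftrightarrow> (1 / 2 :: real) ^ multiplicity 2 m \<le> (1 / 2) ^ k"
    by (simp only: power_one_over)
  also have "\<dots> \<longleftrightarrow> k \<le> multiplicity 2 m" by (rule power_decreasing_iff) auto
  also have "\<dots> \<longleftrightarrow> 2 ^ k dvd m"
    using False by (simp add: power_dvd_iff_le_multiplicity)
  finally show ?thesis .
qed auto

lemma rabs2_add_le_max: "rabs2 (x + y) \<le> max (rabs2 x) (rabs2 y)"
proof (cases "x = 0 \<or> y = 0 \<or> x + y = 0")
  case False
  obtain a b :: int where x: "x = of_int a / of_int b" "b \<noteq> 0" by (rule rat_cases_frac)
  obtain c d :: int where y: "y = of_int c / of_int d" "d \<noteq> 0" by (rule rat_cases_frac)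
  have n: "a * d \<noteq> 0" "c * b \<noteq> 0" "b * d \<noteq> 0" using False x y by auto
  have x': "x = of_int (a * d) / of_int (b * d)" using x y by simp
  have y': "y = of_int (c * b) / of_int (b * d)" using x y by simp
  have xy: "x + y = of_int (a * d + c * b) / of_int (b * d)" 
    unfolding x' y' by (simp add: add_divide_distrib)
  have n2: "a * d + c * b \<noteq> 0" using False xy by (metis div_0 of_int_0)
  let ?m = "multiplicity (2::int)"
  have "2 ^ min (?m (a * d)) (?m (c * b)) dvd a * d + c * b"
    by (intro dvd_add multiplicity_dvd') auto
  hence "min (?m (a * d)) (?m (c * b)) \<le> ?m (a * d + c * b)"
    using n2 by (simp add: multiplicity_geI)
  hence *: "?m (a * d) \<le> ?m (a * d + c * b) \<or> ?m (c * b) \<le> ?m (a * d + c * b)"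
    by linarith
  show ?thesis
    using * rabs2_frac[OF n(1,3)] rabs2_frac[OF n(2,3)] rabs2_frac[OF n2 n(3)]
    unfolding x'[symmetric] y'[symmetric] xy[symmetric]
    by (auto simp: le_max_iff_disj intro!: power_int_increasing)
qed (auto simp: max_def add_eq_0_iff)

lemma rabs2_add_le: "rabs2 (x + y) \<le> rabs2 x + rabs2 y"
  using rabs2_add_le_max[of x y] rabs2_nonneg[of x] rabs2_nonneg[of y] by linarith

lemma rabs2_diff_triangle: "\<bar>rabs2 x - rabs2 y\<bar> \<le> rabs2 (x - y)"
  using rabs2_add_le[of "x - y" y] rabs2_add_le[of "y - x" x] by (simp add: rabs2_minus_commute)

section \<open>The field of 2-adic numbers\<close>

text \<open>The completion of the rationals with respect to \<open>rabs2\<close>: Cauchy sequences modulo null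
  sequences, as for type \<open>real\<close> in the distribution.\<close>

definition cauchy2 :: "(nat \<Rightarrow> rat) \<Rightarrow> bool" where
  "cauchy2 X \<longleftrightarrow> (\<forall>\<epsilon>>0. \<exists>N. \<forall>m\<ge>N. \<forall>n\<ge>N. rabs2 (X m - X n) < \<epsilon>)"

definition vanish2 :: "(nat \<Rightarrow> rat) \<Rightarrow> bool" where
  "vanish2 X \<longleftrightarrow> (\<lambda>n. rabs2 (X n)) \<longlonglongrightarrow> 0"

definition q2rel :: "(nat \<Rightarrow> rat) \<Rightarrow> (nat \<Rightarrow> rat) \<Rightarrow> bool" where
  "q2rel X Y \<longleftrightarrow> cauchy2 X \<and> cauchy2 Y \<and> vanish2 (\<lambda>n. X n - Y n)"

lemma cauchy2D: "cauchy2 X \<Longrightarrow> \<epsilon> > 0 \<Longrightarrow> \<exists>N. \<forall>m\<ge>N. \<forall>n\<ge>N. rabs2 (X m - X n) < \<epsilon>"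
  by (auto simp: cauchy2_def)

lemma cauchy2_const [simp]: "cauchy2 (\<lambda>_. x)"
  by (auto simp: cauchy2_def)

lemma cauchy2_Cauchy: assumes "cauchy2 X" shows "Cauchy (\<lambda>n. rabs2 (X n))"
  unfolding Cauchy_def dist_real_def
  by (meson assms cauchy2D le_less_trans rabs2_diff_triangle)

lemma cauchy2_convergent: assumes "cauchy2 X" shows "convergent (\<lambda>n. rabs2 (X n))"
  using cauchy2_Cauchy[OF assms] by (simp add: Cauchy_convergent_iff)

lemma cauchy2_bounded: assumes "cauchy2 X" obtains B where "B > 0" "\<And>n. rabs2 (X n) \<le> B"
proof -
  have "Bseq (\<lambda>n. rabs2 (X n))" using assms cauchy2_convergent convergent_imp_Bseq by blast
  then obtain K where "K > 0" "\<forall>n. norm (rabs2 (X n)) \<le> K" by (auto elim: BseqE)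
  thus ?thesis using that[of K] by auto
qed

lemma cauchy2_add: assumes "cauchy2 X" "cauchy2 Y" shows "cauchy2 (\<lambda>n. X n + Y n)"
  unfolding cauchy2_def
proof safe
  fix e :: real assume e: "e > 0"
  obtain M where M: "\<forall>m\<ge>M. \<forall>n\<ge>M. rabs2 (X m - X n) < e" using cauchy2D[OF assms(1) e] by blast
  obtain N where N: "\<forall>m\<ge>N. \<forall>n\<ge>N. rabs2 (Y m - Y n) < e" using cauchy2D[OF assms(2) e] by blast
  show "\<exists>N. \<forall>m\<ge>N. \<forall>n\<ge>N. rabs2 (X m + Y m - (X n + Y n)) < e"
  proof (intro exI[of _ "max M N"] allI impI)
    fix m n assume "m \<ge> max M N" "n \<ge> max M N"
    hence "rabs2 (X m - X n) < e" "rabs2 (Y m - Y n) < e" using M N by auto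
    thus "rabs2 (X m + Y m - (X n + Y n)) < e"
      using rabs2_add_le_max[of "X m - X n" "Y m - Y n"] by (simp add: algebra_simps)
  qed
qed

lemma cauchy2_minus: assumes "cauchy2 X" shows "cauchy2 (\<lambda>n. - X n)"
  using assms unfolding cauchy2_def by (simp add: rabs2_minus_commute)

lemma cauchy2_mult: assumes "cauchy2 X" "cauchy2 Y" shows "cauchy2 (\<lambda>n. X n * Y n)"
  unfolding cauchy2_def
proof safe
  fix e :: real assume e: "e > 0"
  obtain A where A: "A > 0" "\<And>n. rabs2 (X n) \<le> A" using cauchy2_bounded[OF assms(1)] by blast
  obtain B where B: "B > 0" "\<And>n. rabs2 (Y n) \<le> B" using cauchy2_bounded[OF assms(2)] by blast
  obtain M where M: "\<forall>m\<ge>M. \<forall>n\<ge>M. rabs2 (X m - X n) < e / B"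
    using cauchy2D[OF assms(1), of "e / B"] e B by auto
  obtain N where N: "\<forall>m\<ge>N. \<forall>n\<ge>N. rabs2 (Y m - Y n) < e / A" 
    using cauchy2D[OF assms(2), of "e / A"] e A by auto
  show "\<exists>N. \<forall>m\<ge>N. \<forall>n\<ge>N. rabs2 (X m * Y m - X n * Y n) < e"
  proof (intro exI[of _ "max M N"] allI impI)
    fix m n assume "m \<ge> max M N" "n \<ge> max M N"
    hence *: "rabs2 (X m - X n) < e / B" "rabs2 (Y m - Y n) < e / A" using M N by auto
    have "rabs2 (X m * Y m - X n * Y n) = rabs2 ((X m - X n) * Y m + X n * (Y m - Y n))"
      by (simp add: algebra_simps)
    also have "\<dots> \<le> max (rabs2 (X m - X n) * rabs2 (Y m)) (rabs2 (X n) * rabs2 (Y m - Y n))"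
      using rabs2_add_le_max by (metis rabs2_mult)
    also have "\<dots> < e"
    proof -
      have "rabs2 (X m - X n) * rabs2 (Y m) \<le> rabs2 (X m - X n) * B"
        using B by (intro mult_left_mono) auto
      moreover have "rabs2 (X n) * rabs2 (Y m - Y n) \<le> A * rabs2 (Y m - Y n)"
        using A by (intro mult_right_mono) auto
      ultimately show ?thesis using * A B by (simp add: field_simps)
    qed
    finally show "rabs2 (X m * Y m - X n * Y n) < e" .
  qed
qed

lemma cauchy2_nonvanish:
  assumes "cauchy2 X" "\<not> vanish2 X"
  obtains b N where "b > 0" "\<And>n. n \<ge> N \<Longrightarrow> rabs2 (X n) \<ge> b"
proof -
  obtain L where L: "(\<lambda>n. rabs2 (X n)) \<longlonglongrightarrow> L"
    using cauchy2_convergent[OF assms(1)] by (auto simp: convergent_def)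
  have "L \<ge> 0" using L by (rule LIMSEQ_le_const) auto
  with L assms have L0: "L > 0" by (cases "L = 0") (auto simp: vanish2_def)
  hence "eventually (\<lambda>n. rabs2 (X n) > L / 2) sequentially"
    using L by (intro order_tendstoD(1)[OF L]) auto
  then obtain N where "\<And>n. n \<ge> N \<Longrightarrow> rabs2 (X n) > L / 2" by (auto simp: eventually_sequentially)
  thus ?thesis using that[of "L / 2" N] \<open>L > 0\<close> by (simp add: less_imp_le)
qed

lemma cauchy2_inverse:
  assumes "cauchy2 X" "\<not> vanish2 X"
  shows "cauchy2 (\<lambda>n. inverse (X n))"
  unfolding cauchy2_def
proof safe
  fix e :: real assume e: "e > 0"
  obtain b N where b: "b > 0" "\<And>n. n \<ge> N \<Longrightarrow> rabs2 (X n) \<ge> b"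
    using cauchy2_nonvanish[OF assms] by blast
  obtain M where M: "\<forall>m\<ge>M. \<forall>n\<ge>M. rabs2 (X m - X n) < e * b\<^sup>2"
    using cauchy2D[OF assms(1), of "e * b\<^sup>2"] e b by auto
  show "\<exists>N. \<forall>m\<ge>N. \<forall>n\<ge>N. rabs2 (inverse (X m) - inverse (X n)) < e"
  proof (intro exI[of _ "max M N"] allI impI)
    fix m n assume mn: "m \<ge> max M N" "n \<ge> max M N"
    hence bb: "rabs2 (X m) \<ge> b" "rabs2 (X n) \<ge> b" using b by auto
    hence nz: "X m \<noteq> 0" "X n \<noteq> 0" using b by auto
    have "inverse (X m) - inverse (X n) = (X n - X m) * inverse (X m * X n)"
      using nz by (simp add: field_simps)
    hence "rabs2 (inverse (X m) - inverse (X n)) = rabs2 (X m - X n) / (rabs2 (X m) * rabs2 (X n))"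
      by (simp only: rabs2_mult rabs2_inverse divide_inverse rabs2_minus_commute)
    also have "\<dots> \<le> rabs2 (X m - X n) / b\<^sup>2"
      using bb b by (intro divide_left_mono) (auto simp: power2_eq_square intro!: mult_mono mult_pos_pos)
    also have "\<dots> < e" using M mn b by (simp add: field_simps)
    finally show "rabs2 (inverse (X m) - inverse (X n)) < e" .
  qed
qed

lemma vanish_add: 
  assumes "vanish2 X" "vanish2 Y"
  shows "vanish2 (\<lambda>n. X n + Y n)"
  unfolding vanish2_def
proof (rule Lim_null_comparison)
  show "(\<lambda>n. rabs2 (X n) + rabs2 (Y n)) \<longlonglongrightarrow> 0" using tendsto_add[OF assms[unfolded vanish2_def]] by simp
qed (auto simp: rabs2_add_le)

lemma vanish_mult: 
  assumes "vanish2 X" "cauchy2 Y"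
  shows "vanish2 (\<lambda>n. X n * Y n)"
proof -
  obtain L where "(\<lambda>n. rabs2 (Y n)) \<longlonglongrightarrow> L"
    using cauchy2_convergent[OF assms(2)] by (auto simp: convergent_def)
  from tendsto_mult[OF assms(1)[unfolded vanish2_def] this] show ?thesis by (simp add: rabs2_mult vanish2_def)
qed

quotient_type q2 = "nat \<Rightarrow> rat" / partial: q2rel
  morphisms rep_q2 Q2
proof (rule part_equivpI)
  show "\<exists>x. q2rel x x" by (intro exI[of _ "\<lambda>_. 0"]) (simp add: q2rel_def vanish2_def)
  show "symp q2rel" by (rule sympI) (simp add: q2rel_def vanish2_def rabs2_minus_commute)
  show "transp q2rel"
  proof (rule transpI)
    fix X Y Z assume "q2rel X Y" "q2rel Y Z"
    thus "q2rel X Z" using vanish_add[of "\<lambda>n. X n - Y n" "\<lambda>n. Y n - Z n"] by (auto simp: q2rel_def)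
  qed
qed

lemma vanish2_zero [simp]: "vanish2 (\<lambda>_. 0)"
  by (simp add: vanish2_def)

lemma q2rel_refl [simp]: "q2rel X X \<longleftrightarrow> cauchy2 X"
  by (simp add: q2rel_def)

instantiation q2 :: field
begin

lift_definition zero_q2 :: q2 is "\<lambda>_. 0" by simp
lift_definition one_q2 :: q2 is "\<lambda>_. 1" by simp

lift_definition plus_q2 :: "q2 \<Rightarrow> q2 \<Rightarrow> q2" is "\<lambda>X Y n. X n + Y n"
proof -
  fix X X' Y Y' assume "q2rel X X'" "q2rel Y Y'"
  thus "q2rel (\<lambda>n. X n + Y n) (\<lambda>n. X' n + Y' n)"
    using vanish_add[of "\<lambda>n. X n - X' n" "\<lambda>n. Y n - Y' n"] 
    by (auto simp: q2rel_def cauchy2_add algebra_simps)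
qed

lift_definition uminus_q2 :: "q2 \<Rightarrow> q2" is "\<lambda>X n. - X n"
  proof -
  fix X Y assume *: "q2rel X Y"
  have "rabs2 (- X n - - Y n) = rabs2 (X n - Y n)" for n
    using rabs2_minus_commute[of "Y n" "X n"] by (simp add: algebra_simps)
  thus "q2rel (\<lambda>n. - X n) (\<lambda>n. - Y n)"
    using * by (simp add: q2rel_def cauchy2_minus vanish2_def)
qed

lift_definition times_q2 :: "q2 \<Rightarrow> q2 \<Rightarrow> q2" is "\<lambda>X Y n. X n * Y n"
proof -
  fix X X' Y Y' assume *: "q2rel X X'" "q2rel Y Y'"
  hence "vanish2 (\<lambda>n. (X n - X' n) * Y n)" "vanish2 (\<lambda>n. (Y n - Y' n) * X' n)"
    by (intro vanish_mult; simp add: q2rel_def)+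
  from vanish_add[OF this] show "q2rel (\<lambda>n. X n * Y n) (\<lambda>n. X' n * Y' n)"
    using * by (auto simp: q2rel_def cauchy2_mult algebra_simps)
qed

lift_definition inverse_q2 :: "q2 \<Rightarrow> q2" is
  "\<lambda>X. if vanish2 X then (\<lambda>_. 0) else (\<lambda>n. inverse (X n))"
proof -
  fix X Y assume *: "q2rel X Y"
  hence c: "cauchy2 X" "cauchy2 Y" and v: "vanish2 (\<lambda>n. X n - Y n)" by (auto simp: q2rel_def)
  have v': "vanish2 (\<lambda>n. Y n - X n)" using v by (simp add: vanish2_def rabs2_minus_commute)
  have iff: "vanish2 X \<longleftrightarrow> vanish2 Y"
    using vanish_add[OF v, of Y] vanish_add[OF v', of X] by auto
  show "q2rel (if vanish2 X then (\<lambda>_. 0) else (\<lambda>n. inverse (X n)))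
              (if vanish2 Y then (\<lambda>_. 0) else (\<lambda>n. inverse (Y n)))"
  proof (cases "vanish2 X")
    case True
    thus ?thesis using iff by simp
  next
    case False
    hence ci: "cauchy2 (\<lambda>n. inverse (X n))" "cauchy2 (\<lambda>n. inverse (Y n))"
      using c iff cauchy2_inverse by auto
    obtain b N where b: "b > 0" "\<And>n. n \<ge> N \<Longrightarrow> rabs2 (X n) \<ge> b"
      using cauchy2_nonvanish[OF c(1) False] by blast
    obtain b' N' where b': "b' > 0" "\<And>n. n \<ge> N' \<Longrightarrow> rabs2 (Y n) \<ge> b'"
      using cauchy2_nonvanish[OF c(2)] False iff by metis
    have "vanish2 (\<lambda>n. (Y n - X n) * (inverse (X n) * inverse (Y n)))"
      by (intro vanish_mult v' cauchy2_mult ci)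
    moreover have "eventually (\<lambda>n. rabs2 ((Y n - X n) * (inverse (X n) * inverse (Y n))) 
        = rabs2 (inverse (X n) - inverse (Y n))) sequentially"
      using eventually_ge_at_top[of "max N N'"]
    proof eventually_elim
      case (elim n)
      hence "X n \<noteq> 0" "Y n \<noteq> 0" using b(1) b'(1) b(2)[of n] b'(2)[of n] by auto
      hence "inverse (X n) - inverse (Y n) = (Y n - X n) * (inverse (X n) * inverse (Y n))"
        by (simp add: field_simps)
      thus ?case by simp
    qed
    ultimately have "vanish2 (\<lambda>n. inverse (X n) - inverse (Y n))"
      unfolding vanish2_def by (rule Lim_transform_eventually)
    thus ?thesis using ci False iff by (simp add: q2rel_def)
  qed
qed

definition minus_q2 :: "q2 \<Rightarrow> q2 \<Rightarrow> q2" where "x - y = x + - (y :: q2)"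
definition divide_q2 :: "q2 \<Rightarrow> q2 \<Rightarrow> q2" where "x div y = x * inverse (y :: q2)"

instance
proof
  fix a b c :: q2
  show "a + b + c = a + (b + c)" by transfer (simp add: cauchy2_add q2rel_def add.assoc)
  show "a + b = b + a" by transfer (simp add: cauchy2_add q2rel_def add.commute)
  show "0 + a = a" by transfer (simp add: q2rel_def)
  show "- a + a = 0" by transfer (simp add: q2rel_def)
  show "a - b = a + - b" by (rule minus_q2_def)
  show "a * b * c = a * (b * c)" by transfer (simp add: cauchy2_mult q2rel_def mult.assoc)
  show "a * b = b * a" by transfer (simp add: cauchy2_mult q2rel_def mult.commute)
  show "1 * a = a" by transfer (simp add: q2rel_def)
  show "(a + b) * c = a * c + b * c" 
    by transfer (simp add: q2rel_def cauchy2_add cauchy2_mult distrib_right)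
  show "(0 :: q2) \<noteq> 1" by transfer (simp add: q2rel_def vanish2_def LIMSEQ_const_iff)
  show "a div b = a * inverse b" by (rule divide_q2_def)
  show "inverse (0 :: q2) = 0" by transfer (simp add: q2rel_def)
  show "a \<noteq> 0 \<Longrightarrow> inverse a * a = 1"
  proof transfer
    fix X assume X: "q2rel X X" and n: "\<not> q2rel X (\<lambda>_. 0)"
    hence nv: "\<not> vanish2 X" by (auto simp: q2rel_def)
    have c: "cauchy2 X" using X by simp
    obtain b N where b: "b > 0" "\<And>n. n \<ge> N \<Longrightarrow> rabs2 (X n) \<ge> b"
      using cauchy2_nonvanish[OF c nv] by blast
    have "eventually (\<lambda>n. rabs2 (inverse (X n) * X n - 1) = 0) sequentially"
      using eventually_ge_at_top[of N]
    proof eventually_elim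
      case (elim n)
      hence "X n \<noteq> 0" using b(1) b(2)[of n] by auto
      thus ?case by simp
    qed
    hence "vanish2 (\<lambda>n. inverse (X n) * X n - 1)"
      unfolding vanish2_def by (rule tendsto_eventually)
    thus "q2rel (\<lambda>n. (if vanish2 X then \<lambda>_. 0 else (\<lambda>n. inverse (X n))) n * X n) (\<lambda>_. 1)"
      using nv c by (simp add: q2rel_def cauchy2_mult cauchy2_inverse)
  qed
qed

end

lemma cauchy2_tendsto: "cauchy2 X \<Longrightarrow> (\<lambda>n. rabs2 (X n)) \<longlonglongrightarrow> lim (\<lambda>n. rabs2 (X n))"
  by (simp add: convergent_LIMSEQ_iff[symmetric] cauchy2_convergent)

lift_definition abs2 :: "q2 \<Rightarrow> real" is "\<lambda>X. lim (\<lambda>n. rabs2 (X n))"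
proof -
  fix X Y assume *: "q2rel X Y"
  hence "cauchy2 X" "vanish2 (\<lambda>n. X n - Y n)" by (auto simp: q2rel_def)
  hence "(\<lambda>n. rabs2 (X n)) \<longlonglongrightarrow> lim (\<lambda>n. rabs2 (X n))" by (intro cauchy2_tendsto)
  moreover have "(\<lambda>n. rabs2 (X n) - rabs2 (Y n)) \<longlonglongrightarrow> 0"
  proof (rule Lim_null_comparison)
    show "(\<lambda>n. rabs2 (X n - Y n)) \<longlonglongrightarrow> 0" 
      using \<open>vanish2 (\<lambda>n. X n - Y n)\<close> by (simp add: vanish2_def)
  qed (simp add: rabs2_diff_triangle)
  ultimately have "(\<lambda>n. rabs2 (X n) - (rabs2 (X n) - rabs2 (Y n))) \<longlonglongrightarrow> lim (\<lambda>n. rabs2 (X n)) - 0"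
    by (rule tendsto_diff)
  hence "(\<lambda>n. rabs2 (Y n)) \<longlonglongrightarrow> lim (\<lambda>n. rabs2 (X n))" by simp
  from limI[OF this] show "lim (\<lambda>n. rabs2 (X n)) = lim (\<lambda>n. rabs2 (Y n))" by (rule sym)
qed

lemma q2_cases: obtains X where "cauchy2 X" "x = Q2 X"
  by (metis Quotient_q2 Quotient_abs_rep Quotient_rep_reflp q2rel_refl)

lemma abs2_Q2: "cauchy2 X \<Longrightarrow> (\<lambda>n. rabs2 (X n)) \<longlonglongrightarrow> abs2 (Q2 X)"
  using cauchy2_tendsto[of X] by (simp add: abs2.abs_eq)

lemma add_Q2: "cauchy2 X \<Longrightarrow> cauchy2 Y \<Longrightarrow> Q2 X + Q2 Y = Q2 (\<lambda>n. X n + Y n)"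
  by (simp add: plus_q2.abs_eq)

lemma minus_Q2: "cauchy2 X \<Longrightarrow> - Q2 X = Q2 (\<lambda>n. - X n)"
  by (simp add: uminus_q2.abs_eq)

lemma diff_Q2: "cauchy2 X \<Longrightarrow> cauchy2 Y \<Longrightarrow> Q2 X - Q2 Y = Q2 (\<lambda>n. X n - Y n)"
  by (simp add: minus_q2_def minus_Q2 add_Q2 cauchy2_minus)

lemma mult_Q2: "cauchy2 X \<Longrightarrow> cauchy2 Y \<Longrightarrow> Q2 X * Q2 Y = Q2 (\<lambda>n. X n * Y n)"
  by (simp add: times_q2.abs_eq)

lemma abs2_const: "abs2 (Q2 (\<lambda>_. q)) = rabs2 q"
  by (rule LIMSEQ_unique[OF abs2_Q2]) auto

lemma abs2_mult: "abs2 (x * y) = abs2 x * abs2 y"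
proof -
  obtain X where X: "cauchy2 X" "x = Q2 X" by (rule q2_cases)
  obtain Y where Y: "cauchy2 Y" "y = Q2 Y" by (rule q2_cases)
  have "(\<lambda>n. rabs2 (X n * Y n)) \<longlonglongrightarrow> abs2 x * abs2 y"
    unfolding X Y rabs2_mult by (intro tendsto_mult abs2_Q2 X Y)
  moreover have "(\<lambda>n. rabs2 (X n * Y n)) \<longlonglongrightarrow> abs2 (x * y)"
    unfolding X(2) Y(2) mult_Q2[OF X(1) Y(1)] by (intro abs2_Q2 cauchy2_mult X Y)
  ultimately show ?thesis by (rule LIMSEQ_unique[symmetric])
qed

lemma abs2_nonneg [simp]: "abs2 x \<ge> 0"
  by (rule q2_cases[of x]) (auto intro!: LIMSEQ_le_const[OF abs2_Q2])

lemma Q2_eq_0_iff: "cauchy2 X \<Longrightarrow> Q2 X = 0 \<longleftrightarrow> vanish2 X"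
  using Quotient_rel[OF Quotient_q2, of X "\<lambda>_. 0"] by (auto simp: zero_q2.abs_eq q2rel_def)

lemma abs2_eq_0_iff [simp]: "abs2 x = 0 \<longleftrightarrow> x = 0"
proof -
  obtain X where X: "cauchy2 X" "x = Q2 X" by (rule q2_cases)
  show ?thesis unfolding X(2) Q2_eq_0_iff[OF X(1)] vanish2_def
    using abs2_Q2[OF X(1)] LIMSEQ_unique by metis
qed

lemma abs2_0 [simp]: "abs2 0 = 0" by simp

lemma abs2_1 [simp]: "abs2 1 = 1"
  using abs2_const[of 1] by (simp add: one_q2.abs_eq)

lemma abs2_minus [simp]: "abs2 (- x) = abs2 x"
proof -
  have "abs2 (-1) * abs2 (-1) = 1" by (simp add: abs2_mult[symmetric])
  hence "abs2 (-1) = 1" by (metis abs2_nonneg abs_of_nonneg abs_square_eq_1 power2_eq_square)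
  thus ?thesis using abs2_mult[of "-1" x] by simp
qed

lemma abs2_minus_commute: "abs2 (x - y) = abs2 (y - x)"
  using abs2_minus[of "x - y"] by simp

lemma abs2_inverse: "abs2 (inverse x) = inverse (abs2 x)"
proof (cases "x = 0")
  case False
  have "abs2 (inverse x) * abs2 x = 1" using False by (simp add: abs2_mult[symmetric])
  thus ?thesis by (metis inverse_unique mult.commute)
qed auto

lemma abs2_divide: "abs2 (x / y) = abs2 x / abs2 y"
  by (simp add: divide_inverse abs2_mult abs2_inverse)

lemma abs2_power: "abs2 (x ^ n) = abs2 x ^ n"
  by (induction n) (auto simp: abs2_mult)

lemma abs2_powi: "abs2 (x powi k) = abs2 x powi k"
  by (simp add: power_int_def abs2_power abs2_inverse)

lemma abs2_add_le_max: "abs2 (x + y) \<le> max (abs2 x) (abs2 y)"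
proof -
  obtain X where X: "cauchy2 X" "x = Q2 X" by (rule q2_cases)
  obtain Y where Y: "cauchy2 Y" "y = Q2 Y" by (rule q2_cases)
  have "(\<lambda>n. max (rabs2 (X n)) (rabs2 (Y n))) \<longlonglongrightarrow> max (abs2 x) (abs2 y)"
    unfolding X Y by (intro tendsto_max abs2_Q2 X Y)
  moreover have "(\<lambda>n. rabs2 (X n + Y n)) \<longlonglongrightarrow> abs2 (x + y)"
    unfolding X(2) Y(2) add_Q2[OF X(1) Y(1)] by (intro abs2_Q2 cauchy2_add X Y)
  ultimately show ?thesis using rabs2_add_le_max by (intro LIMSEQ_le) auto
qed

lemma of_nat_Q2: "of_nat n = Q2 (\<lambda>_. of_nat n)"
  by (induction n) (auto simp: zero_q2.abs_eq one_q2.abs_eq add_Q2)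

lemma of_int_Q2: "of_int n = Q2 (\<lambda>_. of_int n)"
  by (cases n rule: int_diff_cases) (auto simp: of_nat_Q2 diff_Q2)

lemma abs2_of_int: "abs2 (of_int m) = rabs2 (of_int m)"
  by (simp add: of_int_Q2 abs2_const)

instance q2 :: field_char_0
proof
  show "inj (of_nat :: nat \<Rightarrow> q2)"
  proof (rule injI)
    fix m n :: nat assume "(of_nat m :: q2) = of_nat n"
    hence "abs2 (of_int (int m - int n)) = 0" by simp
    thus "m = n" unfolding abs2_of_int by simp
  qed
qed

lemma divide_const_Q2:
  assumes "b \<noteq> 0"
  shows "Q2 (\<lambda>_. a) / Q2 (\<lambda>_. b) = Q2 (\<lambda>_. a / b)"
proof -
  have "Q2 (\<lambda>_. b) \<noteq> 0" using assms by (metis abs2_const abs2_eq_0_iff rabs2_eq_0_iff)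
  thus ?thesis using assms by (simp add: field_simps mult_Q2)
qed

lemma of_rat_Q2: "of_rat q = Q2 (\<lambda>_. q)"
proof -
  obtain a b :: int where q: "q = of_int a / of_int b" "b \<noteq> 0" by (rule rat_cases_frac)
  show ?thesis unfolding q(1) using q(2) by (simp add: of_rat_divide divide_const_Q2 of_int_Q2)
qed

lemma abs2_of_rat: "abs2 (of_rat q) = rabs2 q"
  by (simp add: of_rat_Q2 abs2_const)

lemma abs2_2 [simp]: "abs2 2 = 1 / 2"
  using abs2_of_int[of 2] by (simp add: rabs2_2)

lemma abs2_of_int_le_iff: "abs2 (of_int m) \<le> 1 / 2 ^ k \<longleftrightarrow> 2 ^ k dvd m"
  by (simp add: abs2_of_int rabs2_of_int_le_iff)

lemma Q2_approx:
  assumes "cauchy2 X" "e > 0"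
  shows "eventually (\<lambda>n. abs2 (Q2 X - of_rat (X n)) < e) sequentially"
proof -
  obtain N where N: "\<And>m n. m \<ge> N \<Longrightarrow> n \<ge> N \<Longrightarrow> rabs2 (X m - X n) < e / 2"
    using cauchy2D[OF assms(1), of "e / 2"] assms(2) by auto
  have "abs2 (Q2 X - of_rat (X n)) < e" if n: "n \<ge> N" for n
  proof -
    have c: "cauchy2 (\<lambda>m. X m - X n)"
      using cauchy2_add[OF assms(1), of "\<lambda>_. - X n"] by simp
    have "abs2 (Q2 X - of_rat (X n)) = abs2 (Q2 (\<lambda>m. X m - X n))"
      by (simp add: of_rat_Q2 diff_Q2 assms)
    also have "\<dots> \<le> e / 2"
      using N n by (intro LIMSEQ_le_const2[OF abs2_Q2[OF c]]) (auto intro: less_imp_le)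
    finally show ?thesis using assms by simp
  qed
  thus ?thesis by (auto simp: eventually_sequentially)
qed

lemma of_rat_dense2: 
  assumes "e > 0" obtains q where "abs2 (x - of_rat q) < e"
proof -
  obtain X where X: "cauchy2 X" "x = Q2 X" by (rule q2_cases)
  show ?thesis using Q2_approx[OF X(1) assms] that X(2) by (auto simp: eventually_sequentially)
qed

instantiation q2 :: metric_space
begin

definition dist_q2 :: "q2 \<Rightarrow> q2 \<Rightarrow> real" where "dist_q2 x y = abs2 (x - y)"

definition uniformity_q2 :: "(q2 \<times> q2) filter" where
  "uniformity_q2 = (INF e\<in>{0<..}. principal {(x, y). dist x y < e})"

definition open_q2 :: "q2 set \<Rightarrow> bool" where
  "open_q2 U \<longleftrightarrow> (\<forall>x\<in>U. eventually (\<lambda>(x', y). x' = x \<longrightarrow> y \<in> U) uniformity)"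

instance
proof
  fix x y z :: q2
  show "dist x y = 0 \<longleftrightarrow> x = y" by (simp add: dist_q2_def)
  have "dist x y \<le> max (dist x z) (dist z y)"
    using abs2_add_le_max[of "x - z" "z - y"] by (simp add: dist_q2_def)
  also have "\<dots> \<le> dist x z + dist y z"
    by (simp add: dist_q2_def abs2_minus_commute)
  finally show "dist x y \<le> dist x z + dist y z" .
qed (simp_all add: uniformity_q2_def open_q2_def)

end

instance q2 :: complete_space
proof
  fix X :: "nat \<Rightarrow> q2" assume X: "Cauchy X"
  have "\<exists>q. abs2 (X n - of_rat q) < 1 / real (Suc n)" for n
    using of_rat_dense2[of "1 / real (Suc n)" "X n"] by auto
  then obtain r where r: "\<And>n. abs2 (X n - of_rat (r n)) < 1 / real (Suc n)" by metis
  have rl: "(\<lambda>n. abs2 (X n - of_rat (r n))) \<longlonglongrightarrow> 0"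
    by (rule Lim_null_comparison[OF _ LIMSEQ_inverse_real_of_nat])
      (use r in \<open>auto simp: inverse_eq_divide intro!: always_eventually less_imp_le\<close>)
  have ev: "eventually (\<lambda>n. abs2 (X n - of_rat (r n)) < e) sequentially" if "e > 0" for e
    using order_tendstoD(2)[OF rl that] .
  have c: "cauchy2 r"
    unfolding cauchy2_def
  proof safe
    fix e :: real assume e: "e > 0"
    obtain M where M: "\<And>m n. m \<ge> M \<Longrightarrow> n \<ge> M \<Longrightarrow> abs2 (X m - X n) < e"
      using X e unfolding Cauchy_def dist_q2_def by metis
    obtain N where N: "\<And>n. n \<ge> N \<Longrightarrow> abs2 (X n - of_rat (r n)) < e" 
      using ev[OF e] by (auto simp: eventually_sequentially)
    show "\<exists>N. \<forall>m\<ge>N. \<forall>n\<ge>N. rabs2 (r m - r n) < e"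
    proof (intro exI[of _ "max M N"] allI impI)
      fix m n assume mn: "m \<ge> max M N" "n \<ge> max M N"
      have "rabs2 (r m - r n) = abs2 ((X n - of_rat (r n)) + ((X m - X n) + (of_rat (r m) - X m)))"
        by (simp add: abs2_of_rat[symmetric] of_rat_diff)
      also have "\<dots> \<le> max (abs2 (X n - of_rat (r n))) (max (abs2 (X m - X n)) (abs2 (of_rat (r m) - X m)))"
        by (meson abs2_add_le_max max.mono order.refl order_trans)
      also have "\<dots> < e" using M[of m n] N[of n] N[of m] mn by (simp add: abs2_minus_commute)
      finally show "rabs2 (r m - r n) < e" .
    qed
  qed
  have "X \<longlonglongrightarrow> Q2 r"
  proof (rule metric_LIMSEQ_I)
    fix e :: real assume e: "e > 0"
    have "eventually (\<lambda>n. dist (X n) (Q2 r) < e) sequentially"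
      using ev[OF e] Q2_approx[OF c e]
    proof eventually_elim
      case (elim n)
      have "dist (X n) (Q2 r) = abs2 ((X n - of_rat (r n)) + (of_rat (r n) - Q2 r))"
        by (simp add: dist_q2_def)
      also have "\<dots> \<le> max (abs2 (X n - of_rat (r n))) (abs2 (of_rat (r n) - Q2 r))"
        by (rule abs2_add_le_max)
      also have "\<dots> < e" using elim by (simp add: abs2_minus_commute)
      finally show ?case .
    qed
    thus "\<exists>N. \<forall>n\<ge>N. dist (X n) (Q2 r) < e" by (simp add: eventually_sequentially)
  qed
  thus "convergent X" by (auto simp: convergent_def)
qed

section \<open>The set I2 and the fractional part\<close>

definition I2 :: "q2 set" where
  "I2 = {inverse (2 ^ \<gamma>) * (\<Sum>j<\<gamma>. of_nat (a j) * 2 ^ j) | \<gamma> (a :: nat \<Rightarrow> nat).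
           \<gamma> \<ge> 1 \<and> (\<forall>j<\<gamma>. a j \<in> {0, 1})}"

lemma digit_sum_less:
  "\<forall>j<g. a j \<in> {0, 1 :: nat} \<Longrightarrow> (\<Sum>j<g. a j * 2 ^ j) < 2 ^ g"
proof (induction g)
  case (Suc g)
  hence "(\<Sum>j<g. a j * 2 ^ j) < 2 ^ g" "a g * 2 ^ g \<le> 2 ^ g" by auto
  thus ?case unfolding sum.lessThan_Suc power_Suc by linarith
qed auto

lemma ex_digits:
  "(m :: nat) < 2 ^ g \<Longrightarrow> \<exists>a. (\<forall>j. a j \<in> {0, 1}) \<and> m = (\<Sum>j<g. a j * 2 ^ j)"
proof (induction g arbitrary: m)
  case (Suc g)
  have "m mod 2 ^ g < 2 ^ g" by simp
  then obtain a where a: "\<forall>j. a j \<in> {0, 1}" "m mod 2 ^ g = (\<Sum>j<g. a j * 2 ^ j)"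
    using Suc.IH by blast
  define d where "d = m div 2 ^ g"
  have "d < 2" using Suc.prems by (simp add: d_def less_mult_imp_div_less)
  hence d: "d \<in> {0, 1}" by auto
  have "(\<Sum>j<Suc g. (a(g := d)) j * 2 ^ j) = m mod 2 ^ g + d * 2 ^ g"
    using a by simp
  also have "\<dots> = m" by (simp only: d_def mod_div_mult_eq)
  finally show ?case using a d by (intro exI[of _ "a(g := d)"]) auto
qed auto

lemma I2_eq: "I2 = {of_nat m / 2 ^ g | m g. m < 2 ^ g}" (is "_ = ?R")
proof (intro equalityI subsetI)
  fix x assume "x \<in> I2"
  then obtain g :: nat and a :: "nat \<Rightarrow> nat" 
    where ga: "x = inverse (2 ^ g) * (\<Sum>j<g. of_nat (a j) * 2 ^ j)" "\<forall>j<g. a j \<in> {0, 1}"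
    unfolding I2_def by (elim CollectE exE conjE) (rule that)
  have "x = of_nat (\<Sum>j<g. a j * 2 ^ j) / 2 ^ g" by (simp add: ga(1) divide_inverse mult.commute)
  thus "x \<in> ?R" using digit_sum_less[OF ga(2)] by (intro CollectI exI conjI)
next
  fix x assume "x \<in> ?R"
  then obtain m g where mg: "x = of_nat m / 2 ^ g" "m < 2 ^ g" by blast
  define g' m' where "g' = Suc g" and "m' = 2 * m"
  have x: "x = of_nat m' / 2 ^ g'" using mg by (simp add: g'_def m'_def)
  have "m' < 2 ^ g'" using mg by (simp add: g'_def m'_def)
  then obtain a where a: "\<forall>j. a j \<in> {0, 1}" "m' = (\<Sum>j<g'. a j * 2 ^ j)" using ex_digits by blast
  have "x = inverse (2 ^ g') * (\<Sum>j<g'. of_nat (a j) * 2 ^ j)"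
    unfolding x a(2) by (simp add: divide_inverse mult.commute)
  moreover have "g' \<ge> 1" by (simp add: g'_def)
  ultimately show "x \<in> I2" unfolding I2_def
    by (intro CollectI exI[of _ g'] exI[of _ a] conjI allI impI) (use a(1) in simp_all)
qed

lemma countable_I2: "countable I2"
proof -
  have "I2 \<subseteq> (\<lambda>(m, g). of_nat m / 2 ^ g) ` (UNIV :: (nat \<times> nat) set)" unfolding I2_eq by auto
  thus ?thesis by (rule countable_subset) simp
qed

lemma abs2_diff_le_max: "abs2 (x - z) \<le> max (abs2 (x - y)) (abs2 (y - z))"
  using abs2_add_le_max[of "x - y" "y - z"] by simp

lemma abs2_of_nat_diff_le_iff:
  "abs2 (of_nat m - of_nat n) \<le> 1 / 2 ^ k \<longleftrightarrow> m mod 2 ^ k = n mod 2 ^ k"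
proof -
  have "abs2 (of_nat m - of_nat n) \<le> 1 / 2 ^ k \<longleftrightarrow> 2 ^ k dvd (int m - int n)"
    using abs2_of_int_le_iff[of "int m - int n" k] by simp
  also have "\<dots> \<longleftrightarrow> int m mod 2 ^ k = int n mod 2 ^ k" by (simp add: mod_eq_dvd_iff)
  also have "\<dots> \<longleftrightarrow> int (m mod 2 ^ k) = int (n mod 2 ^ k)" by (simp only: of_nat_mod of_nat_power of_nat_numeral)
  finally show ?thesis by simp
qed

lemma abs2_of_nat_le_1 [simp]: "abs2 (of_nat m) \<le> 1"
  using abs2_of_nat_diff_le_iff[of m 0 0] by simp

lemma of_nat_approx:
  assumes "abs2 x \<le> 1"
  obtains m where "m < 2 ^ k" "abs2 (x - of_nat m) \<le> 1 / 2 ^ k"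
proof -
  obtain q where q: "abs2 (x - of_rat q) < 1 / 2 ^ k" 
    by (rule of_rat_dense2[of "1 / 2 ^ k" x]) auto
  have "(1::real) / 2 ^ k \<le> 1" by simp
  moreover have "abs2 (of_rat q) \<le> max (abs2 (x - of_rat q)) (abs2 x)"
    using abs2_diff_le_max[of "of_rat q" 0 x] by (simp add: abs2_minus_commute)
  ultimately have q1: "abs2 (of_rat q) \<le> 1" using q assms by linarith
  obtain a b where ab: "quotient_of q = (a, b)" by fastforce
  have b: "b > 0" and co: "coprime a b" and qab: "q = of_int a / of_int b"
    using quotient_of_denom_pos[OF ab] quotient_of_coprime[OF ab] quotient_of_div[OF ab] by auto
  have odd: "odd b"
  proof
    assume "even b"
    hence "odd a" using co by (metis coprime_common_divisor odd_one)
    hence "abs2 (of_int a) = 1"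
      using rabs2_frac[of a 1] by (auto simp: abs2_of_int not_dvd_imp_multiplicity_0)
    moreover have "abs2 (of_int b) \<le> 1 / 2" using \<open>even b\<close> abs2_of_int_le_iff[of b 1] by simp
    moreover have "abs2 (of_int b) > 0" using b by (simp add: less_le)
    ultimately have "abs2 (of_rat q) \<ge> 2" 
      by (simp add: qab of_rat_divide abs2_divide field_simps)
    thus False using q1 by simp
  qed
  have absb: "abs2 (of_int b) = 1"
    using rabs2_frac[of b 1] odd b by (auto simp: abs2_of_int not_dvd_imp_multiplicity_0)
  have "coprime b (2 ^ k)" using odd by simp
  then obtain u v where u: "u * b + v * 2 ^ k = 1" using bezout_int[of b "2 ^ k"] by auto
  define m where "m = nat ((a * u) mod 2 ^ k)"
  have m: "int m = (a * u) mod 2 ^ k" by (simp add: m_def)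
  have m2: "m < 2 ^ k"
  proof -
    have "int m < int (2 ^ k)" unfolding m by simp
    thus ?thesis by linarith
  qed
  have m': "int m = a * u - 2 ^ k * ((a * u) div 2 ^ k)"
    unfolding m by (simp only: minus_mult_div_eq_mod)
  have "a - b * int m = a * (1 - u * b) + 2 ^ k * (b * ((a * u) div 2 ^ k))"
    unfolding m' by (simp only: algebra_simps)
  also have "1 - u * b = v * 2 ^ k" using u by linarith
  finally have "a - b * int m = 2 ^ k * (a * v + b * ((a * u) div 2 ^ k))"
    by (simp add: algebra_simps)
  hence "2 ^ k dvd a - b * int m" by (metis dvd_triv_left)
  hence "abs2 (of_int (a - b * int m)) \<le> 1 / 2 ^ k" by (simp only: abs2_of_int_le_iff)
  moreover have "of_rat q - of_nat m = (of_int (a - b * int m) :: q2) / of_int b"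
    using b by (simp add: qab of_rat_divide field_simps)
  ultimately have "abs2 (of_rat q - of_nat m) \<le> 1 / 2 ^ k" 
    by (simp only: abs2_divide absb div_by_1)
  hence "abs2 (x - of_nat m) \<le> 1 / 2 ^ k"
    using abs2_diff_le_max[of x "of_nat m" "of_rat q"] q by linarith
  with m2 show ?thesis by (rule that)
qed

lemma abs2_divide_power2: "abs2 (x / 2 ^ n) = abs2 x * 2 ^ n"
  unfolding abs2_divide abs2_power abs2_2 power_one_over
  by (simp only: div_by_1 divide_divide_eq_right)

lemma abs2_mult_power2: "abs2 (2 ^ n * x) = abs2 x / 2 ^ n"
  unfolding abs2_mult abs2_power abs2_2 power_one_over
  by (simp only: mult_1 times_divide_eq_left)

lemma dyadic_approx:
  obtains m g :: nat where "m < 2 ^ g" "abs2 (x - of_nat m / 2 ^ g) \<le> 1"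
proof -
  obtain g :: nat where "abs2 x < 2 ^ g" using real_arch_pow[of 2 "abs2 x"] by auto
  hence "abs2 (2 ^ g * x) \<le> 1" by (simp add: abs2_mult_power2)
  then obtain m where m: "m < 2 ^ g" "abs2 (2 ^ g * x - of_nat m) \<le> 1 / 2 ^ g"
    by (rule of_nat_approx[of _ g])
  have "x - of_nat m / 2 ^ g = (2 ^ g * x - of_nat m) / 2 ^ g" by (simp add: diff_divide_distrib)
  hence "abs2 (x - of_nat m / 2 ^ g) \<le> 1" 
    using m(2) by (simp only: abs2_divide_power2 pos_le_divide_eq zero_less_power zero_less_numeral)
  with m(1) show ?thesis by (rule that)
qed

lemma dyadic_unique:
  assumes "m < 2 ^ g" "m' < 2 ^ g'"
    and "abs2 (x - of_nat m / 2 ^ g) \<le> 1" "abs2 (x - of_nat m' / 2 ^ g') \<le> 1"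
  shows "m * 2 ^ g' = m' * 2 ^ g"
proof -
  have "abs2 (of_nat m / 2 ^ g - of_nat m' / 2 ^ g') \<le> 1"
    using abs2_diff_le_max[of "of_nat m / 2 ^ g" "of_nat m' / 2 ^ g'" x] assms(3,4)
    by (simp add: abs2_minus_commute)
  moreover have "of_nat m / 2 ^ g - of_nat m' / 2 ^ g' 
      = (of_nat (m * 2 ^ g') - of_nat (m' * 2 ^ g) :: q2) / 2 ^ (g + g')"
    by (simp add: diff_divide_distrib power_add)
  ultimately have "abs2 (of_nat (m * 2 ^ g') - of_nat (m' * 2 ^ g)) \<le> 1 / 2 ^ (g + g')"
    by (simp only: abs2_divide_power2 pos_le_divide_eq zero_less_power zero_less_numeral)
  hence "(m * 2 ^ g') mod 2 ^ (g + g') = (m' * 2 ^ g) mod 2 ^ (g + g')"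
    by (simp only: abs2_of_nat_diff_le_iff)
  moreover have "m * 2 ^ g' < 2 ^ (g + g')" "m' * 2 ^ g < 2 ^ (g + g')"
    using mult_strict_right_mono[OF assms(1), of "2 ^ g'"] mult_strict_right_mono[OF assms(2), of "2 ^ g"]
    by (simp_all add: power_add mult.commute[of "2 ^ g'" "2 ^ g"])
  ultimately show ?thesis by (simp only: mod_less)
qed

lemma I2_ex1: "\<exists>!a. a \<in> I2 \<and> abs2 (x - a) \<le> 1"
proof -
  obtain m g :: nat where mg: "m < 2 ^ g" "abs2 (x - of_nat m / 2 ^ g) \<le> 1" by (rule dyadic_approx)
  show ?thesis
  proof (intro ex1I conjI)
    show "of_nat m / 2 ^ g \<in> I2" using mg by (auto simp: I2_eq)
    fix b assume b: "b \<in> I2 \<and> abs2 (x - b) \<le> 1"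
    then obtain m' g' :: nat where b': "b = of_nat m' / 2 ^ g'" "m' < 2 ^ g'" by (auto simp: I2_eq)
    have "m * 2 ^ g' = m' * 2 ^ g" using dyadic_unique[OF mg(1) b'(2) mg(2)] b b' by simp
    hence "of_nat (m * 2 ^ g') = (of_nat (m' * 2 ^ g) :: q2)" by (rule arg_cong)
    thus "b = of_nat m / 2 ^ g" by (simp add: b' field_simps)
  qed (use mg in auto)
qed

text \<open>The fractional part is the unique dyadic rational in \<open>[0, 1)\<close> that is congruent to \<open>t\<close> modulo
  the 2-adic integers, taken as a real number so that it can be fed into the complex exponential;
  existence and uniqueness are \<open>dyadic_approx\<close> and \<open>frac2_eqI\<close>.\<close>

definition frac2 :: "q2 \<Rightarrow> real" where
  "frac2 t = (THE q. \<exists>m g :: nat. m < 2 ^ g \<and> q = real m / 2 ^ g \<and> abs2 (t - of_nat m / 2 ^ g) \<le> 1)"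

lemma frac2_eqI:
  assumes "m < 2 ^ g" "abs2 (t - of_nat m / 2 ^ g) \<le> 1"
  shows "frac2 t = real m / 2 ^ g"
  unfolding frac2_def
proof (rule the_equality)
  fix q assume "\<exists>m g :: nat. m < 2 ^ g \<and> q = real m / 2 ^ g \<and> abs2 (t - of_nat m / 2 ^ g) \<le> 1"
  then obtain m' g' :: nat where m': "m' < 2 ^ g'" "q = real m' / 2 ^ g'" "abs2 (t - of_nat m' / 2 ^ g') \<le> 1"
    by blast
  have "m * 2 ^ g' = m' * 2 ^ g" using dyadic_unique[OF assms(1) m'(1) assms(2) m'(3)] .
  hence "real (m * 2 ^ g') = real (m' * 2 ^ g)" by (rule arg_cong)
  thus "q = real m / 2 ^ g" by (simp add: m' field_simps)
qed (use assms in blast)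

section \<open>Haar measure on the 2-adic numbers\<close>

text \<open>The unit ball \<open>{x. abs2 x \<le> 1}\<close> is the ring of 2-adic integers.\<close>

definition normalized_haar2 :: "q2 measure \<Rightarrow> bool" where
  "normalized_haar2 \<mu> \<longleftrightarrow> sets \<mu> = sets borel
     \<and> (\<forall>a. \<forall>A\<in>sets borel. emeasure \<mu> ((\<lambda>x. a + x) ` A) = emeasure \<mu> A)
     \<and> emeasure \<mu> {x. abs2 x \<le> 1} = 1"

definition ball2 :: "q2 \<Rightarrow> nat \<Rightarrow> q2 set" where
  "ball2 c k = {y. abs2 (y - c) \<le> 1 / 2 ^ k}"

definition balls2 :: "q2 set set" where
  "balls2 = insert {} {ball2 c k | c k. True}"

lemma ball2_subset:
  assumes "y \<in> ball2 c k" "y \<in> ball2 c' k'" "k \<le> k'"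
  shows "ball2 c' k' \<subseteq> ball2 c k"
proof
  fix z assume z: "z \<in> ball2 c' k'"
  have k: "1 / 2 ^ k' \<le> (1 / 2 ^ k :: real)" 
    using assms(3) by (intro divide_left_mono) auto
  have "abs2 (z - y) \<le> 1 / 2 ^ k'"
    using abs2_diff_le_max[of z y c'] z assms(2) 
    by (simp add: ball2_def abs2_minus_commute[of c' y])
  thus "z \<in> ball2 c k"
    using abs2_diff_le_max[of z c y] assms(1) k unfolding ball2_def mem_Collect_eq by linarith
qed

lemma ball2_eqI:
  assumes "abs2 (c - c') \<le> 1 / 2 ^ k" shows "ball2 c k = ball2 c' k"
proof -
  have "c \<in> ball2 c' k" "c \<in> ball2 c k" "c' \<in> ball2 c k" "c' \<in> ball2 c' k"
    using assms by (auto simp: ball2_def abs2_minus_commute)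
  thus ?thesis by (intro equalityI ball2_subset) auto
qed

lemma open_ball2: "open (ball2 c k)"
  unfolding open_dist
proof safe
  fix x assume x: "x \<in> ball2 c k"
  have "y \<in> ball2 c k" if "dist y x < 1 / 2 ^ k" for y
    using abs2_diff_le_max[of y c x] that x unfolding ball2_def mem_Collect_eq dist_q2_def by linarith
  thus "\<exists>e>0. \<forall>y. dist y x < e \<longrightarrow> y \<in> ball2 c k" by (intro exI[of _ "1 / 2 ^ k"]) auto
qed

lemma open_contains_ball2:
  assumes "open U" "x \<in> U" obtains k where "ball2 x k \<subseteq> U"
proof -
  obtain e where e: "e > 0" "\<And>y. dist y x < e \<Longrightarrow> y \<in> U"
    using assms by (auto simp: open_dist)
  obtain k where "(1 / 2 :: real) ^ k < e" using real_arch_pow_inv[of e "1 / 2"] e by auto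
  hence k: "1 / 2 ^ k < e" by (simp only: power_one_over)
  have "ball2 x k \<subseteq> U"
  proof
    fix y assume "y \<in> ball2 x k"
    with k have "dist y x < e" unfolding ball2_def mem_Collect_eq dist_q2_def by linarith
    thus "y \<in> U" by (rule e)
  qed
  thus ?thesis by (rule that)
qed

lemma ball2_center: "\<exists>a\<in>I2. \<exists>m. ball2 c k = ball2 (a + of_nat m) k"
proof -
  obtain a where a: "a \<in> I2" "abs2 (c - a) \<le> 1" using I2_ex1[of c] by blast
  obtain m where "abs2 (c - a - of_nat m) \<le> 1 / 2 ^ k" by (rule of_nat_approx[OF a(2), of k])
  hence "ball2 c k = ball2 (a + of_nat m) k" by (intro ball2_eqI) (simp add: algebra_simps)
  thus ?thesis using a by blast
qed

lemma countable_balls2: "countable balls2"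
proof -
  have "balls2 \<subseteq> insert {} ((\<lambda>(a, m, k). ball2 (a + of_nat m) k) ` (I2 \<times> (UNIV :: (nat \<times> nat) set)))"
  proof
    fix B assume "B \<in> balls2"
    then consider "B = {}" | c k where "B = ball2 c k" by (auto simp: balls2_def)
    thus "B \<in> insert {} ((\<lambda>(a, m, k). ball2 (a + of_nat m) k) ` (I2 \<times> (UNIV :: (nat \<times> nat) set)))"
    proof cases
      case 2
      obtain a m where "a \<in> I2" "ball2 c k = ball2 (a + of_nat m) k" using ball2_center by blast
      thus ?thesis unfolding 2 by (intro insertI2 image_eqI[of _ _ "(a, m, k)"]) auto
    qed simp
  qed
  moreover have "countable (insert {} ((\<lambda>(a, m, k). ball2 (a + of_nat m) k) ` (I2 \<times> (UNIV :: (nat \<times> nat) set))))"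
    using countable_I2 by (intro countable_insert countable_image countable_SIGMA) auto
  ultimately show ?thesis by (rule countable_subset)
qed

lemma sets_borel_q2: "sets (borel :: q2 measure) = sigma_sets UNIV balls2"
proof -
  have "(borel :: q2 measure) = sigma UNIV balls2"
    unfolding borel_def
  proof (rule sigma_eqI)
    have sb: "B \<in> sigma_sets UNIV {S :: q2 set. open S}" if "B \<in> balls2" for B
      using that by (auto simp: balls2_def open_ball2)
    have bs: "S \<in> sigma_sets UNIV balls2" if OP: "open S" for S :: "q2 set"
    proof -
      have "S = \<Union>{B \<in> balls2. B \<subseteq> S}"
      proof (intro equalityI subsetI)
        fix x assume "x \<in> S"
        then obtain k where k: "ball2 x k \<subseteq> S" using open_contains_ball2[OF OP] by blast
        moreover have "x \<in> ball2 x k" by (simp add: ball2_def)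
        moreover have "ball2 x k \<in> balls2" unfolding balls2_def by blast
        ultimately show "x \<in> \<Union>{B \<in> balls2. B \<subseteq> S}" by blast
      qed blast
      moreover have "countable {B \<in> balls2. B \<subseteq> S}"
        by (rule countable_subset[OF _ countable_balls2]) blast
      hence "\<Union>{B \<in> balls2. B \<subseteq> S} \<in> sigma_sets UNIV balls2"
        by (rule sigma_sets_UNION) auto
      ultimately show ?thesis by simp
    qed
    show "sigma_sets UNIV {S :: q2 set. open S} = sigma_sets UNIV balls2"
      by (rule sigma_sets_eqI) (use sb bs in auto)
  qed auto
  hence "sets (borel :: q2 measure) = sets (sigma UNIV balls2)" by (rule arg_cong)
  also have "\<dots> = sigma_sets UNIV balls2" by (rule sets_measure_of) simp
  finally show ?thesis .
qed

lemma ball2_borel [measurable]: "ball2 c k \<in> sets borel"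
  by (simp add: open_ball2)

lemma Int_stable_balls2: "Int_stable balls2"
proof (rule Int_stableI)
  fix A B assume "A \<in> balls2" "B \<in> balls2"
  show "A \<inter> B \<in> balls2"
  proof (cases "A \<inter> B = {}")
    case False
    then obtain y where y: "y \<in> A" "y \<in> B" by blast
    obtain c k where A: "A = ball2 c k" using y \<open>A \<in> balls2\<close> by (auto simp: balls2_def)
    obtain c' k' where B: "B = ball2 c' k'" using y \<open>B \<in> balls2\<close> by (auto simp: balls2_def)
    show ?thesis
    proof (cases "k \<le> k'")
      case True
      hence "A \<inter> B = B" using ball2_subset[of y c k c' k'] y A B by blast
      thus ?thesis using \<open>B \<in> balls2\<close> by simp
    next
      case False
      hence "A \<inter> B = A" using ball2_subset[of y c' k' c k] y A B by fastforce
      thus ?thesis using \<open>A \<in> balls2\<close> by simp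
    qed
  qed (simp add: balls2_def)
qed

lemma balls2_measure_eqI:
  assumes "sets M = sets borel" "sets N = sets borel"
    and "\<And>c k. emeasure M (ball2 c k) = emeasure N (ball2 c k)"
    and "\<And>c k. emeasure M (ball2 c k) < \<infinity>"
  shows "M = N"
proof -
  have cov: "(\<Union>i. ball2 (from_nat_into I2 i) 0) = UNIV"
  proof -
    have "x \<in> (\<Union>i. ball2 (from_nat_into I2 i) 0)" for x
    proof -
      obtain a where a: "a \<in> I2" "abs2 (x - a) \<le> 1" using I2_ex1[of x] by blast
      obtain i where "from_nat_into I2 i = a" using from_nat_into_surj[OF countable_I2 a(1)] by blast
      thus ?thesis using a(2) by (auto simp: ball2_def)
    qed
    thus ?thesis by blast
  qed
  show ?thesis
  proof (rule measure_eqI_generator_eq[OF Int_stable_balls2, where A = "\<lambda>i. ball2 (from_nat_into I2 i) 0" and \<Omega> = UNIV])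
    fix X assume "X \<in> balls2"
    thus "emeasure M X = emeasure N X" using assms(3) by (auto simp: balls2_def)
  next
    show "range (\<lambda>i. ball2 (from_nat_into I2 i) 0) \<subseteq> balls2" by (auto simp: balls2_def)
    show "emeasure M (ball2 (from_nat_into I2 i) 0) \<noteq> \<infinity>" for i
      using assms(4)[of "from_nat_into I2 i" 0] by simp
  qed (use assms(1,2) cov sets_borel_q2 in auto)
qed

lemma ball2_translate: "(\<lambda>x. a + x) ` ball2 c k = ball2 (a + c) k"
proof (intro equalityI subsetI)
  fix x assume "x \<in> ball2 (a + c) k"
  hence "x - a \<in> ball2 c k" by (simp add: ball2_def algebra_simps)
  moreover have "x = a + (x - a)" by simp
  ultimately show "x \<in> (\<lambda>x. a + x) ` ball2 c k" by blast
qed (auto simp: ball2_def)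

lemma Z2_partition: "{x. abs2 x \<le> 1} = (\<Union>m<2 ^ k. ball2 (of_nat m) k)"
proof (intro equalityI subsetI)
  fix x assume "x \<in> {x. abs2 x \<le> 1}"
  hence "abs2 x \<le> 1" by simp
  then obtain m where "m < 2 ^ k" "abs2 (x - of_nat m) \<le> 1 / 2 ^ k" by (rule of_nat_approx[of _ k])
  thus "x \<in> (\<Union>m<2 ^ k. ball2 (of_nat m) k)" by (auto simp: ball2_def)
next
  fix x assume "x \<in> (\<Union>m<2 ^ k. ball2 (of_nat m) k)"
  then obtain m where m: "abs2 (x - of_nat m) \<le> 1 / 2 ^ k" by (auto simp: ball2_def)
  have "(1::real) / 2 ^ k \<le> 1" by simp
  hence "abs2 x \<le> 1" using abs2_add_le_max[of "x - of_nat m" "of_nat m"] m abs2_of_nat_le_1[of m] 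
    unfolding diff_add_cancel by linarith
  thus "x \<in> {x. abs2 x \<le> 1}" by simp
qed

lemma disjoint_Z2_partition: "disjoint_family_on (\<lambda>m. ball2 (of_nat m) k) {..<2 ^ k}"
  unfolding disjoint_family_on_def
proof (intro ballI impI)
  fix m n :: nat assume mn: "m \<in> {..<2 ^ k}" "n \<in> {..<2 ^ k}" "m \<noteq> n"
  have False if "x \<in> ball2 (of_nat m) k" "x \<in> ball2 (of_nat n) k" for x
  proof -
    have "abs2 (of_nat m - of_nat n) \<le> 1 / 2 ^ k"
      using that abs2_diff_le_max[of "of_nat m" "of_nat n" x] 
      unfolding ball2_def mem_Collect_eq abs2_minus_commute[of "of_nat m" x] by linarith
    thus False using mn by (simp add: abs2_of_nat_diff_le_iff)
  qed
  thus "ball2 (of_nat m) k \<inter> ball2 (of_nat n) k = {}" by blast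
qed

lemma emeasure_haar2_ball2:
  assumes "normalized_haar2 \<mu>"
  shows "emeasure \<mu> (ball2 c k) = ennreal (1 / 2 ^ k)"
proof -
  have sets: "sets \<mu> = sets borel" and Z: "emeasure \<mu> {x. abs2 x \<le> 1} = 1"
    and inv: "\<And>a A. A \<in> sets borel \<Longrightarrow> emeasure \<mu> ((\<lambda>x. a + x) ` A) = emeasure \<mu> A"
    using assms by (auto simp: normalized_haar2_def)
  have eq: "emeasure \<mu> (ball2 c k) = emeasure \<mu> (ball2 0 k)" for c
    using inv[of "ball2 0 k" c] by (simp add: ball2_translate)
  have "1 = emeasure \<mu> (\<Union>m<2 ^ k. ball2 (of_nat m) k)" using Z Z2_partition[of k] by simp
  also have "\<dots> = (\<Sum>m<2 ^ k. emeasure \<mu> (ball2 (of_nat m) k))"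
    by (rule sum_emeasure[symmetric]) (auto simp: sets disjoint_Z2_partition)
  also have "\<dots> = (\<Sum>m<(2::nat) ^ k. emeasure \<mu> (ball2 c k))" 
    by (intro sum.cong refl) (metis eq)
  also have "\<dots> = ennreal (2 ^ k) * emeasure \<mu> (ball2 c k)"
    by (simp add: ennreal_power[symmetric])
  finally have 1: "ennreal (2 ^ k) * emeasure \<mu> (ball2 c k) = 1" by simp
  have "emeasure \<mu> (ball2 c k) = ennreal (1 / 2 ^ k) * ennreal (2 ^ k) * emeasure \<mu> (ball2 c k)"
    by (subst ennreal_mult[symmetric]) auto
  also have "\<dots> = ennreal (1 / 2 ^ k)" unfolding mult.assoc 1 by simp
  finally show ?thesis .
qed

lemma normalized_haar2_unique: "normalized_haar2 \<mu> \<Longrightarrow> normalized_haar2 \<nu> \<Longrightarrow> \<mu> = \<nu>"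
  by (rule balls2_measure_eqI) (auto simp: emeasure_haar2_ball2 normalized_haar2_def)

text \<open>Existence: fair coin flips give the binary digits of a point of the unit ball, and \<open>q2\<close> is the
  disjoint union of the translates of the unit ball by \<open>I2\<close>.\<close>

definition digsum :: "nat \<Rightarrow> (nat \<Rightarrow> bool) \<Rightarrow> nat" where
  "digsum n b = (\<Sum>j<n. of_bool (b j) * 2 ^ j)"

definition coin_space :: "(nat \<Rightarrow> bool) measure" where
  "coin_space = PiM UNIV (\<lambda>_. measure_pmf (bernoulli_pmf (1 / 2)))"

definition dlim :: "(nat \<Rightarrow> bool) \<Rightarrow> q2" where
  "dlim b = Q2 (\<lambda>n. of_nat (digsum n b))"

lemma digsum_less: "digsum n b < 2 ^ n"
  unfolding digsum_def by (rule digit_sum_less) auto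

lemma digsum_Suc: "digsum (Suc n) b = digsum n b + of_bool (b n) * 2 ^ n"
  by (simp add: digsum_def)

lemma digsum_mod: "digsum (n + j) b mod 2 ^ n = digsum n b"
proof (induction j)
  case (Suc j)
  have "digsum (n + Suc j) b = digsum (n + j) b + of_bool (b (n + j)) * 2 ^ j * 2 ^ n"
    by (simp add: digsum_Suc power_add)
  also have "\<dots> mod 2 ^ n = digsum (n + j) b mod 2 ^ n" by (rule mod_mult_self1)
  finally show ?case using Suc.IH by simp
qed (simp add: digsum_less)

lemma abs2_digsum_diff:
  assumes "N \<le> m" "N \<le> n"
  shows "abs2 (of_nat (digsum m b) - of_nat (digsum n b)) \<le> 1 / 2 ^ N"
  using digsum_mod[of N "m - N" b] digsum_mod[of N "n - N" b] assms
  by (simp add: abs2_of_nat_diff_le_iff)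

lemma cauchy2_digsum: "cauchy2 (\<lambda>n. of_nat (digsum n b))"
  unfolding cauchy2_def
proof safe
  fix e :: real assume e: "e > 0"
  obtain N where "(1 / 2 :: real) ^ N < e" using real_arch_pow_inv[of e "1 / 2"] e by auto
  hence N: "1 / 2 ^ N < e" by (simp only: power_one_over)
  have "rabs2 (of_nat (digsum m b) - of_nat (digsum n b)) < e" if "m \<ge> N" "n \<ge> N" for m n
  proof -
    have "rabs2 (of_nat (digsum m b) - of_nat (digsum n b)) = abs2 (of_nat (digsum m b) - of_nat (digsum n b))"
      by (simp add: abs2_of_rat[symmetric] of_rat_diff)
    also have "\<dots> < e" using abs2_digsum_diff[OF that, of b] N by linarith
    finally show ?thesis .
  qed
  thus "\<exists>N. \<forall>m\<ge>N. \<forall>n\<ge>N. rabs2 (of_nat (digsum m b) - of_nat (digsum n b)) < e" by blast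
qed

lemma abs2_dlim_diff: "abs2 (dlim b - of_nat (digsum k b)) \<le> 1 / 2 ^ k"
proof -
  have "eventually (\<lambda>n. abs2 (dlim b - of_rat (of_nat (digsum n b))) < 1 / 2 ^ k) sequentially"
    unfolding dlim_def by (rule Q2_approx[OF cauchy2_digsum]) simp
  hence "eventually (\<lambda>n. abs2 (dlim b - of_nat (digsum n b)) < 1 / 2 ^ k \<and> n \<ge> k) sequentially"
    using eventually_ge_at_top[of k] by eventually_elim simp
  from eventually_happens[OF this]
  obtain n where n: "abs2 (dlim b - of_nat (digsum n b)) < 1 / 2 ^ k" "n \<ge> k" by auto
  show ?thesis
    using abs2_diff_le_max[of "dlim b" "of_nat (digsum k b)" "of_nat (digsum n b)"] 
      n(1) abs2_digsum_diff[OF n(2) order_refl, of b] by linarith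
qed

lemma dlim_in_ball2_iff:
  assumes "m < 2 ^ k" shows "dlim b \<in> ball2 (of_nat m) k \<longleftrightarrow> digsum k b = m"
proof -
  have "ball2 (of_nat (digsum k b)) k = ball2 (dlim b) k"
    by (rule ball2_eqI) (metis abs2_dlim_diff abs2_minus_commute)
  hence "dlim b \<in> ball2 (of_nat m) k \<longleftrightarrow> of_nat (digsum k b) \<in> ball2 (of_nat m) k"
    using abs2_diff_le_max[of "dlim b" "of_nat m" "of_nat (digsum k b)"]
      abs2_diff_le_max[of "of_nat (digsum k b)" "of_nat m" "dlim b"] abs2_dlim_diff[of b k]
    unfolding ball2_def mem_Collect_eq abs2_minus_commute[of "of_nat (digsum k b)" "dlim b"] by linarith
  also have "\<dots> \<longleftrightarrow> digsum k b mod 2 ^ k = m mod 2 ^ k" 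
    by (simp add: ball2_def abs2_of_nat_diff_le_iff)
  finally show ?thesis using assms digsum_less[of k b] by simp
qed

lemma digsum_eq_iff: "digsum k b = digsum k c \<longleftrightarrow> (\<forall>i<k. b i = c i)"
proof (induction k)
  case (Suc k)
  have "digsum (Suc k) b = digsum (Suc k) c \<longleftrightarrow> digsum k b = digsum k c \<and> b k = c k"
    using digsum_less[of k b] digsum_less[of k c] by (auto simp: digsum_Suc)
  thus ?case using Suc.IH by (auto simp: less_Suc_eq)
qed (simp add: digsum_def)

lemma ex_digsum: assumes "m < 2 ^ k" shows "\<exists>c. digsum k c = m"
proof -
  obtain a where a: "\<forall>j. a j \<in> {0, 1}" "m = (\<Sum>j<k. a j * 2 ^ j)" using ex_digits[OF assms] by blast
  have "digsum k (\<lambda>j. a j = 1) = m" unfolding digsum_def a(2)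
    by (intro sum.cong refl) (use a(1) in auto)
  thus ?thesis by blast
qed

interpretation coin: product_prob_space "\<lambda>_::nat. measure_pmf (bernoulli_pmf (1 / 2))" UNIV
  by unfold_locales

lemma space_coin_space [simp]: "space coin_space = UNIV"
  by (simp add: coin_space_def space_PiM)

lemma prod_emb_cylinder:
  assumes "\<And>i. space (M i) = UNIV"
  shows "prod_emb UNIV M {..<k} (Pi\<^sub>E {..<k} (\<lambda>i. {c i})) = {b. \<forall>i<(k::nat). b i = c i}"
  using assms by (auto simp: prod_emb_def PiE_iff)

lemma coin_cylinder:
  shows "{b. \<forall>i<k. b i = c i} \<in> sets coin_space"
    and "emeasure coin_space {b. \<forall>i<k. b i = c i} = ennreal (1 / 2 ^ k)"
proof -
  let ?M = "\<lambda>_::nat. measure_pmf (bernoulli_pmf (1 / 2))"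
  have eq: "{b. \<forall>i<k. b i = c i} = prod_emb UNIV ?M {..<k} (Pi\<^sub>E {..<k} (\<lambda>i. {c i}))"
    by (rule prod_emb_cylinder[symmetric]) (rule space_measure_pmf)
  show "{b. \<forall>i<k. b i = c i} \<in> sets coin_space"
    unfolding eq coin_space_def by (rule sets_PiM_I) auto
  have "emeasure coin_space {b. \<forall>i<k. b i = c i} = (\<Prod>i<k. emeasure (measure_pmf (bernoulli_pmf (1 / 2))) {c i})"
    unfolding eq coin_space_def by (rule coin.emeasure_PiM_emb) auto
  also have "\<dots> = (\<Prod>i<k. ennreal (1 / 2))" by (simp add: emeasure_pmf_single)
  also have "\<dots> = ennreal ((1 / 2) ^ k)" by (simp only: prod_constant card_lessThan ennreal_power)
  finally show "emeasure coin_space {b. \<forall>i<k. b i = c i} = ennreal (1 / 2 ^ k)" 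
    by (simp only: power_one_over)
qed

lemma dlim_vimage_ball2:
  shows "dlim -` ball2 c k \<in> sets coin_space"
    and "emeasure coin_space (dlim -` ball2 c k) = ennreal (1 / 2 ^ k) * indicator {x. abs2 x \<le> 1} c"
proof -
  have "dlim -` ball2 c k \<in> sets coin_space \<and>
    emeasure coin_space (dlim -` ball2 c k) = ennreal (1 / 2 ^ k) * indicator {x. abs2 x \<le> 1} c"
  proof (cases "abs2 c \<le> 1")
    case True
    then obtain m where m: "m < 2 ^ k" "abs2 (c - of_nat m) \<le> 1 / 2 ^ k" by (rule of_nat_approx[of _ k])
    obtain d where d: "digsum k d = m" using ex_digsum[OF m(1)] by blast
    have "dlim -` ball2 c k = {b. \<forall>i<k. b i = d i}"
      unfolding ball2_eqI[OF m(2)]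
      using dlim_in_ball2_iff[OF m(1), unfolded d[symmetric] digsum_eq_iff] d by auto
    thus ?thesis using coin_cylinder[of k d] True by simp
  next
    case False
    have "dlim b \<notin> ball2 c k" for b
    proof
      assume "dlim b \<in> ball2 c k"
      hence "abs2 (c - dlim b) \<le> 1 / 2 ^ k" by (simp add: ball2_def abs2_minus_commute)
      moreover have "(1::real) / 2 ^ k \<le> 1" by simp
      moreover have "abs2 (dlim b) \<le> 1" using abs2_dlim_diff[of b 0] by (simp add: digsum_def)
      ultimately show False using False abs2_add_le_max[of "c - dlim b" "dlim b"]
        unfolding diff_add_cancel by linarith
    qed
    hence "dlim -` ball2 c k = {}" by blast
    thus ?thesis using False by simp
  qed
  thus "dlim -` ball2 c k \<in> sets coin_space"
    and "emeasure coin_space (dlim -` ball2 c k) = ennreal (1 / 2 ^ k) * indicator {x. abs2 x \<le> 1} c" by auto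
qed

lemma measurable_borel_q2I:
  assumes "\<And>c k. f -` ball2 c k \<inter> space M \<in> sets M"
  shows "f \<in> measurable M (borel :: q2 measure)"
proof (rule measurable_sigma_sets[OF sets_borel_q2])
  fix B assume "B \<in> balls2"
  thus "f -` B \<inter> space M \<in> sets M" using assms by (auto simp: balls2_def)
qed auto

lemma translate_vimage_ball2: "(\<lambda>x. a + f x) -` ball2 c k = f -` ball2 (c - a) k"
  by (auto simp: ball2_def algebra_simps)

lemma measurable_translate_q2 [measurable]: "(\<lambda>x :: q2. a + x) \<in> measurable borel borel"
proof (rule measurable_borel_q2I)
  fix c k
  show "(\<lambda>x. a + x) -` ball2 c k \<inter> space borel \<in> sets borel"
    using translate_vimage_ball2[of a "\<lambda>x. x" c k] by (simp add: vimage_ident)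
qed

lemma measurable_digit_map:
  "(\<lambda>(a, b). a + dlim b) \<in> measurable (count_space I2 \<Otimes>\<^sub>M coin_space) borel"
proof (rule measurable_pair_measure_countable1[OF countable_I2])
  fix a assume "a \<in> I2"
  show "(\<lambda>b. case (a, b) of (a, b) \<Rightarrow> a + dlim b) \<in> borel_measurable coin_space"
    by (rule measurable_borel_q2I) (simp add: translate_vimage_ball2 dlim_vimage_ball2)
qed

lemma ex_normalized_haar2: "\<exists>\<mu>. normalized_haar2 \<mu>"
proof -
  define \<mu> where "\<mu> = distr (count_space I2 \<Otimes>\<^sub>M coin_space) borel (\<lambda>(a, b). a + dlim b)"
  have sets: "sets \<mu> = sets borel" by (simp add: \<mu>_def)
  interpret cs: prob_space coin_space unfolding coin_space_def by (rule coin.prob_space_axioms)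
  have ball: "emeasure \<mu> (ball2 c k) = ennreal (1 / 2 ^ k)" for c k
  proof -
    obtain a0 where a0: "a0 \<in> I2" "abs2 (c - a0) \<le> 1" 
      and uniq: "\<And>a. a \<in> I2 \<Longrightarrow> abs2 (c - a) \<le> 1 \<Longrightarrow> a = a0" using I2_ex1[of c] by blast
    let ?f = "\<lambda>(a, b). a + dlim b" and ?N = "count_space I2 \<Otimes>\<^sub>M coin_space"
    have m: "?f -` ball2 c k \<inter> space ?N \<in> sets ?N"
      by (rule measurable_sets[OF measurable_digit_map ball2_borel])
    have "emeasure \<mu> (ball2 c k) = emeasure ?N (?f -` ball2 c k \<inter> space ?N)"
      unfolding \<mu>_def by (rule emeasure_distr[OF measurable_digit_map ball2_borel])
    also have "\<dots> = (\<integral>\<^sup>+ a. emeasure coin_space (Pair a -` (?f -` ball2 c k \<inter> space ?N)) \<partial>count_space I2)"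
      by (rule cs.emeasure_pair_measure_alt[OF m])
    also have "\<dots> = (\<integral>\<^sup>+ a. ennreal (1 / 2 ^ k) * indicator {a0} a \<partial>count_space I2)"
    proof (rule nn_integral_cong)
      fix a assume "a \<in> space (count_space I2)"
      hence a: "a \<in> I2" by simp
      have "Pair a -` (?f -` ball2 c k \<inter> space ?N) = (\<lambda>b. a + dlim b) -` ball2 c k"
        using a by (auto simp: space_pair_measure)
      also have "\<dots> = dlim -` ball2 (c - a) k" by (rule translate_vimage_ball2)
      finally have "Pair a -` (?f -` ball2 c k \<inter> space ?N) = dlim -` ball2 (c - a) k" .
      moreover have "abs2 (c - a) \<le> 1 \<longleftrightarrow> a = a0" using uniq[OF a] a0 by blast
      ultimately show "emeasure coin_space (Pair a -` (?f -` ball2 c k \<inter> space ?N)) 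
          = ennreal (1 / 2 ^ k) * indicator {a0} a"
        by (simp add: dlim_vimage_ball2 indicator_def)
    qed
    also have "\<dots> = ennreal (1 / 2 ^ k)"
      using a0(1) by (simp add: nn_integral_cmult)
    finally show ?thesis .
  qed
  have inv: "emeasure \<mu> ((\<lambda>x. a + x) ` A) = emeasure \<mu> A" if A: "A \<in> sets borel" for a A
  proof -
    have vi: "(\<lambda>x. a + x) ` A = (\<lambda>x. - a + x) -` A" for A
    proof (intro equalityI subsetI)
      fix x assume "x \<in> (\<lambda>x. - a + x) -` A"
      moreover have "x = a + (- a + x)" by simp
      ultimately show "x \<in> (\<lambda>x. a + x) ` A" by blast
    qed auto
    have "distr \<mu> borel (\<lambda>x. - a + x) = \<mu>"
    proof (rule balls2_measure_eqI)
      fix c k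
      have "emeasure (distr \<mu> borel (\<lambda>x. - a + x)) (ball2 c k) = emeasure \<mu> ((\<lambda>x. - a + x) -` ball2 c k)"
        using sets sets_eq_imp_space_eq[OF sets]
        by (subst emeasure_distr) (auto simp: measurable_cong_sets[OF sets refl])
      also have "\<dots> = emeasure \<mu> (ball2 (a + c) k)" unfolding vi[symmetric] ball2_translate ..
      finally have *: "emeasure (distr \<mu> borel (\<lambda>x. - a + x)) (ball2 c k) = ennreal (1 / 2 ^ k)"
        by (simp only: ball)
      show "emeasure (distr \<mu> borel (\<lambda>x. - a + x)) (ball2 c k) = emeasure \<mu> (ball2 c k)"
        by (simp only: * ball)
      show "emeasure (distr \<mu> borel (\<lambda>x. - a + x)) (ball2 c k) < \<infinity>"
        by (simp only: * infinity_ennreal_def ennreal_less_top)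
    qed (auto simp: sets)
    hence "emeasure \<mu> A = emeasure (distr \<mu> borel (\<lambda>x. - a + x)) A" by simp
    also have "\<dots> = emeasure \<mu> ((\<lambda>x. - a + x) -` A)"
      using A sets sets_eq_imp_space_eq[OF sets]
      by (subst emeasure_distr) (auto simp: measurable_cong_sets[OF sets refl])
    also have "(\<lambda>x. - a + x) -` A = (\<lambda>x. a + x) ` A" by (rule vi[symmetric])
    finally show ?thesis by (rule sym)
  qed
  have "{x. abs2 x \<le> 1} = ball2 0 0" by (simp add: ball2_def)
  hence "emeasure \<mu> {x. abs2 x \<le> 1} = 1" using ball[of 0 0] by simp
  thus ?thesis unfolding normalized_haar2_def using sets inv by blast
qed

text \<open>Well-defined by \<open>ex_normalized_haar2\<close> and \<open>normalized_haar2_unique\<close>.\<close>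

definition haar2 :: "q2 measure" where
  "haar2 = (THE \<mu>. normalized_haar2 \<mu>)"

lemma normalized_haar2_haar2: "normalized_haar2 haar2"
proof -
  have "\<exists>!\<mu>. normalized_haar2 \<mu>"
    using ex_normalized_haar2 normalized_haar2_unique by (rule ex_ex1I)
  thus ?thesis unfolding haar2_def by (rule theI')
qed

section \<open>Orthonormal bases of the space of square-integrable functions\<close>

text \<open>Elements are represented by functions rather than by classes modulo null functions, so that
  \<open>l2_norm\<close> is a seminorm on \<open>l2_space M\<close>.\<close>

definition l2_space :: "'a measure \<Rightarrow> ('a \<Rightarrow> complex) set" where
  "l2_space M = {f \<in> borel_measurable M. integrable M (\<lambda>x. (cmod (f x))\<^sup>2)}"

definition l2_inner :: "'a measure \<Rightarrow> ('a \<Rightarrow> complex) \<Rightarrow> ('a \<Rightarrow> complex) \<Rightarrow> complex" where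
  "l2_inner M f g = (LINT x|M. f x * cnj (g x))"

definition l2_norm :: "'a measure \<Rightarrow> ('a \<Rightarrow> complex) \<Rightarrow> real" where
  "l2_norm M f = sqrt (LINT x|M. (cmod (f x))\<^sup>2)"

text \<open>An orthonormal family whose finite linear combinations are dense.\<close>

definition l2_orthonormal_basis :: "'a measure \<Rightarrow> 'i set \<Rightarrow> ('i \<Rightarrow> 'a \<Rightarrow> complex) \<Rightarrow> bool" where
  "l2_orthonormal_basis M I \<psi> \<longleftrightarrow>
     (\<forall>i\<in>I. \<psi> i \<in> l2_space M)
     \<and> (\<forall>i\<in>I. \<forall>k\<in>I. l2_inner M (\<psi> i) (\<psi> k) = (if i = k then 1 else 0))
     \<and> (\<forall>f\<in>l2_space M. \<forall>\<epsilon>>0. \<exists>F c. finite F \<and> F \<subseteq> I \<and>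
            l2_norm M (\<lambda>x. f x - (\<Sum>i\<in>F. c i * \<psi> i x)) < \<epsilon>)"

section \<open>The wavelet functions\<close>

text \<open>Points of the \<open>n\<close>-dimensional space are functions \<open>'n \<Rightarrow> q2\<close> on a finite index type with
  \<open>n = CARD('n)\<close>; its measure is the product of the Haar measures.\<close>

definition haar2_prod :: "('n::finite \<Rightarrow> q2) measure" where
  "haar2_prod = PiM UNIV (\<lambda>_. haar2)"

definition maxabs2 :: "('n::finite \<Rightarrow> q2) \<Rightarrow> real" where
  "maxabs2 x = Max (range (\<lambda>\<nu>. abs2 (x \<nu>)))"

definition chi2 :: "q2 \<Rightarrow> complex" where
  "chi2 t = exp (2 * of_real pi * \<i> * of_real (frac2 t))"

definition Omega :: "real \<Rightarrow> complex" where
  "Omega t = (if 0 \<le> t \<and> t \<le> 1 then 1 else 0)"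

definition kvec :: "'n set \<Rightarrow> 'n \<Rightarrow> nat" where
  "kvec e \<nu> = (if \<nu> \<in> e then 1 else 0)"

definition Psi0 :: "'n::finite set \<Rightarrow> ('n \<Rightarrow> q2) \<Rightarrow> complex" where
  "Psi0 e x = chi2 (inverse 2 * (\<Sum>\<nu>\<in>UNIV. of_nat (kvec e \<nu>) * x \<nu>)) * Omega (maxabs2 x)"

text \<open>In \<open>\<alpha> i k\<close> the first argument is the upper index (0 or 1), the second the lower one.\<close>

definition admissible_coeffs :: "nat \<Rightarrow> (nat \<Rightarrow> nat \<Rightarrow> complex) \<Rightarrow> bool" where
  "admissible_coeffs s \<alpha> \<longleftrightarrow>
     (if s \<ge> 1
      then \<exists>\<gamma> :: nat \<Rightarrow> complex. (\<forall>r<2 ^ s. cmod (\<gamma> r) = 1) \<and>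
             (\<forall>k<2 ^ s. \<alpha> 1 k = inverse (2 ^ s) * (-1) ^ k *
                (\<Sum>r<2 ^ s. \<gamma> r * exp (- (\<i> * of_real pi * ((2 * of_nat r + 1) / 2 ^ s) * of_nat k))))
      else \<alpha> 1 0 = 1)
     \<and> \<alpha> 0 0 = 1 \<and> (\<forall>k. 1 \<le> k \<and> k < 2 ^ s \<longrightarrow> \<alpha> 0 k = 0)"

definition wavelet :: "('n::finite \<Rightarrow> nat) \<Rightarrow> ('n \<Rightarrow> nat \<Rightarrow> nat \<Rightarrow> complex) \<Rightarrow>
    'n set \<Rightarrow> int \<Rightarrow> ('n \<Rightarrow> q2) \<Rightarrow> ('n \<Rightarrow> q2) \<Rightarrow> complex" where
  "wavelet s \<alpha> e j a x =
     of_real (2 powr (- (real CARD('n) * of_int j / 2))) *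
     (\<Sum>r\<in>{r. \<forall>\<nu>. r \<nu> < 2 ^ s \<nu>}.
        (\<Prod>\<nu>\<in>UNIV. \<alpha> \<nu> (kvec e \<nu>) (r \<nu>)) *
        Psi0 e (\<lambda>\<nu>. 2 powi j * x \<nu> - a \<nu> - of_nat (r \<nu>) / 2 ^ s \<nu> * of_nat (kvec e \<nu>)))"

end

theory Submission
  imports Defs
begin

text \<open>
  Every wavelet is a tensor product of functions of one variable: of ball indicators \<open>ball_ind\<close> in
  the coordinates outside \<open>e\<close>, and of combinations \<open>haar_comb\<close> of translated Haar functions in the
  coordinates in \<open>e\<close>.

  The admissible coefficients are chosen such that the symbol of the combination is unimodular on the
  odd powers of a \<open>2 ^ (s + 1)\<close>-th root of unity. A Haar function changes its sign under translation
  by 1, so translation by multiples of \<open>2 ^ (- s)\<close> is negacyclic and Fourier expansion in these odd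
  powers diagonalises it. The resulting identity \<open>negacyclic_convolution\<close> says that the passage from
  Haar functions to their combinations is unitary: applied to inner products it gives orthonormality,
  applied to the Haar functions themselves it recovers them from the combinations.

  For completeness, the indicator of a cube equals \<open>2 ^ (- n)\<close> times that of the cube of doubled radius
  plus a combination of wavelets. Iterating, the remainder tends to zero in norm, so that indicators of
  cubes, hence of boxes, hence of measurable sets, lie in the closed span of the wavelets.
\<close>

section \<open>Haar functions on the 2-adic numbers\<close>

text \<open>Balls around 0 are additive subgroups by the ultrametric inequality, so adding a member
  does not affect membership.\<close>

lemma abs2_add_le_iff:
  assumes "abs2 y \<le> c"
  shows "abs2 (x + y) \<le> c \<longleftrightarrow> abs2 x \<le> c"
  using assms abs2_add_le_max[of x y] abs2_add_le_max[of "x + y" "- y"]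
  by (simp add: le_max_iff_disj) linarith

text \<open>The residue field has two elements: modulo 2 every 2-adic integer is congruent to 0 or
  1.\<close>

lemma abs2_le_1_cases:
  assumes "abs2 t \<le> 1"
  shows "abs2 t \<le> 1 / 2 \<or> abs2 (t - 1) \<le> 1 / 2"
proof -
  obtain m :: nat where "m < 2 ^ 1" "abs2 (t - of_nat m) \<le> 1 / 2 ^ 1"
    using assms by (rule of_nat_approx)
  moreover from this(1) have "m = 0 \<or> m = 1" by auto
  ultimately show ?thesis by auto
qed

lemma abs2_half_disjoint: "abs2 t \<le> 1 / 2 \<Longrightarrow> \<not> abs2 (t - 1) \<le> 1 / 2"
  using abs2_add_le_iff[of t "1 / 2" "- 1"] by simp

lemma abs2_diff_1_le_1: "abs2 (t - 1) \<le> 1 / 2 \<Longrightarrow> abs2 t \<le> 1"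
  using abs2_add_le_iff[of 1 1 "t - 1"] by simp

lemma abs2_half: "abs2 (t / 2) = 2 * abs2 t"
  by (simp add: abs2_divide)

text \<open>Unlike in \<open>frac2_eqI\<close>, the numerator may exceed the denominator, because
  the integer part only adds a multiple of 2 pi i to the exponent. Fractional parts can thus be
  added without reduction modulo 1, which yields \<open>chi2_add\<close>.\<close>

lemma chi2_eqI:
  assumes "abs2 (t - of_nat m / 2 ^ g) \<le> 1"
  shows "chi2 t = exp (2 * of_real pi * \<i> * of_real (real m / 2 ^ g))"
proof -
  let ?d = "m div 2 ^ g" and ?r = "m mod 2 ^ g"
  have m: "m = ?d * 2 ^ g + ?r" by (rule div_mult_mod_eq[symmetric])
  have "(of_nat m :: q2) = of_nat ?d * 2 ^ g + of_nat ?r"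
    by (subst m) (simp only: of_nat_add of_nat_mult of_nat_power of_nat_numeral)
  hence "t - of_nat ?r / 2 ^ g = (t - of_nat m / 2 ^ g) + of_nat ?d"
    by (simp add: field_simps)
  hence "abs2 (t - of_nat ?r / 2 ^ g) \<le> 1"
    using abs2_add_le_iff[OF abs2_of_nat_le_1] assms by metis
  hence fr: "frac2 t = real ?r / 2 ^ g" by (intro frac2_eqI) auto
  have "real m = real ?d * 2 ^ g + real ?r"
    by (subst m) (simp only: of_nat_add of_nat_mult of_nat_power of_nat_numeral)
  hence rm: "real m / 2 ^ g = real ?r / 2 ^ g + real ?d" by (simp add: field_simps)
  have "exp (2 * of_real pi * \<i> * of_real (real m / 2 ^ g)) =
      exp (2 * of_real pi * \<i> * of_real (real ?r / 2 ^ g)) * exp (2 * of_real pi * \<i> * of_nat ?d)"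
    unfolding rm by (simp add: exp_add[symmetric] algebra_simps)
  also have "exp (2 * of_real pi * \<i> * of_nat ?d) = 1"
    using exp_integer_2pi[of "of_nat ?d"] by (simp add: mult_ac)
  finally show ?thesis by (simp add: chi2_def fr)
qed

lemma chi2_add: "chi2 (x + y) = chi2 x * chi2 y"
proof -
  obtain m g :: nat where x: "m < 2 ^ g" "abs2 (x - of_nat m / 2 ^ g) \<le> 1" by (rule dyadic_approx)
  obtain k h :: nat where y: "k < 2 ^ h" "abs2 (y - of_nat k / 2 ^ h) \<le> 1" by (rule dyadic_approx)
  let ?n = "m * 2 ^ h + k * 2 ^ g"
  have "x + y - of_nat ?n / 2 ^ (g + h) = (x - of_nat m / 2 ^ g) + (y - of_nat k / 2 ^ h)"
    by (simp add: field_simps power_add)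
  hence "abs2 (x + y - of_nat ?n / 2 ^ (g + h)) \<le> 1"
    using abs2_add_le_iff[OF y(2)] x(2) by metis
  hence "chi2 (x + y) = exp (2 * of_real pi * \<i> * of_real (real ?n / 2 ^ (g + h)))"
    by (rule chi2_eqI)
  also have "real ?n / 2 ^ (g + h) = real m / 2 ^ g + real k / 2 ^ h"
    by (simp add: field_simps power_add)
  finally show ?thesis
    by (simp add: chi2_eqI[OF x(2)] chi2_eqI[OF y(2)] exp_add[symmetric] algebra_simps)
qed

lemma chi2_eq_1: "abs2 t \<le> 1 \<Longrightarrow> chi2 t = 1"
  using chi2_eqI[of t 0 0] by simp

lemma chi2_sum: "finite A \<Longrightarrow> chi2 (\<Sum>i\<in>A. f i) = (\<Prod>i\<in>A. chi2 (f i))"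
  by (induction A rule: finite_induct) (auto simp: chi2_add chi2_eq_1)

text \<open>The character \<open>chi2 (t / 2)\<close> cut off to the 2-adic integers, written
  without the character as a difference of the even and the odd integers.\<close>

definition haar_mother :: "q2 \<Rightarrow> complex" where
  "haar_mother t = of_bool (abs2 t \<le> 1 / 2) - of_bool (abs2 (t - 1) \<le> 1 / 2)"

text \<open>Half of an even 2-adic integer is an integer, where the character is 1; half of an odd
  one is congruent to 1/2 modulo the integers, where it is exp (pi i) = -1.\<close>

lemma haar_mother_eq_chi2: "haar_mother t = chi2 (t / 2) * of_bool (abs2 t \<le> 1)"
proof -
  consider "abs2 t \<le> 1 / 2" | "abs2 (t - 1) \<le> 1 / 2" "\<not> abs2 t \<le> 1 / 2" | "\<not> abs2 t \<le> 1"
    using abs2_le_1_cases[of t] by argo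
  thus ?thesis
  proof cases
    case 1
    have "abs2 (t / 2) \<le> 1" using 1 by (simp add: abs2_half)
    thus ?thesis using 1 abs2_half_disjoint[OF 1] by (simp add: haar_mother_def chi2_eq_1)
  next
    case 2
    have "abs2 (t / 2 - of_nat 1 / 2 ^ 1) \<le> 1"
      using 2(1) abs2_half[of "t - 1"] by (simp add: diff_divide_distrib)
    hence "chi2 (t / 2) = exp (2 * of_real pi * \<i> * of_real (real 1 / 2 ^ 1))" by (rule chi2_eqI)
    also have "\<dots> = exp (of_real pi * \<i>)" by simp
    finally have "chi2 (t / 2) = -1" by simp
    thus ?thesis using 2 abs2_diff_1_le_1[OF 2(1)] by (simp add: haar_mother_def)
  next
    case 3
    thus ?thesis using abs2_diff_1_le_1[of t] by (auto simp: haar_mother_def)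
  qed
qed

lemma abs2_add_1_le_half_iff: "abs2 (t + 1) \<le> 1 / 2 \<longleftrightarrow> abs2 (t - 1) \<le> 1 / 2"
  using abs2_add_le_iff[of 2 "1 / 2" "t - 1"] by (simp add: add.commute)

lemma haar_mother_add_1: "haar_mother (t + 1) = - haar_mother t"
  unfolding haar_mother_def abs2_add_1_le_half_iff add_diff_cancel_right' by simp

lemma haar_mother_cong:
  assumes "abs2 (t - t') \<le> 1 / 2"
  shows "haar_mother t = haar_mother t'"
proof -
  have "abs2 (t - c) \<le> 1 / 2 \<longleftrightarrow> abs2 (t' - c) \<le> 1 / 2" for c
    using abs2_add_le_iff[OF assms, of "t' - c"] by simp
  from this[of 0] this[of 1] show ?thesis by (simp add: haar_mother_def)
qed

text \<open>Balls grow with the level: this one has centre \<open>2 powi (- j) * a\<close>, and its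
  radius and Haar measure are both \<open>2 powi j\<close>.\<close>

definition ball_ind :: "int \<Rightarrow> q2 \<Rightarrow> q2 \<Rightarrow> complex" where
  "ball_ind j a y = of_bool (abs2 (2 powi j * y - a) \<le> 1)"

definition haar_fun :: "int \<Rightarrow> q2 \<Rightarrow> q2 \<Rightarrow> complex" where
  "haar_fun j a y = haar_mother (2 powi j * y - a)"

lemma haar_fun_add_1: "haar_fun j (a + 1) y = - haar_fun j a y"
  using haar_mother_add_1[of "2 powi j * y - a - 1"] by (simp add: haar_fun_def algebra_simps)

lemma ball_ind_half: "ball_ind (j - 1) (a / 2) y = of_bool (abs2 (2 powi j * y - a) \<le> 1 / 2)"
proof -
  have "2 powi (j - 1) * y - a / 2 = (2 powi j * y - a) / 2"
    by (simp add: power_int_diff diff_divide_distrib)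
  thus ?thesis unfolding ball_ind_def by (simp only: abs2_half) simp
qed

lemma ball_ind_split: "ball_ind j a y = ball_ind (j - 1) (a / 2) y + ball_ind (j - 1) ((a + 1) / 2) y"
proof -
  have "1 / 2 \<le> (1::real)" by simp
  thus ?thesis
    using abs2_le_1_cases[of "2 powi j * y - a"] abs2_diff_1_le_1[of "2 powi j * y - a"]
      abs2_half_disjoint[of "2 powi j * y - a"]
    unfolding ball_ind_half by (auto simp: ball_ind_def diff_diff_eq)
qed

lemma haar_fun_split: "haar_fun j a y = ball_ind (j - 1) (a / 2) y - ball_ind (j - 1) ((a + 1) / 2) y"
  unfolding ball_ind_half by (simp add: haar_fun_def haar_mother_def diff_diff_eq)

text \<open>The relations \<open>ball_ind_split\<close> and \<open>haar_fun_split\<close>, solved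
  for the smaller ball. This is the elementary step of the completeness argument.\<close>

lemma ball_ind_double: "ball_ind (j - 1) a y = (ball_ind j (2 * a) y + haar_fun j (2 * a) y) / 2"
  using ball_ind_split[of j "2 * a" y] haar_fun_split[of j "2 * a" y] by simp

lemma sum_lessThan_add:
  fixes f :: "nat \<Rightarrow> 'a :: comm_monoid_add"
  shows "sum f {..<m + n} = sum f {..<m} + (\<Sum>i<n. f (m + i))"
  by (induction n) (simp_all add: add.assoc)

text \<open>Iterated halving; it serves to cut boxes with unequal sides into cubes of a common
  level.\<close>

lemma ball_ind_refine: "ball_ind j a y = (\<Sum>i<2 ^ m. ball_ind (j - int m) ((a + of_nat i) / 2 ^ m) y)"
proof (induction m)
  case (Suc m)
  have "ball_ind j a y = (\<Sum>i<2 ^ m. ball_ind (j - int (Suc m)) ((a + of_nat i) / 2 ^ Suc m) y)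
     + (\<Sum>i<2 ^ m. ball_ind (j - int (Suc m)) ((a + of_nat (2 ^ m + i)) / 2 ^ Suc m) y)"
    unfolding Suc.IH sum.distrib[symmetric]
  proof (intro sum.cong refl)
    fix i
    \<comment> \<open>The second half of piece \<open>i\<close> becomes piece
      \<open>2 ^ m + i\<close>, so that the new pieces form two consecutive blocks of
      indices.\<close>
    have "((a + of_nat i) / 2 ^ m + 1) / 2 = (a + of_nat (2 ^ m + i)) / 2 ^ Suc m"
      by (simp add: add_divide_distrib mult.commute)
    moreover have "(a + of_nat i) / 2 ^ m / 2 = (a + of_nat i) / 2 ^ Suc m" by simp
    moreover have "j - int m - 1 = j - int (Suc m)" by simp
    ultimately show "ball_ind (j - int m) ((a + of_nat i) / 2 ^ m) y =
       ball_ind (j - int (Suc m)) ((a + of_nat i) / 2 ^ Suc m) y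
     + ball_ind (j - int (Suc m)) ((a + of_nat (2 ^ m + i)) / 2 ^ Suc m) y"
      using ball_ind_split[of "j - int m" "(a + of_nat i) / 2 ^ m" y] by (simp only:)
  qed
  also have "\<dots> = (\<Sum>i<2 ^ m + 2 ^ m. ball_ind (j - int (Suc m)) ((a + of_nat i) / 2 ^ Suc m) y)"
    by (simp only: sum_lessThan_add)
  finally show ?case by (simp only: power_Suc mult_2)
qed simp

text \<open>Two balls are nested or disjoint, and the smaller one lies in the larger exactly if its
  centre does.\<close>

lemma ball_ind_mult:
  assumes "i \<le> j"
  shows "ball_ind i a y * ball_ind j b y = of_bool (abs2 (2 powi (j - i) * a - b) \<le> 1) * ball_ind i a y"
proof (cases "abs2 (2 powi i * y - a) \<le> 1")
  case True
  define k where "k = nat (j - i)"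
  have k: "j - i = int k" using assms by (simp add: k_def)
  have "2 powi j = (2 powi (j - i) * 2 powi i :: q2)"
    by (simp add: power_int_diff)
  \<comment> \<open>Since \<open>2 ^ k\<close> is a 2-adic integer, the first summand stays in the
    unit ball and the second alone decides.\<close>
  hence *: "2 powi j * y - b = 2 ^ k * (2 powi i * y - a) + (2 powi (j - i) * a - b)"
    unfolding k by (simp add: algebra_simps)
  have "abs2 (2 powi i * y - a) / 2 ^ k \<le> 1 / 1"
    using True by (intro frac_le) auto
  hence "abs2 (2 ^ k * (2 powi i * y - a)) \<le> 1"
    by (simp add: abs2_mult_power2)
  hence "abs2 (2 powi j * y - b) \<le> 1 \<longleftrightarrow> abs2 (2 powi (j - i) * a - b) \<le> 1"
    unfolding * add.commute[of "2 ^ k * _"] by (rule abs2_add_le_iff)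
  thus ?thesis by (simp add: ball_ind_def)
qed (simp add: ball_ind_def)

lemma haar_fun_mult_ball_ind: 
  assumes "i \<le> j"
  shows "haar_fun i a y * ball_ind j b y = of_bool (abs2 (2 powi (j - i) * a - b) \<le> 1) * haar_fun i a y"
proof -
  have "haar_fun i a y = haar_fun i a y * ball_ind i a y"
    by (simp add: haar_fun_def haar_mother_eq_chi2 ball_ind_def)
  thus ?thesis using ball_ind_mult[OF assms, of a y b] by (metis mult.assoc mult.commute)
qed

section \<open>Integrals of ball indicators and Haar functions\<close>

lemma sets_haar2 [measurable_cong, simp]: "sets haar2 = sets borel"
  using normalized_haar2_haar2 by (simp add: normalized_haar2_def)

lemma space_haar2 [simp]: "space haar2 = UNIV"
  using sets_eq_imp_space_eq[OF sets_haar2] by simp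

lemma ball_ind_neg: "ball_ind (- int k) a y = indicator (ball2 (2 ^ k * a) k) y"
proof -
  have "2 powi (- int k) * y - a = (y - 2 ^ k * a) / 2 ^ k"
    by (simp add: power_int_minus field_simps)
  hence "abs2 (2 powi (- int k) * y - a) = abs2 (y - 2 ^ k * a) * 2 ^ k"
    by (simp only: abs2_divide_power2)
  thus ?thesis by (simp add: ball_ind_def ball2_def indicator_def field_simps)
qed

text \<open>Levels up to 0 are the balls \<open>ball2\<close> of known measure; positive levels
  follow by induction, each ball being the disjoint union of two balls one level lower.\<close>

lemma ball_ind_has_integral:
  "has_bochner_integral haar2 (ball_ind j a) (2 powi j)"
proof -
  have neg: "has_bochner_integral haar2 (ball_ind (- int k) a) (2 powi (- int k))" for k a
  proof -
    have em: "emeasure haar2 (ball2 (2 ^ k * a) k) = ennreal (1 / 2 ^ k)"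
      by (rule emeasure_haar2_ball2[OF normalized_haar2_haar2])
    have "has_bochner_integral haar2 (indicator (ball2 (2 ^ k * a) k) :: q2 \<Rightarrow> real) (measure haar2 (ball2 (2 ^ k * a) k))"
      by (rule has_bochner_integral_real_indicator) (simp_all add: em)
    also have "measure haar2 (ball2 (2 ^ k * a) k) = 2 powi (- int k)"
      unfolding measure_def em by (simp add: power_int_minus inverse_eq_divide)
    finally have "has_bochner_integral haar2 (\<lambda>y. complex_of_real (indicator (ball2 (2 ^ k * a) k) y))
        (complex_of_real (2 powi (- int k)))"
      by (rule has_bochner_integral_of_real)
    thus ?thesis by (simp add: ball_ind_neg[abs_def] of_real_indicator)
  qed
  have pos: "has_bochner_integral haar2 (ball_ind (int k) a) (2 powi (int k))" for k a
  proof (induction k arbitrary: a)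
    case 0
    thus ?case using neg[of 0 a] by simp
  next
    case (Suc k)
    have "ball_ind (int (Suc k)) a = (\<lambda>y. ball_ind (int k) (a / 2) y + ball_ind (int k) ((a + 1) / 2) y)"
      using ball_ind_split[of "int (Suc k)" a] by (intro ext) simp
    moreover have "(2 powi int (Suc k) :: complex) = 2 powi int k + 2 powi int k"
      unfolding power_int_of_nat by simp
    ultimately show ?case
      using has_bochner_integral_add[OF Suc.IH[of "a / 2"] Suc.IH[of "(a + 1) / 2"]] by (simp only:)
  qed
  show ?thesis
  proof (cases "j \<ge> 0")
    case True
    thus ?thesis using pos[of "nat j" a] by simp
  next
    case False
    thus ?thesis using neg[of "nat (- j)" a] by simp
  qed
qed

lemma integrable_ball_ind [simp]: "integrable haar2 (ball_ind j a)"
  and integral_ball_ind [simp]: "integral\<^sup>L haar2 (ball_ind j a) = 2 powi j"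
  using ball_ind_has_integral[of j a] by (simp_all add: has_bochner_integral_iff)

lemma integrable_haar_fun [simp]: "integrable haar2 (haar_fun j a)"
  unfolding haar_fun_split[abs_def] by simp

lemma integral_haar_fun [simp]: "integral\<^sup>L haar2 (haar_fun j a) = 0"
  unfolding haar_fun_split[abs_def] by simp

section \<open>Inner products of ball indicators and Haar functions\<close>

lemma integral_ball_ind_ball_ind:
  "i \<le> j \<Longrightarrow> (LINT y|haar2. ball_ind i a y * ball_ind j b y)
      = of_bool (abs2 (2 powi (j - i) * a - b) \<le> 1) * 2 powi i"
  by (simp add: ball_ind_mult)

lemma integrable_ball_ind_ball_ind [simp]: "integrable haar2 (\<lambda>y. ball_ind i a y * ball_ind j b y)"
proof (cases "i \<le> j")
  case False
  hence "j \<le> i" by simp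
  thus ?thesis unfolding mult.commute[of "ball_ind i a _"] by (simp add: ball_ind_mult)
qed (simp add: ball_ind_mult)

lemma integral_haar_fun_ball_ind:
  "i \<le> j \<Longrightarrow> (LINT y|haar2. haar_fun i a y * ball_ind j b y) = 0"
  by (simp add: haar_fun_mult_ball_ind)

lemma integrable_haar_fun_ball_ind [simp]: "integrable haar2 (\<lambda>y. haar_fun i a y * ball_ind j b y)"
  by (simp add: haar_fun_split left_diff_distrib)

text \<open>The coarser function is a difference of ball indicators of level \<open>j - 1\<close>,
  which is still at least \<open>i\<close>; each of them either keeps or annihilates the finer
  function, whose integral is 0.\<close>

lemma integral_haar_fun_haar_fun_less:
  "i < j \<Longrightarrow> (LINT y|haar2. haar_fun i a y * haar_fun j b y) = 0"
  unfolding haar_fun_split[of j] right_diff_distrib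
  by (simp add: integral_haar_fun_ball_ind)

lemma integrable_haar_fun_haar_fun [simp]: "integrable haar2 (\<lambda>y. haar_fun i a y * haar_fun j b y)"
  unfolding haar_fun_split[of j] right_diff_distrib by simp

text \<open>As a function of the shift, the correlation is again a Haar function. It therefore
  changes sign under shifts by 1, which makes \<open>negacyclic_convolution\<close> applicable to
  inner products.\<close>

lemma integral_haar_fun_haar_fun:
  "(LINT y|haar2. haar_fun j a y * haar_fun j b y) = 2 powi j * haar_mother (a - b)"
proof -
  have half: "abs2 (c / 2 - d / 2) \<le> 1 \<longleftrightarrow> abs2 (c - d) \<le> 1 / 2" for c d
    unfolding diff_divide_distrib[symmetric] abs2_half by auto
  have i: "(LINT y|haar2. ball_ind (j - 1) (c / 2) y * ball_ind (j - 1) (d / 2) y)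
      = of_bool (abs2 (c - d) \<le> 1 / 2) * 2 powi (j - 1)" for c d
    using integral_ball_ind_ball_ind[of "j - 1" "j - 1" "c / 2" "d / 2"] by (simp add: half)
  have 1: "(LINT y|haar2. haar_fun j a y * haar_fun j b y) = 
      (of_bool (abs2 (a - b) \<le> 1 / 2) - of_bool (abs2 (a - (b + 1)) \<le> 1 / 2)
       - of_bool (abs2 (a + 1 - b) \<le> 1 / 2) + of_bool (abs2 ((a + 1) - (b + 1)) \<le> 1 / 2)) * 2 powi (j - 1)"
    unfolding haar_fun_split left_diff_distrib right_diff_distrib
    by (simp add: i abs2_minus_commute[of b] abs2_minus_commute[of "b + 1"] left_diff_distrib distrib_right)
  have 2: "a - (b + 1) = a - b - 1" "a + 1 - b = a - b + 1" "(a + 1) - (b + 1) = a - b"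
    by simp_all
  have 3: "(2 powi j :: complex) = 2 * 2 powi (j - 1)" by (simp add: power_int_diff)
  show ?thesis unfolding 1 2 abs2_add_1_le_half_iff haar_mother_def 3 by (simp add: algebra_simps)
qed

lemma sigma_finite_haar2: "sigma_finite_measure haar2"
proof
  show "\<exists>A. countable A \<and> A \<subseteq> sets haar2 \<and> \<Union> A = space haar2 \<and> (\<forall>a\<in>A. emeasure haar2 a \<noteq> \<infinity>)"
  proof (intro exI conjI ballI)
    show "countable ((\<lambda>a. ball2 a 0) ` I2)" using countable_I2 by simp
    show "\<Union> ((\<lambda>a. ball2 a 0) ` I2) = space haar2"
      using I2_ex1 by (fastforce simp: ball2_def)
  qed (auto simp: emeasure_haar2_ball2[OF normalized_haar2_haar2])
qed

section \<open>Negacyclic Fourier expansion\<close>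

text \<open>The \<open>m\<close>-th power of a root of \<open>z ^ N = -1\<close>; for
  \<open>p < N\<close> all \<open>N\<close> such roots occur. These are the characters adapted to
  sequences that change sign after \<open>N\<close> steps.\<close>

definition twist :: "nat \<Rightarrow> nat \<Rightarrow> int \<Rightarrow> complex" where
  "twist N p m = cis (pi * (2 * real p + 1) * of_int m / real N)"

lemma twist_0 [simp]: "twist N p 0 = 1"
  by (simp add: twist_def)

lemma twist_add: "twist N p (m + n) = twist N p m * twist N p n"
  by (simp add: twist_def cis_mult add_divide_distrib distrib_left)

lemma twist_minus: "twist N p (- m) = cnj (twist N p m)"
  by (simp add: twist_def cis_cnj)

lemma cis_odd_pi: "cis (pi * (2 * real p + 1)) = -1"
proof -
  have "pi * (2 * real p + 1) = 2 * pi * real p + pi" by (simp add: algebra_simps)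
  hence "cis (pi * (2 * real p + 1)) = cis (2 * pi * real p) * cis pi" by (simp only: cis_mult)
  thus ?thesis by (simp only: cis_multiple_2pi Ints_of_nat cis_pi mult_1)
qed

lemma twist_period: "N > 0 \<Longrightarrow> twist N p (m + int N) = - twist N p m"
  unfolding twist_add by (simp add: twist_def cis_odd_pi)

lemma sum_cis_roots:
  fixes m :: int
  assumes "N > 0"
  shows "(\<Sum>k<N. cis (2 * pi * real k * of_int m / real N)) = (if int N dvd m then of_nat N else 0)"
proof -
  define z where "z = cis (2 * pi * of_int m / real N)"
  have pow: "cis (2 * pi * real k * of_int m / real N) = z ^ k" for k
    by (simp add: z_def Complex.DeMoivre mult_ac)
  have zN: "z ^ N = 1"
    using assms by (simp add: z_def Complex.DeMoivre mult.commute[of "real N"] cis_multiple_2pi)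
  show ?thesis
  proof (cases "int N dvd m")
    case True
    then obtain d where "m = int N * d" by blast
    hence "2 * pi * of_int m / real N = 2 * pi * of_int d" using assms by simp
    hence "z = 1" by (simp only: z_def cis_multiple_2pi Ints_of_int)
    thus ?thesis using True by (simp add: pow)
  next
    case False
    have "z \<noteq> 1"
    proof
      assume "z = 1"
      hence "Re z = 1" by simp
      hence "cos (2 * pi * of_int m / real N) = 1" by (simp add: z_def)
      then obtain n :: int where "2 * pi * of_int m / real N = of_int n * 2 * pi"
        using cos_one_2pi_int by blast
      hence "real_of_int m = of_int (n * int N)" using assms by (simp add: field_simps)
      hence "m = n * int N" by (simp only: of_int_eq_iff)
      thus False using False by simp
    qed
    hence "(\<Sum>k<N. z ^ k) = 0" using zN by (simp add: geometric_sum)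
    thus ?thesis using False by (simp add: pow)
  qed
qed

text \<open>A phase \<open>cis (pi * m / N)\<close> factors out and leaves a sum over all
  \<open>N\<close>-th roots of unity. The bound on \<open>m\<close> excludes the nonzero multiples
  of \<open>N\<close>, at which the sum is \<open>N\<close> up to sign.\<close>

lemma sum_twist:
  assumes "N > 0" "\<bar>m\<bar> < int N"
  shows "(\<Sum>p<N. twist N p m) = (if m = 0 then of_nat N else 0)"
proof -
  have "twist N p m = cis (pi * of_int m / real N) * cis (2 * pi * real p * of_int m / real N)" for p
    by (simp add: twist_def cis_mult add_divide_distrib algebra_simps)
  hence "(\<Sum>p<N. twist N p m) = cis (pi * of_int m / real N) * (if int N dvd m then of_nat N else 0)"
    using sum_cis_roots[OF assms(1), of m] by (simp add: sum_distrib_left[symmetric])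
  moreover have "int N dvd m \<longleftrightarrow> m = 0"
    using assms zdvd_not_zless[of "\<bar>m\<bar>" "int N"] by auto
  ultimately show ?thesis by simp
qed

text \<open>Steps of length \<open>N\<close> only change the sign, and division with remainder moves
  every \<open>m\<close> into the first period.\<close>

lemma negacyclic_eq_0:
  fixes d :: "int \<Rightarrow> complex"
  assumes "N > 0" "\<And>m. d (m + int N) = - d m" "\<And>m. m < N \<Longrightarrow> d (int m) = 0"
  shows "d m = 0"
proof -
  have up: "d (m + int k * int N) = 0 \<longleftrightarrow> d m = 0" for m k
  proof (induction k)
    case (Suc k)
    have "m + int (Suc k) * int N = (m + int k * int N) + int N" by (simp add: algebra_simps)
    thus ?case using Suc.IH assms(2)[of "m + int k * int N"] by (simp only: neg_equal_0_iff_equal)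
  qed simp
  have "d (m mod int N) = 0" using assms(3)[of "nat (m mod int N)"] assms(1)
    by (simp add: nat_less_iff)
  moreover have "m = m mod int N + (m div int N) * int N" by simp
  ultimately show ?thesis
  proof (cases "m div int N \<ge> 0")
    case True
    thus ?thesis using up[of "m mod int N" "nat (m div int N)"] \<open>d (m mod int N) = 0\<close> by simp
  next
    case False
    \<comment> \<open>For a negative quotient it is the remainder that is reached from
      \<open>m\<close> by upward steps, so the two points exchange roles in
      \<open>up\<close>.\<close>
    hence "m mod int N = m + int (nat (- (m div int N))) * int N"
      by (simp add: algebra_simps)
    thus ?thesis using up[of m "nat (- (m div int N))"] \<open>d (m mod int N) = 0\<close> by simp
  qed
qed

text \<open>Discrete Fourier inversion over the roots of \<open>z ^ N = -1\<close>. Both sides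
  change sign after \<open>N\<close> steps, so it suffices to compare one period, where
  \<open>sum_twist\<close> covers all index differences.\<close>

lemma negacyclic_expansion:
  fixes g :: "int \<Rightarrow> complex"
  assumes N: "N > 0" and g: "\<And>m. g (m + int N) = - g m"
  obtains h where "\<And>m. g m = (\<Sum>p<N. h p * twist N p m)"
proof
  define h where "h p = (\<Sum>k<N. g (int k) * twist N p (- int k)) / of_nat N" for p
  define d where "d m = g m - (\<Sum>p<N. h p * twist N p m)" for m
  have "d m = 0" for m
  proof (rule negacyclic_eq_0[OF N])
    show "d (m + int N) = - d m" for m
      by (simp add: d_def g twist_period[OF N] sum_negf)
    show "d (int m) = 0" if "m < N" for m
    proof -
      have "(\<Sum>p<N. h p * twist N p (int m)) = (\<Sum>p<N. \<Sum>k<N. g (int k) * twist N p (int m - int k) / of_nat N)"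
        by (simp add: h_def sum_distrib_right sum_divide_distrib twist_add[symmetric] mult.assoc)
      also have "\<dots> = (\<Sum>k<N. g (int k) * (\<Sum>p<N. twist N p (int m - int k)) / of_nat N)"
        by (subst sum.swap) (simp add: sum_distrib_left sum_divide_distrib)
      also have "\<dots> = (\<Sum>k<N. if k = m then g (int k) else 0)"
        using N that by (intro sum.cong refl) (auto simp: sum_twist)
      also have "\<dots> = g (int m)" using that by simp
      finally show ?thesis by (simp add: d_def)
    qed
  qed
  thus "g m = (\<Sum>p<N. h p * twist N p m)" for m by (simp add: d_def)
qed

text \<open>With the character \<open>twist N p\<close> in place of \<open>g\<close>, the double sum
  is the squared modulus of the symbol at \<open>p\<close>, that is 1. By linearity its value for
  \<open>g\<close> is the sum of the Fourier coefficients, which is \<open>g 0\<close>.\<close>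

lemma negacyclic_convolution:
  fixes g :: "int \<Rightarrow> complex"
  assumes N: "N > 0" and g: "\<And>m. g (m + int N) = - g m"
    and A: "\<And>p. p < N \<Longrightarrow> cmod (\<Sum>k<N. c k * twist N p (int k)) = 1"
  shows "(\<Sum>q<N. cnj (c q) * (\<Sum>r<N. c r * g (int r - int q))) = g 0"
proof -
  obtain h where h: "\<And>m. g m = (\<Sum>p<N. h p * twist N p m)"
    using negacyclic_expansion[of N g] N g by blast
  let ?A = "\<lambda>p. \<Sum>k<N. c k * twist N p (int k)"
  have "(\<Sum>q<N. cnj (c q) * (\<Sum>r<N. c r * g (int r - int q)))
      = (\<Sum>q<N. \<Sum>r<N. \<Sum>p<N. h p * (c r * twist N p (int r)) * cnj (c q * twist N p (int q)))"
    unfolding h diff_conv_add_uminus twist_add twist_minus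
    by (simp add: sum_distrib_left mult_ac)
  also have "\<dots> = (\<Sum>p<N. \<Sum>q<N. \<Sum>r<N. h p * (c r * twist N p (int r)) * cnj (c q * twist N p (int q)))"
    by (subst (2) sum.swap, subst sum.swap) (rule refl)
  also have "\<dots> = (\<Sum>p<N. h p * (?A p * cnj (?A p)))"
    by (simp add: sum_distrib_left sum_distrib_right cnj_sum mult_ac)
  also have "\<dots> = (\<Sum>p<N. h p)"
    using A by (intro sum.cong refl) (simp add: complex_norm_square[symmetric] del: cnj_sum)
  finally show ?thesis by (simp add: h)
qed

text \<open>The coefficients are a discrete Fourier transform of the unimodular numbers \<gamma>, up
  to a shift of frequency. Evaluating the symbol undoes the transform, so each of its values is a
  single \<gamma>. For \<open>s = 0\<close> the sum is the single term 1.\<close>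

lemma admissible_coeffs_twist:
  assumes "admissible_coeffs s \<alpha>" "p < 2 ^ s"
  shows "cmod (\<Sum>k<2 ^ s. \<alpha> 1 k * twist (2 ^ s) p (int k)) = 1"
proof (cases "s \<ge> 1")
  case False
  thus ?thesis using assms by (simp add: admissible_coeffs_def not_le)
next
  case True
  define N :: nat where "N = 2 ^ s"
  \<comment> \<open>The sign \<open>(-1) ^ k\<close> is \<open>cis (pi * k)\<close>, a shift of the
    frequency by half of \<open>N\<close>; here \<open>N\<close> is even because
    \<open>s \<ge> 1\<close>.\<close>
  define H :: nat where "H = 2 ^ (s - 1)"
  have N: "N > 0" by (simp add: N_def)
  have NH: "N = 2 * H" using True by (cases s) (simp_all add: N_def H_def)
  obtain \<gamma> :: "nat \<Rightarrow> complex" where \<gamma>: "\<And>r. r < N \<Longrightarrow> cmod (\<gamma> r) = 1"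
    and \<alpha>: "\<And>k. k < N \<Longrightarrow> \<alpha> 1 k = inverse (of_nat N) * (-1) ^ k *
        (\<Sum>r<N. \<gamma> r * exp (- (\<i> * of_real pi * ((2 * of_nat r + 1) / of_nat N) * of_nat k)))"
    using assms(1) True unfolding admissible_coeffs_def N_def of_nat_power of_nat_numeral
    by (simp only: if_True) blast
  have e: "exp (- (\<i> * of_real pi * ((2 * of_nat r + 1) / of_nat N) * of_nat k)) = twist N r (- int k)" for r k
    by (simp add: twist_def cis_conv_exp mult_ac)
  have t: "(-1) ^ k * twist N r (- int k) * twist N p (int k)
      = cis (2 * pi * real k * of_int (int p - int r + int H) / real N)" for r k
  proof -
    have "(-1) ^ k = cis (pi * real k)" by (simp add: Complex.DeMoivre[symmetric] cis_pi mult.commute[of pi])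
    moreover have "pi * real k + pi * (2 * real r + 1) * of_int (- int k) / real N
       + pi * (2 * real p + 1) * of_int (int k) / real N
       = 2 * pi * real k * of_int (int p - int r + int H) / real N"
      using N by (simp add: NH field_simps)
    ultimately show ?thesis by (simp only: twist_def cis_mult)
  qed
  \<comment> \<open>The only index for which the sum over \<open>k\<close> does not cancel.\<close>
  define r0 where "r0 = (p + H) mod N"
  have r0: "r0 < N" using N by (simp add: r0_def)
  have dvd: "int N dvd int p - int r + int H \<longleftrightarrow> r = r0" if "r < N" for r
  proof -
    have "int N dvd int p - int r + int H \<longleftrightarrow> int (p + H) mod int N = int r mod int N"
      by (simp add: mod_eq_dvd_iff algebra_simps)
    also have "\<dots> \<longleftrightarrow> r0 = r"
      using that by (simp only: r0_def of_nat_mod[symmetric] of_nat_eq_iff) simp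
    finally show ?thesis by auto
  qed
  have "(\<Sum>k<N. \<alpha> 1 k * twist N p (int k))
      = (\<Sum>k<N. \<Sum>r<N. inverse (of_nat N) * \<gamma> r * ((-1) ^ k * twist N r (- int k) * twist N p (int k)))"
  proof (rule sum.cong[OF refl])
    fix k assume "k \<in> {..<N}"
    hence "k < N" by simp
    show "\<alpha> 1 k * twist N p (int k)
      = (\<Sum>r<N. inverse (of_nat N) * \<gamma> r * ((-1) ^ k * twist N r (- int k) * twist N p (int k)))"
      unfolding \<alpha>[OF \<open>k < N\<close>] e by (simp add: sum_distrib_left sum_distrib_right mult_ac)
  qed
  also have "\<dots> = (\<Sum>r<N. inverse (of_nat N) * \<gamma> r * (\<Sum>k<N. cis (2 * pi * real k * of_int (int p - int r + int H) / real N)))"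
    unfolding t by (subst sum.swap) (simp only: sum_distrib_left)
  also have "\<dots> = (\<Sum>r<N. if r = r0 then \<gamma> r else 0)"
    unfolding sum_cis_roots[OF N] using N by (intro sum.cong refl) (auto simp: dvd)
  also have "\<dots> = \<gamma> r0" using r0 by simp
  finally show ?thesis using \<gamma>[OF r0] by (simp add: N_def)
qed

section \<open>The one-dimensional factors of a wavelet\<close>

text \<open>With \<open>c = \<alpha> \<nu> 1\<close> this is, up to normalisation, the factor of a
  wavelet in a coordinate \<open>\<nu> \<in> e\<close>.\<close>

definition haar_comb :: "nat \<Rightarrow> (nat \<Rightarrow> complex) \<Rightarrow> int \<Rightarrow> q2 \<Rightarrow> q2 \<Rightarrow> complex" where
  "haar_comb s c j a y = (\<Sum>r<2 ^ s. c r * haar_fun j (a + of_nat r / 2 ^ s) y)"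

text \<open>The property through which the coefficients with upper index 1 enter the rest of the
  proof: their generating polynomial has modulus 1 wherever \<open>z ^ (2 ^ s) = -1\<close>.\<close>

definition unimodular_symbol :: "nat \<Rightarrow> (nat \<Rightarrow> complex) \<Rightarrow> bool" where
  "unimodular_symbol s c \<longleftrightarrow> (\<forall>p<2 ^ s. cmod (\<Sum>k<2 ^ s. c k * twist (2 ^ s) p (int k)) = 1)"

text \<open>\<open>negacyclic_convolution\<close> at a fixed point \<open>y\<close>, for the
  translates by multiples of \<open>1 / 2 ^ s\<close>: after \<open>2 ^ s\<close> steps the
  translation is by 1 and the sign changes.\<close>

lemma haar_fun_eq_haar_comb:
  assumes "unimodular_symbol s c"
  shows "haar_fun j a y = (\<Sum>q<2 ^ s. cnj (c q) * haar_comb s c j (a - of_nat q / 2 ^ s) y)"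
proof -
  define g where "g m = haar_fun j (a + of_int m / 2 ^ s) y" for m :: int
  have "g (m + int (2 ^ s)) = - g m" for m
    using haar_fun_add_1[of j "a + of_int m / 2 ^ s" y] by (simp add: g_def add_divide_distrib add.assoc)
  hence "(\<Sum>q<2 ^ s. cnj (c q) * (\<Sum>r<2 ^ s. c r * g (int r - int q))) = g 0"
    using assms by (intro negacyclic_convolution) (auto simp: unimodular_symbol_def)
  thus ?thesis by (simp add: g_def haar_comb_def diff_divide_distrib algebra_simps)
qed

lemma cnj_haar_fun [simp]: "cnj (haar_fun j a y) = haar_fun j a y"
  by (simp add: haar_fun_def haar_mother_def)

lemma cnj_ball_ind [simp]: "cnj (ball_ind j a y) = ball_ind j a y"
  by (simp add: ball_ind_def)

lemma cnj_haar_comb: "cnj (haar_comb s c j a y) = haar_comb s (\<lambda>r. cnj (c r)) j a y"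
  by (simp add: haar_comb_def)

lemma haar_comb_mult:
  assumes "\<And>b. integrable haar2 (\<lambda>y. haar_fun j b y * f y)"
  shows integrable_haar_comb_mult: "integrable haar2 (\<lambda>y. haar_comb s c j a y * f y)"
    and integral_haar_comb_mult: "(LINT y|haar2. haar_comb s c j a y * f y)
      = (\<Sum>r<2 ^ s. c r * (LINT y|haar2. haar_fun j (a + of_nat r / 2 ^ s) y * f y))"
  using assms by (simp_all add: haar_comb_def sum_distrib_right mult.assoc)

lemma mult_haar_comb:
  assumes "\<And>b. integrable haar2 (\<lambda>y. f y * haar_fun j b y)"
  shows integrable_mult_haar_comb: "integrable haar2 (\<lambda>y. f y * haar_comb s c j a y)"
    and integral_mult_haar_comb: "(LINT y|haar2. f y * haar_comb s c j a y)
      = (\<Sum>r<2 ^ s. c r * (LINT y|haar2. f y * haar_fun j (a + of_nat r / 2 ^ s) y))"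
  using haar_comb_mult[of j f s c a] assms by (simp_all only: mult.commute[of "f _"])

lemma integrable_haar_fun_haar_comb [simp]: 
  "integrable haar2 (\<lambda>y. haar_fun i a y * haar_comb s c j b y)"
  by (simp add: integrable_mult_haar_comb)

text \<open>\<open>negacyclic_convolution\<close> again, now for the correlation as a function of
  the shift: the combinations have the same inner products as the Haar functions they are built
  from.\<close>

lemma integral_haar_comb_haar_comb:
  assumes "unimodular_symbol s c"
  shows "(LINT y|haar2. haar_comb s c j a y * cnj (haar_comb s c j b y)) = 2 powi j * haar_mother (a - b)"
proof -
  define g where "g m = haar_mother (a - b + of_int m / 2 ^ s)" for m :: int
  have "(LINT y|haar2. haar_comb s c j a y * cnj (haar_comb s c j b y))
      = (\<Sum>r<2 ^ s. c r * (LINT y|haar2. haar_fun j (a + of_nat r / 2 ^ s) y * haar_comb s (\<lambda>r. cnj (c r)) j b y))"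
    unfolding cnj_haar_comb by (simp add: integral_haar_comb_mult)
  also have "\<dots> = (\<Sum>r<2 ^ s. c r * (\<Sum>q<2 ^ s. cnj (c q) * (2 powi j * g (int r - int q))))"
    by (simp add: integral_mult_haar_comb integral_haar_fun_haar_fun g_def diff_divide_distrib
        add_diff_add)
  also have "\<dots> = 2 powi j * (\<Sum>q<2 ^ s. cnj (c q) * (\<Sum>r<2 ^ s. c r * g (int r - int q)))"
    unfolding sum_distrib_left by (subst sum.swap) (simp add: mult_ac)
  also have "(\<Sum>q<2 ^ s. cnj (c q) * (\<Sum>r<2 ^ s. c r * g (int r - int q))) = g 0"
  proof (rule negacyclic_convolution)
    show "g (m + int (2 ^ s)) = - g m" for m
      using haar_mother_add_1[of "a - b + of_int m / 2 ^ s"] by (simp add: g_def add_divide_distrib add.assoc)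
  qed (use assms in \<open>auto simp: unimodular_symbol_def\<close>)
  finally show ?thesis by (simp add: g_def)
qed

lemma haar_fun_cong:
  assumes "abs2 (a - b) \<le> 1 / 2"
  shows "haar_fun j a y = haar_fun j b y"
  using haar_mother_cong[of "2 powi j * y - b" "2 powi j * y - a"] assms by (simp add: haar_fun_def)

text \<open>An even 2-adic integer leaves every term of the sum unchanged and an odd one changes
  every sign, so \<epsilon> is 1 or -1 for all terms at once.\<close>

lemma haar_comb_integer_translate:
  assumes "abs2 (a - b) \<le> 1"
  obtains \<epsilon> where "\<And>y. haar_comb s c j a y = \<epsilon> * haar_comb s c j b y"
proof -
  from abs2_le_1_cases[OF assms] show ?thesis
  proof
    assume *: "abs2 (a - b) \<le> 1 / 2"
    have "haar_comb s c j a y = 1 * haar_comb s c j b y" for y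
      unfolding haar_comb_def mult_1 
      by (intro sum.cong arg_cong2[of _ _ _ _ "(*)"] haar_fun_cong refl) (use * in simp)
    thus ?thesis by (rule that)
  next
    assume *: "abs2 (a - b - 1) \<le> 1 / 2"
    have "haar_fun j (a + t) y = - haar_fun j (b + t) y" for t y
      using haar_fun_cong[of "a + t" "b + t + 1" j y] haar_fun_add_1[of j "b + t" y] *
      by (simp add: algebra_simps)
    hence "haar_comb s c j a y = -1 * haar_comb s c j b y" for y
      by (simp add: haar_comb_def sum_negf)
    thus ?thesis by (rule that)
  qed
qed

text \<open>The scalar is the share of one coordinate in the normalisation of the wavelet; the flag
  \<open>b\<close> stands for membership of that coordinate in \<open>e\<close>.\<close>

definition factor :: "nat \<Rightarrow> (nat \<Rightarrow> complex) \<Rightarrow> int \<Rightarrow> bool \<Rightarrow> q2 \<Rightarrow> q2 \<Rightarrow> complex" where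
  "factor s c j b a y = of_real (2 powr (- (of_int j / 2))) * (if b then haar_comb s c j a y else ball_ind j a y)"

lemma integrable_factor [simp]: "integrable haar2 (factor s c j b a)"
  by (cases b) (simp_all add: factor_def[abs_def] haar_comb_def)

lemma integrable_ball_ind_haar_comb [simp]:
  "integrable haar2 (\<lambda>y. haar_comb s c i a y * ball_ind j b y)"
  "integrable haar2 (\<lambda>y. ball_ind j b y * haar_comb s c i a y)"
  using integrable_haar_comb_mult[of i "ball_ind j b" s c a] by (simp_all add: mult.commute[of "ball_ind j b _"])

lemma integrable_haar_comb_haar_comb [simp]:
  "integrable haar2 (\<lambda>y. haar_comb s c i a y * haar_comb s' c' j b y)"
  by (simp add: integrable_haar_comb_mult)

lemma factor_mult_cnj:
  "factor s c i b u y * cnj (factor s' c' j b' v y) = of_real (2 powr (- (of_int i / 2)) * 2 powr (- (of_int j / 2)))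
    * ((if b then haar_comb s c i u y else ball_ind i u y) * cnj (if b' then haar_comb s' c' j v y else ball_ind j v y))"
  by (simp add: factor_def mult_ac)

lemma integrable_factor_factor [simp]:
  "integrable haar2 (\<lambda>y. factor s c i b u y * cnj (factor s' c' j b' v y))"
  unfolding factor_mult_cnj
  by (rule integrable_mult_right) (cases b; cases b'; simp add: cnj_haar_comb)

text \<open>Haar functions of level \<open>i\<close> are orthogonal to ball indicators and to Haar
  functions of every higher level, hence to both kinds of factors there.\<close>

lemma integral_factor_cross:
  assumes "i < j"
  shows "(LINT y|haar2. factor s c i True u y * cnj (factor s' c' j b v y)) = 0"
proof -
  have "(LINT y|haar2. haar_fun i w y * haar_comb s'' c'' j v y) = 0" for w s'' c''
    by (simp add: integral_mult_haar_comb integral_haar_fun_haar_fun_less[OF assms])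
  thus ?thesis unfolding factor_mult_cnj
    using assms by (cases b) (simp_all add: integral_haar_comb_mult cnj_haar_comb integral_haar_fun_ball_ind)
qed

lemma integral_factor_cnj:
  "(LINT y|haar2. factor s c i b u y * cnj (factor s' c' j b' v y))
    = cnj (LINT y|haar2. factor s' c' j b' v y * cnj (factor s c i b u y))"
proof -
  have "cnj (LINT y|haar2. factor s' c' j b' v y * cnj (factor s c i b u y))
      = (LINT y|haar2. cnj (factor s' c' j b' v y * cnj (factor s c i b u y)))"
    by (rule Bochner_Integration.integral_cnj[symmetric])
  thus ?thesis by (simp add: mult.commute)
qed

text \<open>Points of \<open>I2\<close> at distance at most 1 coincide, which separates factors of
  the same kind. Factors of different kinds are orthogonal because Haar functions integrate to 0
  over balls of their own level.\<close>

lemma integral_factor_same_level: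
  assumes "unimodular_symbol s c" "u \<in> I2" "v \<in> I2"
  shows "(LINT y|haar2. factor s c j b u y * cnj (factor s c j b' v y)) = of_bool (b = b' \<and> u = v)"
proof -
  have uv: "abs2 (u - v) \<le> 1 \<longleftrightarrow> u = v"
    using I2_ex1[of u] assms by auto
  \<comment> \<open>The two normalising scalars cancel the measure \<open>2 powi j\<close> of the
    ball.\<close>
  have "2 powr (- (of_int j / 2)) * 2 powr (- (of_int j / 2)) * 2 powi j = (1::real)"
    by (simp add: powr_add[symmetric] powr_real_of_int'[symmetric])
  hence norm: "complex_of_real (2 powr (- (of_int j / 2)) * 2 powr (- (of_int j / 2))) * 2 powi j = 1"
    by (metis of_real_1 of_real_mult of_real_numeral of_real_power_int)
  have hm: "haar_mother (u - v) = of_bool (u = v)"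
    using uv by (auto simp: haar_mother_eq_chi2 chi2_eq_1)
  have hb: "(LINT y|haar2. haar_comb s c' j z y * ball_ind j x y) = 0" for x z c'
    by (simp add: integral_haar_comb_mult integral_haar_fun_ball_ind)
  have bh: "(LINT y|haar2. ball_ind j x y * haar_comb s c' j z y) = 0" for x z c'
    using hb[of c' z x] by (simp only: mult.commute)
  have bb: "(LINT y|haar2. ball_ind j u y * ball_ind j v y) = of_bool (u = v) * 2 powi j"
    using integral_ball_ind_ball_ind[of j j u v] by (simp add: uv)
  have "(LINT y|haar2. (if b then haar_comb s c j u y else ball_ind j u y) * cnj (if b' then haar_comb s c j v y else ball_ind j v y))
      = 2 powi j * of_bool (b = b' \<and> u = v)"
    using integral_haar_comb_haar_comb[OF assms(1), of j u v]
    by (cases b; cases b') (simp_all add: hm cnj_haar_comb bh hb bb)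
  thus ?thesis unfolding factor_mult_cnj integral_mult_right_zero using norm
    by (simp only: mult.assoc[symmetric] mult_1)
qed

section \<open>Closed linear spans of square-integrable functions\<close>

text \<open>Squared seminorms avoid roots in the estimates; the passage to \<open>l2_norm\<close> is
  made in the final theorem.\<close>

definition l2_approximable :: "'a measure \<Rightarrow> 'i set \<Rightarrow> ('i \<Rightarrow> 'a \<Rightarrow> complex) \<Rightarrow> ('a \<Rightarrow> complex) set" where
  "l2_approximable M I \<psi> = {f \<in> l2_space M. \<forall>\<epsilon>>0. \<exists>F c. finite F \<and> F \<subseteq> I \<and>
     (LINT x|M. (cmod (f x - (\<Sum>i\<in>F. c i * \<psi> i x)))\<^sup>2) < \<epsilon>}"

text \<open>This replaces the triangle inequality for squared seminorms; its factor 2 is the reason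
  for the errors \<epsilon> / 4 below.\<close>

lemma cmod_add_square_le: "(cmod (a + b))\<^sup>2 \<le> 2 * (cmod a)\<^sup>2 + 2 * (cmod b)\<^sup>2"
proof -
  have "(cmod (a + b))\<^sup>2 \<le> (cmod a + cmod b)\<^sup>2"
    by (intro power_mono norm_triangle_ineq) simp
  also have "\<dots> \<le> 2 * (cmod a)\<^sup>2 + 2 * (cmod b)\<^sup>2"
    using zero_le_power2[of "cmod a - cmod b"] by (simp add: power2_eq_square algebra_simps)
  finally show ?thesis .
qed

lemma l2_space_add:
  assumes "f \<in> l2_space M" "g \<in> l2_space M"
  shows "(\<lambda>x. f x + g x) \<in> l2_space M"
proof -
  have [measurable]: "f \<in> borel_measurable M" "g \<in> borel_measurable M"
    and int: "integrable M (\<lambda>x. (cmod (f x))\<^sup>2)" "integrable M (\<lambda>x. (cmod (g x))\<^sup>2)"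
    using assms by (auto simp: l2_space_def)
  have "integrable M (\<lambda>x. (cmod (f x + g x))\<^sup>2)"
  proof (rule Bochner_Integration.integrable_bound)
    show "integrable M (\<lambda>x. 2 * (cmod (f x))\<^sup>2 + 2 * (cmod (g x))\<^sup>2)" using int by simp
  qed (use cmod_add_square_le in auto)
  thus ?thesis by (simp add: l2_space_def)
qed

lemma l2_space_cmult: "f \<in> l2_space M \<Longrightarrow> (\<lambda>x. c * f x) \<in> l2_space M"
  by (auto simp: l2_space_def norm_mult power_mult_distrib)

lemma l2_space_0: "(\<lambda>_. 0) \<in> l2_space M"
  by (simp add: l2_space_def)

lemma l2_space_sum: "(\<And>i. i \<in> F \<Longrightarrow> g i \<in> l2_space M) \<Longrightarrow> (\<lambda>x. \<Sum>i\<in>F. g i x) \<in> l2_space M"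
  by (induction F rule: infinite_finite_induct) (simp_all add: l2_space_0 l2_space_add)

lemma l2_space_diff:
  assumes "f \<in> l2_space M" "g \<in> l2_space M"
  shows "(\<lambda>x. f x - g x) \<in> l2_space M"
  using l2_space_add[OF assms(1) l2_space_cmult[OF assms(2), of "-1"]] by simp

lemma l2_integral_add_le:
  assumes "f \<in> l2_space M" "g \<in> l2_space M"
  shows "(LINT x|M. (cmod (f x + g x))\<^sup>2) \<le> 2 * (LINT x|M. (cmod (f x))\<^sup>2) + 2 * (LINT x|M. (cmod (g x))\<^sup>2)"
proof -
  have int: "integrable M (\<lambda>x. (cmod (f x))\<^sup>2)" "integrable M (\<lambda>x. (cmod (g x))\<^sup>2)"
    using assms by (auto simp: l2_space_def)
  have "(LINT x|M. (cmod (f x + g x))\<^sup>2) \<le> (LINT x|M. 2 * (cmod (f x))\<^sup>2 + 2 * (cmod (g x))\<^sup>2)"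
    using int l2_space_add[OF assms] by (intro integral_mono) (auto simp: l2_space_def cmod_add_square_le)
  thus ?thesis using int by simp
qed

locale l2_system =
  fixes M :: "'a measure" and I :: "'i set" and \<psi> :: "'i \<Rightarrow> 'a \<Rightarrow> complex"
  assumes \<psi>_l2: "i \<in> I \<Longrightarrow> \<psi> i \<in> l2_space M"
begin

abbreviation "closed_span \<equiv> l2_approximable M I \<psi>"

lemma closed_span_l2_space: "f \<in> closed_span \<Longrightarrow> f \<in> l2_space M"
  by (simp add: l2_approximable_def)

lemma combination_l2: "F \<subseteq> I \<Longrightarrow> (\<lambda>x. \<Sum>i\<in>F. c i * \<psi> i x) \<in> l2_space M"
  by (intro l2_space_sum l2_space_cmult \<psi>_l2) blast

lemma closed_span_I:
  assumes "f \<in> l2_space M"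
    and "\<And>\<epsilon>. \<epsilon> > 0 \<Longrightarrow> \<exists>F c. finite F \<and> F \<subseteq> I \<and> (LINT x|M. (cmod (f x - (\<Sum>i\<in>F. c i * \<psi> i x)))\<^sup>2) < \<epsilon>"
  shows "f \<in> closed_span"
  using assms by (simp add: l2_approximable_def)

lemma closed_span_E:
  assumes "f \<in> closed_span" "\<epsilon> > 0"
  obtains F c where "finite F" "F \<subseteq> I" "(LINT x|M. (cmod (f x - (\<Sum>i\<in>F. c i * \<psi> i x)))\<^sup>2) < \<epsilon>"
  using assms unfolding l2_approximable_def by blast

lemma closed_span_limit:
  assumes f: "f \<in> l2_space M"
    and appr: "\<And>\<epsilon>. \<epsilon> > 0 \<Longrightarrow> \<exists>g\<in>closed_span. (LINT x|M. (cmod (f x - g x))\<^sup>2) < \<epsilon>"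
  shows "f \<in> closed_span"
proof (rule closed_span_I[OF f])
  fix \<epsilon> :: real assume "\<epsilon> > 0"
  then obtain g where g: "g \<in> closed_span" "(LINT x|M. (cmod (f x - g x))\<^sup>2) < \<epsilon> / 4"
    using appr[of "\<epsilon> / 4"] by auto
  then obtain F c where F: "finite F" "F \<subseteq> I" "(LINT x|M. (cmod (g x - (\<Sum>i\<in>F. c i * \<psi> i x)))\<^sup>2) < \<epsilon> / 4"
    using closed_span_E[of g "\<epsilon> / 4"] \<open>\<epsilon> > 0\<close> by auto
  have "(LINT x|M. (cmod (f x - (\<Sum>i\<in>F. c i * \<psi> i x)))\<^sup>2) < \<epsilon>"
    using l2_integral_add_le[OF l2_space_diff[OF f closed_span_l2_space[OF g(1)]]
        l2_space_diff[OF closed_span_l2_space[OF g(1)] combination_l2[OF F(2)]], of c] g(2) F(3) by simp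
  thus "\<exists>F c. finite F \<and> F \<subseteq> I \<and> (LINT x|M. (cmod (f x - (\<Sum>i\<in>F. c i * \<psi> i x)))\<^sup>2) < \<epsilon>"
    using F by blast
qed

lemma closed_span_basis: "i \<in> I \<Longrightarrow> \<psi> i \<in> closed_span"
  unfolding l2_approximable_def
  by (auto intro!: \<psi>_l2 exI[of _ "{i}"] exI[of _ "\<lambda>_. 1"])

lemma closed_span_0: "(\<lambda>_. 0) \<in> closed_span"
  unfolding l2_approximable_def by (auto intro!: l2_space_0 exI[of _ "{}"])

lemma closed_span_add:
  assumes f: "f \<in> closed_span" and g: "g \<in> closed_span"
  shows "(\<lambda>x. f x + g x) \<in> closed_span"
proof (rule closed_span_I)
  show "(\<lambda>x. f x + g x) \<in> l2_space M" using f g by (intro l2_space_add closed_span_l2_space)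
  fix \<epsilon> :: real assume e: "\<epsilon> > 0"
  obtain F c where F: "finite F" "F \<subseteq> I" "(LINT x|M. (cmod (f x - (\<Sum>i\<in>F. c i * \<psi> i x)))\<^sup>2) < \<epsilon> / 4"
    using closed_span_E[OF f, of "\<epsilon> / 4"] e by auto
  obtain G d where G: "finite G" "G \<subseteq> I" "(LINT x|M. (cmod (g x - (\<Sum>i\<in>G. d i * \<psi> i x)))\<^sup>2) < \<epsilon> / 4"
    using closed_span_E[OF g, of "\<epsilon> / 4"] e by auto
  \<comment> \<open>The index sets may overlap, in which case the coefficients add up.\<close>
  define k where "k i = c i * of_bool (i \<in> F) + d i * of_bool (i \<in> G)" for i
  have FG: "F \<union> G \<subseteq> I" using F G by blast
  have "(\<Sum>i\<in>F \<union> G. k i * \<psi> i x) = (\<Sum>i\<in>F \<union> G. if i \<in> F then c i * \<psi> i x else 0)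
      + (\<Sum>i\<in>F \<union> G. if i \<in> G then d i * \<psi> i x else 0)" for x
    unfolding sum.distrib[symmetric] by (intro sum.cong refl) (auto simp: k_def algebra_simps)
  also have "\<dots> x = (\<Sum>i\<in>F. c i * \<psi> i x) + (\<Sum>i\<in>G. d i * \<psi> i x)" for x
    using F(1) G(1) by (simp add: sum.If_cases Int_absorb1)
  finally have eq: "f x + g x - (\<Sum>i\<in>F \<union> G. k i * \<psi> i x)
      = (f x - (\<Sum>i\<in>F. c i * \<psi> i x)) + (g x - (\<Sum>i\<in>G. d i * \<psi> i x))" for x by simp
  have "(LINT x|M. (cmod (f x + g x - (\<Sum>i\<in>F \<union> G. k i * \<psi> i x)))\<^sup>2) < \<epsilon>"
    unfolding eq using l2_integral_add_le[OF l2_space_diff[OF closed_span_l2_space[OF f] combination_l2[OF F(2)]]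
        l2_space_diff[OF closed_span_l2_space[OF g] combination_l2[OF G(2)]], of c d] F(3) G(3) by linarith
  thus "\<exists>F c. finite F \<and> F \<subseteq> I \<and> (LINT x|M. (cmod (f x + g x - (\<Sum>i\<in>F. c i * \<psi> i x)))\<^sup>2) < \<epsilon>"
    using FG F(1) G(1) by (intro exI[of _ "F \<union> G"] exI[of _ k]) auto
qed

lemma closed_span_cmult:
  assumes f: "f \<in> closed_span"
  shows "(\<lambda>x. d * f x) \<in> closed_span"
proof (rule closed_span_I)
  show "(\<lambda>x. d * f x) \<in> l2_space M" using f by (intro l2_space_cmult closed_span_l2_space)
  fix \<epsilon> :: real assume e: "\<epsilon> > 0"
  \<comment> \<open>The summand 1 keeps the divisor positive when \<open>d = 0\<close>.\<close>
  define D where "D = (cmod d)\<^sup>2 + 1"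
  have D: "D > 0" "(cmod d)\<^sup>2 \<le> D" by (simp_all add: D_def add_nonneg_pos)
  obtain F c where F: "finite F" "F \<subseteq> I" "(LINT x|M. (cmod (f x - (\<Sum>i\<in>F. c i * \<psi> i x)))\<^sup>2) < \<epsilon> / D"
    using closed_span_E[OF f, of "\<epsilon> / D"] e D by auto
  have "d * f x - (\<Sum>i\<in>F. d * c i * \<psi> i x) = d * (f x - (\<Sum>i\<in>F. c i * \<psi> i x))" for x
    by (simp add: sum_distrib_left mult.assoc right_diff_distrib)
  hence "(LINT x|M. (cmod (d * f x - (\<Sum>i\<in>F. d * c i * \<psi> i x)))\<^sup>2)
      = (cmod d)\<^sup>2 * (LINT x|M. (cmod (f x - (\<Sum>i\<in>F. c i * \<psi> i x)))\<^sup>2)"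
    by (simp add: norm_mult power_mult_distrib)
  also have "\<dots> \<le> D * (LINT x|M. (cmod (f x - (\<Sum>i\<in>F. c i * \<psi> i x)))\<^sup>2)"
    using D by (intro mult_right_mono) auto
  also have "\<dots> < \<epsilon>" using F(3) D by (simp add: field_simps)
  finally show "\<exists>F c. finite F \<and> F \<subseteq> I \<and> (LINT x|M. (cmod (d * f x - (\<Sum>i\<in>F. c i * \<psi> i x)))\<^sup>2) < \<epsilon>"
    using F by (intro exI[of _ F] exI[of _ "\<lambda>i. d * c i"]) auto
qed

lemma closed_span_diff: "f \<in> closed_span \<Longrightarrow> g \<in> closed_span \<Longrightarrow> (\<lambda>x. f x - g x) \<in> closed_span"
  using closed_span_add[of f "\<lambda>x. (-1) * g x"] closed_span_cmult[of g "-1"] by simp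

lemma closed_span_sum: "(\<And>i. i \<in> F \<Longrightarrow> g i \<in> closed_span) \<Longrightarrow> (\<lambda>x. \<Sum>i\<in>F. g i x) \<in> closed_span"
  by (induction F rule: infinite_finite_induct) (simp_all add: closed_span_0 closed_span_add)

text \<open>Dominated convergence for the squared errors. The bound by \<open>w\<close> passes to
  the limit, which makes \<open>f\<close> square-integrable and gives the majorant with factor
  4.\<close>

lemma closed_span_dominated_limit:
  assumes f: "f \<in> borel_measurable M" and g: "\<And>n. g n \<in> closed_span"
    and lim: "\<And>x. x \<in> space M \<Longrightarrow> (\<lambda>n. g n x) \<longlonglongrightarrow> f x"
    and w: "w \<in> l2_space M" and le: "\<And>n x. x \<in> space M \<Longrightarrow> cmod (g n x) \<le> cmod (w x)"
  shows "f \<in> closed_span"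
proof -
  have wi: "integrable M (\<lambda>x. (cmod (w x))\<^sup>2)" using w by (simp add: l2_space_def)
  have gm [measurable]: "g n \<in> borel_measurable M" for n using closed_span_l2_space[OF g] by (simp add: l2_space_def)
  note f [measurable]
  have fle: "cmod (f x) \<le> cmod (w x)" if "x \<in> space M" for x
    using LIMSEQ_le_const2[OF tendsto_norm[OF lim[OF that]]] le[OF that] by blast
  have "integrable M (\<lambda>x. (cmod (f x))\<^sup>2)"
    using wi by (rule Bochner_Integration.integrable_bound) (auto intro!: power_mono fle)
  hence fl2: "f \<in> l2_space M" using f by (simp add: l2_space_def)
  have "(\<lambda>n. LINT x|M. (cmod (f x - g n x))\<^sup>2) \<longlonglongrightarrow> (LINT x|M. 0)"
  proof (rule integral_dominated_convergence)
    show "integrable M (\<lambda>x. 4 * (cmod (w x))\<^sup>2)" using wi by simp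
    show "AE x in M. (\<lambda>n. (cmod (f x - g n x))\<^sup>2) \<longlonglongrightarrow> 0"
    proof (rule AE_I2)
      fix x assume x: "x \<in> space M"
      have "(\<lambda>n. (cmod (f x - g n x))\<^sup>2) \<longlonglongrightarrow> (cmod (f x - f x))\<^sup>2"
        by (intro tendsto_intros lim x)
      thus "(\<lambda>n. (cmod (f x - g n x))\<^sup>2) \<longlonglongrightarrow> 0" by simp
    qed
    show "AE x in M. norm ((cmod (f x - g n x))\<^sup>2) \<le> 4 * (cmod (w x))\<^sup>2" for n
    proof (rule AE_I2)
      fix x assume x: "x \<in> space M"
      have "cmod (f x - g n x) \<le> 2 * cmod (w x)"
        using norm_triangle_ineq4[of "f x" "g n x"] fle[OF x] le[OF x, of n] by linarith
      hence "(cmod (f x - g n x))\<^sup>2 \<le> (2 * cmod (w x))\<^sup>2" by (intro power_mono) auto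
      thus "norm ((cmod (f x - g n x))\<^sup>2) \<le> 4 * (cmod (w x))\<^sup>2" by (simp add: power_mult_distrib)
    qed
  qed measurable
  hence lim0: "(\<lambda>n. LINT x|M. (cmod (f x - g n x))\<^sup>2) \<longlonglongrightarrow> 0" by simp
  show ?thesis
  proof (rule closed_span_limit[OF fl2])
    fix \<epsilon> :: real assume "\<epsilon> > 0"
    from order_tendstoD(2)[OF lim0 this]
    obtain n where "(LINT x|M. (cmod (f x - g n x))\<^sup>2) < \<epsilon>" by (auto simp: eventually_sequentially)
    thus "\<exists>g\<in>closed_span. (LINT x|M. (cmod (f x - g x))\<^sup>2) < \<epsilon>" using g by blast
  qed
qed

text \<open>Measure-theoretic induction from the generator to measurable sets, simple functions and
  their dominated limits. The cut-off by \<open>B n\<close> keeps the indicators square-integrable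
  when the whole space has infinite measure.\<close>

lemma closed_span_eq_l2_spaceI:
  assumes gen: "sets M = sigma_sets (space M) G" "Int_stable G" "G \<subseteq> Pow (space M)"
    and ind: "\<And>A n. A \<in> G \<Longrightarrow> indicator (A \<inter> B n) \<in> closed_span"
    and B: "\<And>n :: nat. indicator (B n) \<in> closed_span" "incseq B" "(\<Union>n. B n) = space M"
    and B_sets: "\<And>n. B n \<in> sets M"
  shows "closed_span = l2_space M"
proof (intro equalityI subsetI)
  fix f assume f: "f \<in> l2_space M"
  \<comment> \<open>For fixed \<open>n\<close>, the sets \<open>A\<close> with this property form a
    Dynkin system that contains the intersection-stable generator.\<close>
  have indH: "indicator (A \<inter> B n) \<in> closed_span" if A: "A \<in> sets M" for A n
  proof -
    have "A \<in> sigma_sets (space M) G" using A gen(1) by simp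
    with gen(2,3) show ?thesis
    proof (induction rule: sigma_sets_induct_disjoint)
      case (basic A)
      show ?case using ind[OF basic] .
    next
      case empty
      show ?case using closed_span_0 by (simp add: indicator_def[abs_def])
    next
      case (compl A)
      have "indicator ((space M - A) \<inter> B n) = (\<lambda>x. indicator (B n) x - indicator (A \<inter> B n) x :: complex)"
        using sets.sets_into_space[OF B_sets[of n]] by (auto simp: fun_eq_iff indicator_def)
      thus ?case using closed_span_diff[OF B(1) compl(2)] by simp
    next
      case (union A)
      have Am: "A i \<in> sets M" for i using union(2) gen(1) by auto
      show ?case
      proof (rule closed_span_dominated_limit[where w = "indicator (B n)"])
        show "(\<lambda>x. \<Sum>i<m. indicator (A i \<inter> B n) x) \<in> closed_span" for m
          by (intro closed_span_sum union(3))
        have eq: "(\<Sum>i<m. indicator (A i \<inter> B n) x) = (indicator ((\<Union>i<m. A i) \<inter> B n) x :: complex)" for m x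
          using union(1) by (simp add: indicator_inter_arith indicator_UN_disjoint sum_distrib_right disjoint_family_on_mono[of _ UNIV])
        show "(\<lambda>m. \<Sum>i<m. indicator (A i \<inter> B n) x) \<longlonglongrightarrow> (indicator (\<Union> (range A) \<inter> B n) x :: complex)" for x
          unfolding eq unfolding indicator_inter_arith by (intro tendsto_mult LIMSEQ_indicator_UN tendsto_const)
        show "cmod (\<Sum>i<m. indicator (A i \<inter> B n) x) \<le> cmod (indicator (B n) x)" for m x
          unfolding eq by (auto simp: indicator_def)
        show "indicator (\<Union> (range A) \<inter> B n) \<in> borel_measurable M"
          using Am B_sets[of n] by simp
        show "indicator (B n) \<in> l2_space M" by (rule closed_span_l2_space[OF B(1)])
      qed
    qed
  qed
  have fm: "f \<in> borel_measurable M" using f by (simp add: l2_space_def)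
  \<comment> \<open>The \<open>n\<close>-th simple function is cut off to \<open>B n\<close>; as
    these sets exhaust the space, the limit is still \<open>f\<close>, and \<open>2 * f\<close>
    remains a majorant.\<close>
  obtain F where "\<forall>i. simple_function M (F i)" "\<forall>x\<in>space M. (\<lambda>i. F i x) \<longlonglongrightarrow> f x"
    "\<forall>i. \<forall>x\<in>space M. dist (F i x) 0 \<le> 2 * dist (f x) 0"
    using borel_measurable_implies_sequence_metric[OF fm, of 0] by blast
  hence F: "\<And>i. simple_function M (F i)" "\<And>x. x \<in> space M \<Longrightarrow> (\<lambda>i. F i x) \<longlonglongrightarrow> f x"
    "\<And>i x. x \<in> space M \<Longrightarrow> cmod (F i x) \<le> 2 * cmod (f x)" by simp_all
  show "f \<in> closed_span"
  proof (rule closed_span_dominated_limit[OF fm])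
    show "(\<lambda>x. \<Sum>z\<in>F n ` space M. z * indicator (F n -` {z} \<inter> space M \<inter> B n) x) \<in> closed_span" for n
      by (intro closed_span_sum closed_span_cmult indH simple_functionD(2)[OF F(1)])
    have eq: "(\<Sum>z\<in>F n ` space M. z * indicator (F n -` {z} \<inter> space M \<inter> B n) x) = F n x * indicator (B n) x"
      if "x \<in> space M" for n x
    proof -
      have "(\<Sum>z\<in>F n ` space M. z * indicator (F n -` {z} \<inter> space M \<inter> B n) x)
          = (\<Sum>z\<in>F n ` space M. if z = F n x then z * indicator (B n) x else 0)"
        using that by (intro sum.cong refl) (auto simp: indicator_def)
      thus ?thesis using that simple_functionD(1)[OF F(1)[of n]] by simp
    qed
    show "(\<lambda>n. \<Sum>z\<in>F n ` space M. z * indicator (F n -` {z} \<inter> space M \<inter> B n) x) \<longlonglongrightarrow> f x"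
      if "x \<in> space M" for x
    proof -
      have "(\<lambda>n. F n x * indicator (B n) x) \<longlonglongrightarrow> f x * indicator (\<Union>n. B n) x"
        by (intro tendsto_mult F(2) that LIMSEQ_indicator_incseq B(2))
      thus ?thesis unfolding eq[OF that] using that B(3) by simp
    qed
    show "(\<lambda>x. 2 * f x) \<in> l2_space M" using f by (rule l2_space_cmult)
    show "cmod (\<Sum>z\<in>F n ` space M. z * indicator (F n -` {z} \<inter> space M \<inter> B n) x) \<le> cmod (2 * f x)"
      if "x \<in> space M" for n x
      unfolding eq[OF that] using F(3)[OF that, of n] by (auto simp: norm_mult indicator_def)
  qed
qed (rule closed_span_l2_space)

end

section \<open>Tensor products and orthonormality\<close>

interpretation haar: product_sigma_finite "\<lambda>_ :: 'n::finite. haar2"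
  by (simp add: product_sigma_finite_def sigma_finite_haar2)

lemma integrable_tensor:
  fixes f :: "'n::finite \<Rightarrow> q2 \<Rightarrow> 'b::{real_normed_field,banach,second_countable_topology}"
  shows "(\<And>\<nu>. integrable haar2 (f \<nu>)) \<Longrightarrow> integrable haar2_prod (\<lambda>x. \<Prod>\<nu>\<in>UNIV. f \<nu> (x \<nu>))"
  unfolding haar2_prod_def by (rule haar.product_integrable_prod) simp_all

lemma integral_tensor:
  fixes f :: "'n::finite \<Rightarrow> q2 \<Rightarrow> 'b::{real_normed_field,banach,second_countable_topology}"
  shows "(\<And>\<nu>. integrable haar2 (f \<nu>)) \<Longrightarrow>
    (LINT x|haar2_prod. (\<Prod>\<nu>\<in>UNIV. f \<nu> (x \<nu>))) = (\<Prod>\<nu>\<in>UNIV. (LINT y|haar2. f \<nu> y))"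
  unfolding haar2_prod_def by (rule haar.product_integral_prod) simp_all

lemma prod_of_bool: "finite A \<Longrightarrow> (\<Prod>i\<in>A. of_bool (P i)) = (of_bool (\<forall>i\<in>A. P i) :: 'a :: comm_semiring_1)"
  by (induction A rule: finite_induct) auto

section \<open>Factorisation of the wavelets over the coordinates\<close>

lemma Omega_maxabs2: "Omega (maxabs2 z) = (\<Prod>\<nu>\<in>UNIV. of_bool (abs2 (z \<nu>) \<le> 1))"
proof -
  have "0 \<le> maxabs2 z"
    unfolding maxabs2_def by (rule order_trans[OF abs2_nonneg Max_ge]) auto
  moreover have "maxabs2 z \<le> 1 \<longleftrightarrow> (\<forall>\<nu>. abs2 (z \<nu>) \<le> 1)"
    by (simp add: maxabs2_def)
  ultimately show ?thesis by (simp add: Omega_def prod_of_bool)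
qed

text \<open>The character turns the sum over the coordinates into a product, to which a coordinate
  outside \<open>e\<close> contributes \<open>chi2 0 = 1\<close>.\<close>

lemma Psi0_eq_prod:
  "Psi0 e z = (\<Prod>\<nu>\<in>UNIV. if \<nu> \<in> e then haar_mother (z \<nu>) else of_bool (abs2 (z \<nu>) \<le> 1))"
proof -
  have half: "inverse 2 * t = t / 2" for t :: q2 unfolding divide_inverse by (rule mult.commute)
  have "Psi0 e z = (\<Prod>\<nu>\<in>UNIV. chi2 (inverse 2 * (of_nat (kvec e \<nu>) * z \<nu>)) * of_bool (abs2 (z \<nu>) \<le> 1))"
    by (simp add: Psi0_def sum_distrib_left chi2_sum Omega_maxabs2 prod.distrib)
  also have "\<dots> = (\<Prod>\<nu>\<in>UNIV. if \<nu> \<in> e then haar_mother (z \<nu>) else of_bool (abs2 (z \<nu>) \<le> 1))"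
    by (intro prod.cong refl) (simp add: kvec_def haar_mother_eq_chi2 chi2_eq_1 half)
  finally show ?thesis .
qed

text \<open>Outside \<open>e\<close> the translation by \<open>r / 2 ^ s\<close> is switched off, so
  this sum is all that remains of the coefficients there.\<close>

lemma admissible_coeffs_0_sum:
  assumes "admissible_coeffs s \<alpha>"
  shows "(\<Sum>r<2 ^ s. \<alpha> 0 r) = 1"
proof -
  have "(\<Sum>r<2 ^ s. \<alpha> 0 r) = (\<Sum>r<(2::nat) ^ s. if r = 0 then 1 else 0)"
    using assms by (intro sum.cong refl) (auto simp: admissible_coeffs_def)
  thus ?thesis by simp
qed

lemma admissible_unimodular_symbol: "admissible_coeffs s \<alpha> \<Longrightarrow> unimodular_symbol s (\<alpha> 1)"
  unfolding unimodular_symbol_def using admissible_coeffs_twist by blast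

text \<open>By distributivity, the sum over multi-indices of products is the product over the
  coordinates of single sums.\<close>

lemma wavelet_eq_prod:
  fixes s :: "'n::finite \<Rightarrow> nat"
  assumes "\<And>\<nu>. admissible_coeffs (s \<nu>) (\<alpha> \<nu>)"
  shows "wavelet s \<alpha> e j a x = (\<Prod>\<nu>\<in>UNIV. factor (s \<nu>) (\<alpha> \<nu> 1) j (\<nu> \<in> e) (a \<nu>) (x \<nu>))"
proof -
  let ?t = "\<lambda>\<nu> r. \<alpha> \<nu> (kvec e \<nu>) r * (if \<nu> \<in> e then haar_fun j (a \<nu> + of_nat r / 2 ^ s \<nu>) (x \<nu>) else ball_ind j (a \<nu>) (x \<nu>))"
  have set_eq: "{r. \<forall>\<nu>. r \<nu> < 2 ^ s \<nu>} = PiE UNIV (\<lambda>\<nu>. {..<2 ^ s \<nu>})"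
    by (auto simp: PiE_UNIV_domain)
  have norm: "complex_of_real (2 powr (- (real CARD('n) * of_int j / 2)))
      = (\<Prod>\<nu>\<in>(UNIV :: 'n set). of_real (2 powr (- (of_int j / 2))))"
    by (simp add: powr_power flip: of_real_power)
  have "(\<Sum>r\<in>{r. \<forall>\<nu>. r \<nu> < 2 ^ s \<nu>}. (\<Prod>\<nu>\<in>UNIV. \<alpha> \<nu> (kvec e \<nu>) (r \<nu>)) *
        Psi0 e (\<lambda>\<nu>. 2 powi j * x \<nu> - a \<nu> - of_nat (r \<nu>) / 2 ^ s \<nu> * of_nat (kvec e \<nu>)))
      = (\<Sum>r\<in>PiE UNIV (\<lambda>\<nu>. {..<2 ^ s \<nu>}). \<Prod>\<nu>\<in>UNIV. ?t \<nu> (r \<nu>))"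
    unfolding set_eq Psi0_eq_prod prod.distrib[symmetric]
    by (intro sum.cong prod.cong refl) (auto simp: kvec_def haar_fun_def ball_ind_def diff_diff_eq)
  also have "\<dots> = (\<Prod>\<nu>\<in>UNIV. \<Sum>r<2 ^ s \<nu>. ?t \<nu> r)"
    by (rule prod_sum_PiE[symmetric]) auto
  also have "\<dots> = (\<Prod>\<nu>\<in>UNIV. if \<nu> \<in> e then haar_comb (s \<nu>) (\<alpha> \<nu> 1) j (a \<nu>) (x \<nu>) else ball_ind j (a \<nu>) (x \<nu>))"
    by (intro prod.cong refl)
      (simp add: kvec_def haar_comb_def sum_distrib_right[symmetric] admissible_coeffs_0_sum[OF assms])
  finally show ?thesis unfolding wavelet_def norm factor_def prod.distrib by simp
qed

lemma wavelet_l2_space: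
  fixes s :: "'n::finite \<Rightarrow> nat"
  assumes "\<And>\<nu>. admissible_coeffs (s \<nu>) (\<alpha> \<nu>)"
  shows "wavelet s \<alpha> e j a \<in> l2_space haar2_prod"
proof -
  have eq: "wavelet s \<alpha> e j a = (\<lambda>x. \<Prod>\<nu>\<in>UNIV. factor (s \<nu>) (\<alpha> \<nu> 1) j (\<nu> \<in> e) (a \<nu>) (x \<nu>))"
    by (intro ext wavelet_eq_prod assms)
  have "integrable haar2 (\<lambda>y. (cmod (factor s c j b u y))\<^sup>2)" for s c b u
    using integrable_norm[OF integrable_factor_factor[of s c j b u s c j b u]]
    by (simp add: norm_mult power2_eq_square)
  hence "integrable haar2_prod (\<lambda>x. (cmod (wavelet s \<alpha> e j a x))\<^sup>2)"
    unfolding eq prod_norm[symmetric] prod_power_distrib by (intro integrable_tensor)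
  moreover have "wavelet s \<alpha> e j a \<in> borel_measurable haar2_prod"
    unfolding eq by (intro borel_measurable_integrable integrable_tensor integrable_factor)
  ultimately show ?thesis by (simp add: l2_space_def)
qed

text \<open>The inner product factors over the coordinates. For different levels, the wavelet of
  smaller level has a Haar combination in some coordinate because its index set is nonempty, and the
  integral in that coordinate vanishes.\<close>

lemma wavelet_orthonormal:
  fixes s :: "'n::finite \<Rightarrow> nat"
  assumes adm: "\<And>\<nu>. admissible_coeffs (s \<nu>) (\<alpha> \<nu>)"
    and e: "e \<noteq> {}" "e' \<noteq> {}" and a: "\<And>\<nu>. a \<nu> \<in> I2" "\<And>\<nu>. a' \<nu> \<in> I2"
  shows "l2_inner haar2_prod (wavelet s \<alpha> e j a) (wavelet s \<alpha> e' j' a') = (if (e, j, a) = (e', j', a') then 1 else 0)"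
proof -
  define c where "c \<nu> = \<alpha> \<nu> 1" for \<nu>
  have c: "unimodular_symbol (s \<nu>) (c \<nu>)" for \<nu>
    unfolding c_def by (rule admissible_unimodular_symbol[OF adm])
  let ?I = "\<lambda>\<nu>. (LINT y|haar2. factor (s \<nu>) (c \<nu>) j (\<nu> \<in> e) (a \<nu>) y * cnj (factor (s \<nu>) (c \<nu>) j' (\<nu> \<in> e') (a' \<nu>) y))"
  have "l2_inner haar2_prod (wavelet s \<alpha> e j a) (wavelet s \<alpha> e' j' a') = (\<Prod>\<nu>\<in>UNIV. ?I \<nu>)"
    unfolding l2_inner_def wavelet_eq_prod[OF adm] cnj_prod prod.distrib[symmetric] c_def
    by (rule integral_tensor) simp
  also have "\<dots> = (if (e, j, a) = (e', j', a') then 1 else 0)"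
  proof (cases "j = j'")
    case True
    have "(\<Prod>\<nu>\<in>UNIV. ?I \<nu>) = (\<Prod>\<nu>\<in>UNIV. of_bool ((\<nu> \<in> e) = (\<nu> \<in> e') \<and> a \<nu> = a' \<nu>))"
      unfolding True[symmetric] by (intro prod.cong refl integral_factor_same_level c a)
    also have "\<dots> = of_bool (e = e' \<and> a = a')"
      unfolding prod_of_bool[OF finite] by (rule arg_cong[of _ _ of_bool]) auto
    finally show ?thesis using True by simp
  next
    case False
    then consider "j < j'" | "j' < j" by linarith
    hence "\<exists>\<nu>. ?I \<nu> = 0"
    proof cases
      case 1
      obtain \<nu> where "\<nu> \<in> e" using e by blast
      hence "?I \<nu> = 0" using integral_factor_cross[OF 1] by simp
      thus ?thesis ..
    next
      case 2
      obtain \<nu> where "\<nu> \<in> e'" using e by blast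
      hence "?I \<nu> = 0" using integral_factor_cross[OF 2] by (subst integral_factor_cnj) simp
      thus ?thesis ..
    qed
    hence "(\<Prod>\<nu>\<in>UNIV. ?I \<nu>) = 0" by (intro prod_zero) auto
    thus ?thesis using False by simp
  qed
  finally show ?thesis .
qed

section \<open>Expansion of Haar functions and ball indicators in wavelet factors\<close>

lemma ball_ind_cong:
  assumes "abs2 (a - b) \<le> 1"
  shows "ball_ind j a y = ball_ind j b y"
  using abs2_add_le_iff[OF assms, of "2 powi j * y - a"] by (simp add: ball_ind_def)

text \<open>All translations \<open>d q\<close> can be taken from \<open>I2\<close>, because translating by a 2-adic integer changes a
  factor at most by a sign.\<close>

lemma factor_expansion:
  assumes "unimodular_symbol s c"
  shows "\<exists>(A :: nat set) k d. finite A \<and> (\<forall>q. d q \<in> I2) \<and>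
    (\<forall>y. (if b then haar_fun j a y else ball_ind j a y) = (\<Sum>q\<in>A. k q * factor s c j b (d q) y))"
proof -
  define n where "n = complex_of_real (2 powr (- (of_int j / 2)))"
  have n: "n \<noteq> 0" by (simp add: n_def)
  hence inv: "inverse n * (n * z) = z" for z by simp
  show ?thesis
  proof (cases b)
    case False
    obtain u where u: "u \<in> I2" "abs2 (a - u) \<le> 1" using I2_ex1[of a] by blast
    show ?thesis
      by (intro exI[of _ "{0}"] exI[of _ "\<lambda>_. inverse n"] exI[of _ "\<lambda>_. u"])
        (use u(1) n ball_ind_cong[OF u(2)] False in \<open>simp_all add: factor_def n_def[symmetric]\<close>)
  next
    case True
    have "\<exists>u. u \<in> I2 \<and> (\<exists>\<epsilon>. \<forall>y. haar_comb s c j (a - of_nat q / 2 ^ s) y = \<epsilon> * haar_comb s c j u y)" for q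
    proof -
      obtain u where "u \<in> I2" "abs2 (a - of_nat q / 2 ^ s - u) \<le> 1"
        using I2_ex1[of "a - of_nat q / 2 ^ s"] by blast
      thus ?thesis by (meson haar_comb_integer_translate)
    qed
    then obtain d \<epsilon> where d: "\<And>q. d q \<in> I2"
      and \<epsilon>: "\<And>q y. haar_comb s c j (a - of_nat q / 2 ^ s) y = \<epsilon> q * haar_comb s c j (d q) y"
      by metis
    show ?thesis
    proof (intro exI[of _ "{..<2 ^ s}"] exI[of _ "\<lambda>q. cnj (c q) * \<epsilon> q * inverse n"] exI[of _ d] conjI allI)
      show "(if b then haar_fun j a y else ball_ind j a y)
          = (\<Sum>q<2 ^ s. cnj (c q) * \<epsilon> q * inverse n * factor s c j b (d q) y)" for y
        using True n haar_fun_eq_haar_comb[OF assms, of j a y]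
        by (simp add: factor_def n_def[symmetric] \<epsilon> mult.assoc inv)
    qed (use d in auto)
  qed
qed

text \<open>Multiplying out gives a finite combination of pure tensors. This serves both to expand
  Haar tensors into wavelets and to cut boxes into cubes.\<close>

lemma tensor_of_sums:
  fixes g :: "'n::finite \<Rightarrow> 'b \<Rightarrow> complex"
  assumes "l2_system M I \<psi>"
    and fin: "\<And>\<nu>. finite (A \<nu>)"
    and g: "\<And>\<nu> y. g \<nu> y = (\<Sum>i\<in>A \<nu>. c \<nu> i * h \<nu> i y)"
    and h: "\<And>p. (\<And>\<nu>. p \<nu> \<in> A \<nu>) \<Longrightarrow> (\<lambda>x. \<Prod>\<nu>\<in>UNIV. h \<nu> (p \<nu>) (x \<nu>)) \<in> l2_approximable M I \<psi>"
  shows "(\<lambda>x. \<Prod>\<nu>\<in>UNIV. g \<nu> (x \<nu>)) \<in> l2_approximable M I \<psi>"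
proof -
  interpret l2_system M I \<psi> by fact
  have "(\<lambda>x. \<Prod>\<nu>\<in>UNIV. g \<nu> (x \<nu>)) 
      = (\<lambda>x. \<Sum>p\<in>PiE UNIV A. (\<Prod>\<nu>\<in>UNIV. c \<nu> (p \<nu>)) * (\<Prod>\<nu>\<in>UNIV. h \<nu> (p \<nu>) (x \<nu>)))"
    unfolding g prod.distrib[symmetric] by (subst prod_sum_PiE) (auto simp: fin)
  thus ?thesis by (auto intro!: closed_span_sum closed_span_cmult h)
qed

section \<open>Completeness\<close>

definition cube_ind :: "int \<Rightarrow> ('n::finite \<Rightarrow> q2) \<Rightarrow> ('n \<Rightarrow> q2) \<Rightarrow> complex" where
  "cube_ind j a x = (\<Prod>\<nu>\<in>UNIV. ball_ind j (a \<nu>) (x \<nu>))"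

lemma integrable_cmod_square_ball_ind: "integrable haar2 (\<lambda>y. (cmod (ball_ind j a y))\<^sup>2)"
  and integral_cmod_square_ball_ind: "(LINT y|haar2. (cmod (ball_ind j a y))\<^sup>2) = 2 powi j"
proof -
  have 1: "(cmod (ball_ind j a y))\<^sup>2 = Re (ball_ind j a y)" for y
    by (simp add: ball_ind_def)
  have "complex_of_real (2 powi j) = 2 powi j" by simp
  hence 2: "Re (2 powi j) = 2 powi j" by (metis Re_complex_of_real)
  have "has_bochner_integral haar2 (\<lambda>y. (cmod (ball_ind j a y))\<^sup>2) (2 powi j)"
    using has_bochner_integral_Re[OF ball_ind_has_integral[of j a]] by (simp add: 1 2)
  thus "integrable haar2 (\<lambda>y. (cmod (ball_ind j a y))\<^sup>2)" 
    "(LINT y|haar2. (cmod (ball_ind j a y))\<^sup>2) = 2 powi j"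
    by (simp_all add: has_bochner_integral_iff)
qed

lemma
  fixes a :: "'n::finite \<Rightarrow> q2"
  shows cube_ind_l2_space: "cube_ind j a \<in> l2_space haar2_prod"
    and integral_cmod_square_cube_ind: "(LINT x|haar2_prod. (cmod (cube_ind j a x))\<^sup>2) = (2 powi j) ^ CARD('n)"
proof -
  have eq: "(cmod (cube_ind j a x))\<^sup>2 = (\<Prod>\<nu>\<in>UNIV. (cmod (ball_ind j (a \<nu>) (x \<nu>)))\<^sup>2)" for x
    by (simp only: cube_ind_def prod_norm[symmetric] prod_power_distrib)
  have "cube_ind j a \<in> borel_measurable haar2_prod"
    unfolding cube_ind_def[abs_def] by (intro borel_measurable_integrable integrable_tensor integrable_ball_ind)
  thus "cube_ind j a \<in> l2_space haar2_prod"
    unfolding l2_space_def eq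
    by (simp add: eq integrable_tensor[of "\<lambda>\<nu> y. (cmod (ball_ind j (a \<nu>) y))\<^sup>2"] integrable_cmod_square_ball_ind)
  show "(LINT x|haar2_prod. (cmod (cube_ind j a x))\<^sup>2) = (2 powi j) ^ CARD('n)"
    unfolding eq by (subst integral_tensor) (simp_all add: integrable_cmod_square_ball_ind integral_cmod_square_ball_ind)
qed

text \<open>The set \<open>e\<close> records where the first summand is chosen; it becomes the index
  \<open>e\<close> of the wavelets.\<close>

lemma prod_add_UNIV:
  fixes f g :: "'n::finite \<Rightarrow> complex"
  shows "(\<Prod>\<nu>\<in>UNIV. f \<nu> + g \<nu>) = (\<Sum>e\<in>UNIV. \<Prod>\<nu>\<in>UNIV. if \<nu> \<in> e then f \<nu> else g \<nu>)"
proof -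
  have "(\<Prod>\<nu>\<in>UNIV. if \<nu> \<in> e then f \<nu> else g \<nu>) = (\<Prod>\<nu>\<in>e. f \<nu>) * (\<Prod>\<nu>\<in>UNIV - e. g \<nu>)" for e
    by (simp add: prod.If_cases Compl_eq_Diff_UNIV)
  thus ?thesis by (simp add: prod_add)
qed

text \<open>Each factor is generated by \<open>balls2\<close>, whose countability supplies the
  countable covering required for generating the product by boxes.\<close>

lemma sets_haar2_prod:
  "sets (haar2_prod :: ('n::finite \<Rightarrow> q2) measure) = sigma_sets UNIV {PiE UNIV F | F. \<forall>\<nu>. F \<nu> \<in> balls2}"
proof -
  have "sets (haar2_prod :: ('n \<Rightarrow> q2) measure) = sets (PiM (UNIV :: 'n set) (\<lambda>_. sigma UNIV balls2))"
    unfolding haar2_prod_def by (intro sets_PiM_cong refl) (simp add: sets_borel_q2)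
  also have "\<dots> = sets (sigma (\<Pi>\<^sub>E i\<in>(UNIV :: 'n set). UNIV)
      {{f\<in>(\<Pi>\<^sub>E i\<in>UNIV. UNIV). \<forall>i\<in>j. f i \<in> A i} | A j. j \<in> {UNIV :: 'n set} \<and> A \<in> Pi j (\<lambda>_. balls2)})"
  proof (rule sets_PiM_sigma)
    show "\<exists>S\<subseteq>balls2. countable S \<and> UNIV = \<Union> S"
    proof (intro exI conjI)
      have "y \<in> ball2 y 0" for y by (simp add: ball2_def)
      thus "UNIV = \<Union> balls2" unfolding balls2_def by blast
    qed (auto simp: countable_balls2)
  qed auto
  also have "{{f\<in>(\<Pi>\<^sub>E i\<in>UNIV. UNIV). \<forall>i\<in>j. f i \<in> A i} | A j. j \<in> {UNIV :: 'n set} \<and> A \<in> Pi j (\<lambda>_. balls2)} = {PiE UNIV F | F. \<forall>\<nu>. F \<nu> \<in> balls2}"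
    by (auto simp: PiE_UNIV_domain Pi_def)
  finally show ?thesis by simp
qed

section \<open>Approximation of cubes, boxes and square-integrable functions by wavelets\<close>

definition wavelet_index :: "('n set \<times> int \<times> ('n \<Rightarrow> q2)) set" where
  "wavelet_index = {(e, j, a). e \<noteq> {} \<and> (\<forall>\<nu>. a \<nu> \<in> I2)}"

definition wavelet_family :: "('n::finite \<Rightarrow> nat) \<Rightarrow> ('n \<Rightarrow> nat \<Rightarrow> nat \<Rightarrow> complex) \<Rightarrow>
    'n set \<times> int \<times> ('n \<Rightarrow> q2) \<Rightarrow> ('n \<Rightarrow> q2) \<Rightarrow> complex" where
  "wavelet_family s \<alpha> = (\<lambda>(e, j, a). wavelet s \<alpha> e j a)"

locale wavelet_system =
  fixes s :: "'n::finite \<Rightarrow> nat" and \<alpha> :: "'n \<Rightarrow> nat \<Rightarrow> nat \<Rightarrow> complex"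
  assumes adm: "\<And>\<nu>. admissible_coeffs (s \<nu>) (\<alpha> \<nu>)"
begin

sublocale l2_system "haar2_prod :: ('n \<Rightarrow> q2) measure" wavelet_index "wavelet_family s \<alpha>"
  by unfold_locales (use wavelet_l2_space[of s \<alpha>, OF adm] in \<open>simp add: wavelet_family_def split: prod.splits\<close>)

text \<open>Expanding each coordinate by \<open>factor_expansion\<close> and multiplying out
  produces only wavelets with the given \<open>e\<close> and \<open>j\<close> and with translations
  in \<open>I2\<close>, although \<open>a\<close> is arbitrary.\<close>

lemma haar_tensor_in_closed_span:
  assumes "e \<noteq> {}"
  shows "(\<lambda>x. \<Prod>\<nu>\<in>UNIV. if \<nu> \<in> e then haar_fun j (a \<nu>) (x \<nu>) else ball_ind j (a \<nu>) (x \<nu>)) \<in> closed_span"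
proof -
  have "\<exists>(A :: nat set) k d. finite A \<and> (\<forall>q. d q \<in> I2) \<and>
    (\<forall>y. (if \<nu> \<in> e then haar_fun j (a \<nu>) y else ball_ind j (a \<nu>) y) 
        = (\<Sum>q\<in>A. k q * factor (s \<nu>) (\<alpha> \<nu> 1) j (\<nu> \<in> e) (d q) y))" for \<nu>
    by (rule factor_expansion[OF admissible_unimodular_symbol[OF adm]])
  hence "\<forall>\<nu>. \<exists>(A :: nat set) k d. finite A \<and> (\<forall>q. d q \<in> I2) \<and>
    (\<forall>y. (if \<nu> \<in> e then haar_fun j (a \<nu>) y else ball_ind j (a \<nu>) y) 
        = (\<Sum>q\<in>A. k q * factor (s \<nu>) (\<alpha> \<nu> 1) j (\<nu> \<in> e) (d q) y))" by (rule allI)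
  then obtain A :: "'n \<Rightarrow> nat set" and k d where "\<forall>\<nu>. finite (A \<nu>) \<and> (\<forall>q. d \<nu> q \<in> I2) \<and>
    (\<forall>y. (if \<nu> \<in> e then haar_fun j (a \<nu>) y else ball_ind j (a \<nu>) y) 
        = (\<Sum>q\<in>A \<nu>. k \<nu> q * factor (s \<nu>) (\<alpha> \<nu> 1) j (\<nu> \<in> e) (d \<nu> q) y))"
    unfolding choice_iff by (elim exE) (rule that)
  hence A: "\<And>\<nu>. finite (A \<nu>)" "\<And>\<nu> q. d \<nu> q \<in> I2"
    and eq: "\<And>\<nu> y. (if \<nu> \<in> e then haar_fun j (a \<nu>) y else ball_ind j (a \<nu>) y) 
        = (\<Sum>q\<in>A \<nu>. k \<nu> q * factor (s \<nu>) (\<alpha> \<nu> 1) j (\<nu> \<in> e) (d \<nu> q) y)"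
    by blast+
  show ?thesis
  proof (rule tensor_of_sums[OF l2_system_axioms A(1) eq])
    fix p :: "'n \<Rightarrow> nat"
    have "(e, j, \<lambda>\<nu>. d \<nu> (p \<nu>)) \<in> wavelet_index"
      using assms A by (simp add: wavelet_index_def)
    from closed_span_basis[OF this]
    show "(\<lambda>x. \<Prod>\<nu>\<in>UNIV. factor (s \<nu>) (\<alpha> \<nu> 1) j (\<nu> \<in> e) (d \<nu> (p \<nu>)) (x \<nu>)) \<in> closed_span"
      by (simp add: wavelet_family_def wavelet_eq_prod[OF adm, abs_def])
  qed
qed

text \<open>\<open>ball_ind_double\<close> in every coordinate, multiplied out over subsets
  \<open>e\<close>: the empty set gives the larger cube, and every other term is a Haar
  tensor.\<close>

lemma cube_ind_coarsen:
  "(\<lambda>x. cube_ind (j - 1) a x - cube_ind j (\<lambda>\<nu>. 2 * a \<nu>) x / 2 ^ CARD('n)) \<in> closed_span"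
proof -
  let ?t = "\<lambda>e x. \<Prod>\<nu>\<in>UNIV. if \<nu> \<in> e then haar_fun j (2 * a \<nu>) (x \<nu>) else ball_ind j (2 * a \<nu>) (x \<nu>)"
  have eq: "cube_ind (j - 1) a x - cube_ind j (\<lambda>\<nu>. 2 * a \<nu>) x / 2 ^ CARD('n)
      = inverse (2 ^ CARD('n)) * (\<Sum>e\<in>UNIV - {{}}. ?t e x)" for x
  proof -
    have "cube_ind (j - 1) a x = (\<Sum>e\<in>UNIV. ?t e x) / 2 ^ CARD('n)"
      unfolding cube_ind_def ball_ind_double[of j] prod_add_UNIV[symmetric]
      by (simp add: prod_dividef add.commute)
    also have "(\<Sum>e\<in>UNIV. ?t e x) = ?t {} x + (\<Sum>e\<in>UNIV - {{}}. ?t e x)"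
      by (rule sum.remove) auto
    also have "?t {} x = cube_ind j (\<lambda>\<nu>. 2 * a \<nu>) x"
      by (simp add: cube_ind_def)
    finally show ?thesis by (simp add: distrib_left divide_inverse mult.commute)
  qed
  show ?thesis unfolding eq by (intro closed_span_cmult closed_span_sum haar_tensor_in_closed_span) simp
qed

lemma cube_ind_coarsen_iter:
  "(\<lambda>x. cube_ind j a x - cube_ind (j + int m) (\<lambda>\<nu>. 2 ^ m * a \<nu>) x / (2 ^ CARD('n)) ^ m) \<in> closed_span"
proof (induction m)
  case (Suc m)
  define b where "b \<nu> = 2 ^ m * a \<nu>" for \<nu>
  have "(\<lambda>x. inverse ((2 ^ CARD('n)) ^ m) * (cube_ind (j + int m) b x
      - cube_ind (j + int (Suc m)) (\<lambda>\<nu>. 2 * b \<nu>) x / 2 ^ CARD('n))) \<in> closed_span"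
    using cube_ind_coarsen[of "j + int (Suc m)" b] by (intro closed_span_cmult) simp
  from closed_span_add[OF Suc.IH this]
  have "(\<lambda>x. cube_ind j a x - cube_ind (j + int m) b x / (2 ^ CARD('n)) ^ m
      + inverse ((2 ^ CARD('n)) ^ m) * (cube_ind (j + int m) b x
      - cube_ind (j + int (Suc m)) (\<lambda>\<nu>. 2 * b \<nu>) x / 2 ^ CARD('n))) \<in> closed_span"
    unfolding b_def .
  moreover have "(\<lambda>\<nu>. 2 * b \<nu>) = (\<lambda>\<nu>. 2 ^ Suc m * a \<nu>)" by (simp add: b_def mult.assoc)
  ultimately show ?case
    by (simp only: right_diff_distrib divide_inverse power_Suc inverse_mult_distrib mult_ac diff_add_cancel
        diff_add_eq add_diff_eq)
qed (simp add: closed_span_0)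

text \<open>After \<open>m\<close> steps the measure of the cube has grown by
  \<open>2 ^ (N * m)\<close>, while the squared coefficient is \<open>1 / 2 ^ (2 * N * m)\<close>.
  The squared norm of the remainder thus tends to 0, even though its integral stays
  constant.\<close>

lemma cube_ind_in_closed_span: "cube_ind j a \<in> closed_span"
proof (rule closed_span_limit[OF cube_ind_l2_space])
  fix \<epsilon> :: real assume e: "\<epsilon> > 0"
  define N where "N = CARD('n)"
  have N: "N > 0" by (simp add: N_def)
  have int: "(LINT x|haar2_prod. (cmod (cube_ind (j + int m) (b :: 'n \<Rightarrow> q2) x / (2 ^ N) ^ m))\<^sup>2) 
     = (2 powi j) ^ N * ((1 / 2) ^ N) ^ m" for m b
  proof -
    have "(LINT x|haar2_prod. (cmod (cube_ind (j + int m) (b :: 'n \<Rightarrow> q2) x / (2 ^ N) ^ m))\<^sup>2)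
        = (2 powi (j + int m)) ^ N / (((2 ^ N) ^ m)\<^sup>2)"
      by (simp add: norm_divide norm_power power_divide integral_cmod_square_cube_ind N_def)
    also have "\<dots> = (2 powi j) ^ N * (((2 ^ m) ^ N) / (((2 ^ N) ^ m)\<^sup>2))"
      by (simp add: power_int_add power_mult_distrib)
    also have "((2 ^ m) ^ N) / (((2 ^ N) ^ m)\<^sup>2) = (((1 / 2) ^ N) ^ m :: real)"
      by (simp add: power_mult[symmetric] mult.commute[of m] power2_eq_square power_one_over)
    finally show ?thesis .
  qed
  have "(\<lambda>m. (2 powi j) ^ N * ((1 / 2 :: real) ^ N) ^ m) \<longlonglongrightarrow> (2 powi j) ^ N * 0"
    using N by (intro tendsto_mult tendsto_const LIMSEQ_power_zero) (simp add: power_less_one_iff norm_power)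
  hence "eventually (\<lambda>m. (2 powi j) ^ N * ((1 / 2 :: real) ^ N) ^ m < \<epsilon>) sequentially"
    using e by (intro order_tendstoD) simp_all
  then obtain m where "(2 powi j) ^ N * ((1 / 2 :: real) ^ N) ^ m < \<epsilon>"
    by (auto simp: eventually_sequentially)
  hence m: "(LINT x|haar2_prod. (cmod (cube_ind (j + int m) (\<lambda>\<nu>. 2 ^ m * a \<nu>) x / (2 ^ N) ^ m))\<^sup>2) < \<epsilon>"
    unfolding int .
  show "\<exists>g\<in>closed_span. (LINT x|haar2_prod. (cmod (cube_ind j a x - g x))\<^sup>2) < \<epsilon>"
    by (rule bexI[OF _ cube_ind_coarsen_iter[of j a m]]) (use m in \<open>simp add: N_def\<close>)
qed

text \<open>All sides are refined to the smallest level \<open>J\<close>, which decomposes the box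
  into cubes.\<close>

lemma box_ind_in_closed_span: "(\<lambda>x. \<Prod>\<nu>\<in>UNIV. ball_ind (j \<nu>) (a \<nu>) (x \<nu>)) \<in> closed_span"
proof -
  define J where "J = Min (range j)"
  have J: "j \<nu> - int (nat (j \<nu> - J)) = J" for \<nu>
    by (simp add: J_def)
  show ?thesis
  proof (rule tensor_of_sums[OF l2_system_axioms])
    show "finite {..<(2::nat) ^ nat (j \<nu> - J)}" for \<nu> by simp
    show "ball_ind (j \<nu>) (a \<nu>) y = (\<Sum>i<2 ^ nat (j \<nu> - J). 1 * ball_ind J ((a \<nu> + of_nat i) / 2 ^ nat (j \<nu> - J)) y)" for \<nu> y
      using ball_ind_refine[of "j \<nu>" "a \<nu>" y "nat (j \<nu> - J)"] by (simp only: J mult_1)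
    show "(\<lambda>x. \<Prod>\<nu>\<in>UNIV. ball_ind J ((a \<nu> + of_nat (p \<nu>)) / 2 ^ nat (j \<nu> - J)) (x \<nu>)) \<in> closed_span" for p
      using cube_ind_in_closed_span[of J "\<lambda>\<nu>. (a \<nu> + of_nat (p \<nu>)) / 2 ^ nat (j \<nu> - J)"] by (simp add: cube_ind_def[abs_def])
  qed
qed

lemma indicator_PiE_UNIV: "indicator (PiE UNIV F) x = (\<Prod>\<nu>\<in>UNIV. indicator (F \<nu>) (x \<nu> :: 'b) :: complex)"
  for F :: "'n \<Rightarrow> 'b set"
  unfolding indicator_def prod_of_bool[OF finite] by (simp add: PiE_UNIV_domain Pi_iff)

lemma closed_span_eq_l2_space: "closed_span = l2_space haar2_prod"
proof (rule closed_span_eq_l2_spaceI)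
  let ?G = "{PiE UNIV F | F :: 'n \<Rightarrow> q2 set. \<forall>\<nu>. F \<nu> \<in> balls2}"
  \<comment> \<open>The cube of radius \<open>2 ^ n\<close> around 0; the trivial \<open>- 0\<close>
    matches the form of \<open>ball_ind\<close>.\<close>
  let ?B = "\<lambda>n. {x :: 'n \<Rightarrow> q2. \<forall>\<nu>. abs2 (2 powi int n * x \<nu> - 0) \<le> 1}"
  have space: "space (haar2_prod :: ('n \<Rightarrow> q2) measure) = UNIV"
    by (simp add: haar2_prod_def space_PiM)
  have Bind: "indicator (?B n) = cube_ind (int n) (\<lambda>_ :: 'n. 0)" for n
    by (simp add: fun_eq_iff cube_ind_def ball_ind_def prod_of_bool indicator_def)
  show "sets haar2_prod = sigma_sets (space haar2_prod) ?G"
    unfolding space by (rule sets_haar2_prod)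
  show "Int_stable ?G"
  proof (rule Int_stableI)
    fix a b assume "a \<in> ?G" "b \<in> ?G"
    then obtain F F' where F: "a = PiE UNIV F" "b = PiE UNIV F'" "\<And>\<nu>. F \<nu> \<in> balls2" "\<And>\<nu>. F' \<nu> \<in> balls2" by blast
    have "a \<inter> b = PiE UNIV (\<lambda>\<nu>. F \<nu> \<inter> F' \<nu>)" unfolding F by (rule PiE_Int)
    moreover have "F \<nu> \<inter> F' \<nu> \<in> balls2" for \<nu> using Int_stableD[OF Int_stable_balls2 F(3,4)] .
    ultimately show "a \<inter> b \<in> ?G" by blast
  qed
  show "?G \<subseteq> Pow (space haar2_prod)" by (simp add: space)
  show "indicator (A \<inter> ?B n) \<in> closed_span" if A: "A \<in> ?G" for A n
  proof -
    obtain F where F: "A = PiE UNIV F" "\<And>\<nu>. F \<nu> \<in> balls2" using A by blast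
    show ?thesis
    proof (cases "\<exists>\<nu>. F \<nu> = {}")
      case True
      hence "A = {}" by (simp add: F(1) PiE_eq_empty_iff)
      thus ?thesis using closed_span_0 by (simp add: indicator_def[abs_def])
    next
      case False
      hence "\<exists>c k. F \<nu> = ball2 c k" for \<nu> using F(2)[of \<nu>] by (auto simp: balls2_def)
      then obtain c k where ck: "\<And>\<nu>. F \<nu> = ball2 (c \<nu>) (k \<nu>)" by metis
      define a where "a \<nu> = c \<nu> / 2 ^ k \<nu>" for \<nu>
      have "indicator (F \<nu>) y = ball_ind (- int (k \<nu>)) (a \<nu>) y" for \<nu> y
        by (simp add: ball_ind_neg ck a_def)
      \<comment> \<open>A ball of radius at most 1 lies inside the ball of radius
        \<open>2 ^ n\<close> or misses it, so the intersection is the original box or empty.\<close>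
      hence "indicator (F \<nu>) y * ball_ind (int n) 0 y
          = of_bool (abs2 (2 powi (int n + int (k \<nu>)) * a \<nu>) \<le> 1) * ball_ind (- int (k \<nu>)) (a \<nu>) y" for \<nu> y
        using ball_ind_mult[of "- int (k \<nu>)" "int n" "a \<nu>" y 0] by (simp only: diff_0_right diff_minus_eq_add)
      hence "indicator (A \<inter> ?B n) x = (\<Prod>\<nu>\<in>UNIV. of_bool (abs2 (2 powi (int n + int (k \<nu>)) * a \<nu>) \<le> 1))
         * (\<Prod>\<nu>\<in>UNIV. ball_ind (- int (k \<nu>)) (a \<nu>) (x \<nu>))" for x
        unfolding indicator_inter_arith Bind cube_ind_def F(1) indicator_PiE_UNIV prod.distrib[symmetric]
        by (intro prod.cong refl)
      hence "indicator (A \<inter> ?B n) = (\<lambda>x. (\<Prod>\<nu>\<in>UNIV. of_bool (abs2 (2 powi (int n + int (k \<nu>)) * a \<nu>) \<le> 1))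
         * (\<Prod>\<nu>\<in>UNIV. ball_ind (- int (k \<nu>)) (a \<nu>) (x \<nu>)))" by blast
      thus ?thesis using closed_span_cmult[OF box_ind_in_closed_span] by simp
    qed
  qed
  show "indicator (?B n) \<in> closed_span" for n unfolding Bind by (rule cube_ind_in_closed_span)
  have abs: "abs2 (2 powi int n * y - 0) \<le> 1 \<longleftrightarrow> abs2 y \<le> 2 ^ n" for n y
    by (simp add: abs2_mult_power2)
  show "incseq ?B"
  proof (rule incseq_SucI)
    fix n
    have "(2::real) ^ n \<le> 2 ^ Suc n" by simp
    thus "?B n \<subseteq> ?B (Suc n)" unfolding abs by (blast intro: order_trans)
  qed
  show "(\<Union>n. ?B n) = space haar2_prod"
  proof -
    have "\<exists>n. \<forall>\<nu>. abs2 (x \<nu>) \<le> 2 ^ n" for x :: "'n \<Rightarrow> q2"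
    proof -
      obtain n where n: "maxabs2 x < 2 ^ n" using real_arch_pow[of 2 "maxabs2 x"] by auto
      have "abs2 (x \<nu>) \<le> maxabs2 x" for \<nu> unfolding maxabs2_def by (rule Max_ge) auto
      thus ?thesis using n by (meson less_imp_le order_trans)
    qed
    thus ?thesis unfolding abs space by blast
  qed
  show "?B n \<in> sets haar2_prod" for n
  proof -
    have "cube_ind (int n) (\<lambda>_ :: 'n. 0) \<in> borel_measurable haar2_prod"
      using cube_ind_l2_space[of "int n" "\<lambda>_ :: 'n. 0"] by (simp add: l2_space_def)
    hence "cube_ind (int n) (\<lambda>_ :: 'n. 0) -` {1} \<inter> space haar2_prod \<in> sets haar2_prod"
      by (rule measurable_sets) simp
    also have "cube_ind (int n) (\<lambda>_ :: 'n. 0) -` {1} \<inter> space haar2_prod = ?B n"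
      unfolding Bind[symmetric] space by (auto simp: indicator_def)
    finally show ?thesis .
  qed
qed

end

theorem theorem5p3:
  fixes s :: "'n::finite \<Rightarrow> nat"
    and \<alpha> :: "'n \<Rightarrow> nat \<Rightarrow> nat \<Rightarrow> complex"
  assumes "\<And>\<nu>. admissible_coeffs (s \<nu>) (\<alpha> \<nu>)"
  shows "l2_orthonormal_basis (haar2_prod :: ('n \<Rightarrow> q2) measure)
           {(e, j, a). e \<noteq> {} \<and> (\<forall>\<nu>. a \<nu> \<in> I2)}
           (\<lambda>(e, j, a). wavelet s \<alpha> e j a)"
proof -
  interpret wavelet_system s \<alpha> by unfold_locales (rule assms)
  let ?I = "wavelet_index :: ('n set \<times> int \<times> ('n \<Rightarrow> q2)) set" and ?\<psi> = "wavelet_family s \<alpha>"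
  show ?thesis
    unfolding l2_orthonormal_basis_def wavelet_index_def[symmetric] wavelet_family_def[symmetric]
  proof (intro conjI ballI allI impI)
    show "?\<psi> i \<in> l2_space haar2_prod" if "i \<in> ?I" for i
      using that by (rule \<psi>_l2)
    show "l2_inner haar2_prod (?\<psi> i) (?\<psi> k) = (if i = k then 1 else 0)" if "i \<in> ?I" "k \<in> ?I" for i k
    proof -
      obtain e j a e' j' a' where "i = (e, j, a)" "k = (e', j', a')" by (metis prod_cases3)
      thus ?thesis using that wavelet_orthonormal[of s \<alpha> e e' a a' j j', OF assms] by (simp add: wavelet_index_def wavelet_family_def)
    qed
    fix f :: "('n \<Rightarrow> q2) \<Rightarrow> complex" and \<epsilon> :: real
    assume f: "f \<in> l2_space haar2_prod" and e: "\<epsilon> > 0"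
    have "f \<in> closed_span" using f by (simp only: closed_span_eq_l2_space)
    \<comment> \<open>The bound is the square of \<epsilon> because \<open>closed_span\<close>
      measures squared seminorms.\<close>
    then obtain F c where F: "finite F" "F \<subseteq> ?I" "(LINT x|haar2_prod. (cmod (f x - (\<Sum>i\<in>F. c i * ?\<psi> i x)))\<^sup>2) < \<epsilon>\<^sup>2"
      by (rule closed_span_E[of f "\<epsilon>\<^sup>2"]) (use e in simp)
    have "l2_norm haar2_prod (\<lambda>x. f x - (\<Sum>i\<in>F. c i * ?\<psi> i x)) < sqrt (\<epsilon>\<^sup>2)"
      unfolding l2_norm_def by (rule real_sqrt_less_mono[OF F(3)])
    also have "sqrt (\<epsilon>\<^sup>2) = \<epsilon>" using e by simp
    finally show "\<exists>F c. finite F \<and> F \<subseteq> ?I \<and> l2_norm haar2_prod (\<lambda>x. f x - (\<Sum>i\<in>F. c i * ?\<psi> i x)) < \<epsilon>"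
      using F by blast
  qed
qed

end
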